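(* Let $P \subseteq \mathbb{R}^d$ be a $d$-dimensional simplicial polytope that is a maximizer of the functional $K \mapsto L_K$ among all $d$-dimensional convex bodies $K$. Then $P$ is a simplex.
   Context: A $d$-dimensional convex body is a compact convex set in $\mathbb{R}^d$ with non-empty interior. For a $d$-dimensional convex body $K$ and $X$ uniformly distributed in $K$, let $\mu_K = \mathbb{E}(X)$ and $A(K) = \mathbb{E}\bigl((X-\mu_K)(X-\mu_K)^T\bigr)$ (the covariance matrix). The isotropic constant $L_K > 0$ is defined by $L_K^{2d} = \det(A(K))/(\mathrm{vol}(K))^2$. A polytope is the convex hull of finitely many points; it is simplicial if every facet is a simplex. *)

theory Defs
  imports "HOL-Analysis.Analysis"
begin

definition convex_body :: "(real^'n) set \<Rightarrow> bool" where
  "convex_body K \<longleftrightarrow> compact K \<and> convex K \<and> interior K \<noteq> {}"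

(* For X uniformly distributed in K, the expectation of g X is the integral of g
   with respect to the law uniform_measure lborel K of X. *)

definition centroid :: "(real^'n) set \<Rightarrow> real^'n" where
  "centroid K = (\<integral>x. x \<partial>uniform_measure lborel K)"

(* columnvector v ** rowvector v is the rank-one matrix v v^T, where the shared dimension,
   polymorphic in the library, is fixed to 1 by the type constraint.  The integral is a
   Bochner integral in the space of matrices. *)
lemma columnvector_mult_rowvector_nth:
  fixes v :: "real^'n"
  shows "(columnvector v ** (rowvector v :: real^'n^1)) $ i $ j = v $ i * v $ j"
  by (simp add: matrix_matrix_mult_def columnvector_def rowvector_def)

definition covariance_matrix :: "(real^'n) set \<Rightarrow> real^'n^'n" where
  "covariance_matrix K =
     (\<integral>x. columnvector (x - centroid K) ** (rowvector (x - centroid K) :: real^'n^1)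
        \<partial>uniform_measure lborel K)"

definition isotropic_constant :: "(real^'n) set \<Rightarrow> real" where
  "isotropic_constant K =
     root (2 * CARD('n)) (det (covariance_matrix K) / (measure lborel K)\<^sup>2)"

(* Whenever the determinant is positive, as it is for every convex body, the root
   is the positive number determined by the usual defining equation. *)
lemma isotropic_constant_unique:
  fixes K :: "(real^'n) set"
  assumes "det (covariance_matrix K) / (measure lborel K)\<^sup>2 > 0"
  shows "L = isotropic_constant K \<longleftrightarrow>
    L > 0 \<and> L ^ (2 * CARD('n)) = det (covariance_matrix K) / (measure lborel K)\<^sup>2"
  using assms
  by (auto simp: isotropic_constant_def real_root_power_cancel real_root_pow_pos2
      simp flip: real_root_pos_unique)

definition simplicial_polytope :: "(real^'n) set \<Rightarrow> bool" where
  "simplicial_polytope P \<longleftrightarrow> polytope P \<and> (\<forall>F. F facet_of P \<longrightarrow> (\<exists>n. n simplex F))"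

end

(*
  Put P in isotropic position (mean 0, covariance matrix I) and let d be the dimension.

  First variation.  Attaching to P a pyramid of height tending to 0 over a facet with vertex set V gives, in
  the limit where its apex tends to a vertex v of V,
    |v + S|^2 + |v|^2 + Q <= (d + 1) (d + 2)^2,   where S is the sum of V and Q the sum of the |u|^2, u in V.
  Weighted by the volumes of the cones over the facets, these inequalities add up to an equality, because the
  trace of the covariance matrix is d.  So all of them are equalities, that is, v . (v + S) = (d + 1) (d + 2)
  for every vertex v of every facet.  These equations determine the neighbour of a facet across a ridge: the
  two opposite vertices are mirror images in the linear hyperplane spanned by the ridge.  Walking from facet
  to facet, P itself is symmetric in that hyperplane.

  Second variation.  Let g be the height of P over the mirror.  Shearing P along the normal n by a multiple
  t (g - l) n, with l the affine regression of g on P, keeps it convex for small |t| because P is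
  symmetric, preserves the volume, and adds the variance of g - l times t^2 to the variance in the direction n.
  So g = l is affine, and P is the convex hull of the two facets sharing the ridge, which is a simplex.
*)

theory Submission
  imports Defs
begin

text \<open>The constants come from linearizing \<open>det A(K) \<le> (vol K / vol P)^2\<close>,
  which is what maximality says once P is isotropic. Adding a small volume changes the determinant
  by the trace of the change, because the covariance matrix starts at I, and the moving centroid
  enters only to second order; so the mean of |x|^2 over the added piece is at most d + 2. For a
  simplex this mean is a quadratic expression in the vertices divided by (d + 1)(d + 2), whence (d +
  1)(d + 2)^2. An apex has to stay over the relative interior of a facet, where the hull gains a
  single pyramid; hence the passage to the limit at the vertices. That neighbours are determined
  helps only if any facet can be reached from any other across ridges; a segment in general position
  through the cones over the facets supplies the path. In the second variation, subtracting the
  affine l composes the shear with an affine map, which is free. The regression is the choice that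
  keeps the centroid and makes the change of the covariance matrix of rank one, so that its
  determinant is explicit.\<close>

section \<open>Change of variables for the Lebesgue integral\<close>

lemma Basis_cart: "(Basis :: (real^'n) set) = range (\<lambda>i. axis i 1)"
  by (auto simp: Basis_vec_def)

lemma inj_axis: "inj (\<lambda>i. axis i (1::real))"
  by (auto simp: inj_def axis_eq_axis)

lemma sum_Basis_cart: "(\<Sum>b\<in>Basis. f b) = (\<Sum>i\<in>UNIV. f (axis i 1 :: real^'n))"
  unfolding Basis_cart by (simp add: sum.reindex[OF inj_axis])

lemma prod_Basis_cart: "(\<Prod>b\<in>Basis. f b) = (\<Prod>i\<in>UNIV. f (axis i 1 :: real^'n))"
  unfolding Basis_cart by (simp add: prod.reindex[OF inj_axis])

lemma nn_integral_lborel_translation: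
  fixes f :: "'a::euclidean_space \<Rightarrow> ennreal"
  assumes [measurable]: "f \<in> borel_measurable borel"
  shows "(\<integral>\<^sup>+x. f (c + x) \<partial>lborel) = (\<integral>\<^sup>+x. f x \<partial>lborel)"
proof -
  have "(\<integral>\<^sup>+x. f x \<partial>lborel) = (\<integral>\<^sup>+x. f x \<partial>distr lborel borel ((+) c))"
    by (simp add: lborel_distr_plus)
  also have "\<dots> = (\<integral>\<^sup>+x. f (c + x) \<partial>lborel)"
    by (subst nn_integral_distr) auto
  finally show ?thesis by simp
qed

text \<open>
  Averaging over the translations by \<open>s *\<^sub>R n\<close>, which commute with the shear, reduces the
  claim to the translation invariance of the one-dimensional Lebesgue measure in \<open>s\<close>.
\<close>

lemma nn_integral_shear:
  fixes g :: "'a::euclidean_space \<Rightarrow> ennreal" and \<alpha> :: "'a \<Rightarrow> real"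
  assumes [measurable]: "g \<in> borel_measurable borel" "\<alpha> \<in> borel_measurable borel"
    and inv: "\<And>x s. \<alpha> (x + s *\<^sub>R n) = \<alpha> x"
  shows "(\<integral>\<^sup>+x. g (x + \<alpha> x *\<^sub>R n) \<partial>lborel) = (\<integral>\<^sup>+x. g x \<partial>lborel)"
proof -
  define \<psi> :: "real \<Rightarrow> ennreal" where "\<psi> = indicator {0..1}"
  have [measurable]: "\<psi> \<in> borel_measurable borel"
    by (simp add: \<psi>_def)
  have \<psi>: "(\<integral>\<^sup>+s. \<psi> s \<partial>lborel) = 1"
    by (simp add: \<psi>_def)
  have \<psi>': "(\<integral>\<^sup>+s. \<psi> (s - c) \<partial>lborel) = 1" for c
    using nn_integral_lborel_translation[of \<psi> "-c"] \<psi> by simp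
  have tr: "(\<integral>\<^sup>+x. g (x + \<alpha> x *\<^sub>R n) \<partial>lborel) = (\<integral>\<^sup>+x. g (x + (s + \<alpha> x) *\<^sub>R n) \<partial>lborel)" for s
  proof -
    have "(\<integral>\<^sup>+x. g (x + \<alpha> x *\<^sub>R n) \<partial>lborel)
        = (\<integral>\<^sup>+x. g ((s *\<^sub>R n + x) + \<alpha> (s *\<^sub>R n + x) *\<^sub>R n) \<partial>lborel)"
      by (rule nn_integral_lborel_translation[symmetric]) measurable
    then show ?thesis
      using inv by (simp add: algebra_simps)
  qed
  have tr': "(\<integral>\<^sup>+x. \<psi> (s - \<alpha> x) * g (x + s *\<^sub>R n) \<partial>lborel) = (\<integral>\<^sup>+x. \<psi> (s - \<alpha> x) * g x \<partial>lborel)" for s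
  proof -
    have "(\<integral>\<^sup>+x. \<psi> (s - \<alpha> x) * g x \<partial>lborel)
        = (\<integral>\<^sup>+x. \<psi> (s - \<alpha> (s *\<^sub>R n + x)) * g (s *\<^sub>R n + x) \<partial>lborel)"
      by (rule nn_integral_lborel_translation[symmetric]) measurable
    then show ?thesis
      using inv by (simp add: algebra_simps)
  qed
  have "(\<integral>\<^sup>+x. g (x + \<alpha> x *\<^sub>R n) \<partial>lborel)
      = (\<integral>\<^sup>+s. \<psi> s * (\<integral>\<^sup>+x. g (x + \<alpha> x *\<^sub>R n) \<partial>lborel) \<partial>lborel)"
    by (simp add: nn_integral_multc \<psi>)
  also have "\<dots> = (\<integral>\<^sup>+s. \<integral>\<^sup>+x. \<psi> s * g (x + (s + \<alpha> x) *\<^sub>R n) \<partial>lborel \<partial>lborel)"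
    by (intro nn_integral_cong) (subst nn_integral_cmult, measurable, subst tr, rule refl)
  also have "\<dots> = (\<integral>\<^sup>+x. \<integral>\<^sup>+s. \<psi> s * g (x + (s + \<alpha> x) *\<^sub>R n) \<partial>lborel \<partial>lborel)"
    by (rule lborel_pair.Fubini') measurable
  \<comment> \<open>For fixed \<open>x\<close>, substituting \<open>s - \<alpha> x\<close> for
    \<open>s\<close> moves the shear out of the argument of \<open>g\<close> and into the weight
    \<open>\<psi>\<close>, whose integral is 1 wherever it is shifted.\<close>
  also have "\<dots> = (\<integral>\<^sup>+x. \<integral>\<^sup>+s. \<psi> (s - \<alpha> x) * g (x + s *\<^sub>R n) \<partial>lborel \<partial>lborel)"
  proof (rule nn_integral_cong)
    fix x
    have "(\<integral>\<^sup>+s. \<psi> ((\<alpha> x + s) - \<alpha> x) * g (x + (\<alpha> x + s) *\<^sub>R n) \<partial>lborel)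
        = (\<integral>\<^sup>+s. \<psi> (s - \<alpha> x) * g (x + s *\<^sub>R n) \<partial>lborel)"
      by (rule nn_integral_lborel_translation) measurable
    then show "(\<integral>\<^sup>+s. \<psi> s * g (x + (s + \<alpha> x) *\<^sub>R n) \<partial>lborel)
        = (\<integral>\<^sup>+s. \<psi> (s - \<alpha> x) * g (x + s *\<^sub>R n) \<partial>lborel)"
      by (simp add: add.commute)
  qed
  also have "\<dots> = (\<integral>\<^sup>+s. \<integral>\<^sup>+x. \<psi> (s - \<alpha> x) * g (x + s *\<^sub>R n) \<partial>lborel \<partial>lborel)"
    by (rule lborel_pair.Fubini') measurable
  also have "\<dots> = (\<integral>\<^sup>+s. \<integral>\<^sup>+x. \<psi> (s - \<alpha> x) * g x \<partial>lborel \<partial>lborel)"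
    by (simp add: tr')
  also have "\<dots> = (\<integral>\<^sup>+x. \<integral>\<^sup>+s. \<psi> (s - \<alpha> x) * g x \<partial>lborel \<partial>lborel)"
    by (rule lborel_pair.Fubini') measurable
  also have "\<dots> = (\<integral>\<^sup>+x. g x \<partial>lborel)"
    by (simp add: nn_integral_multc \<psi>')
  finally show ?thesis .
qed

text \<open>Induction over a factorization into elementary maps: scalings are known, coordinate
  swaps preserve the volume of boxes, and a transvection is a shear. The condition on the
  determinant passes to both factors of a composition and discards the maps that annihilate a
  coordinate. Nonnegative integrals come first because composition then raises no question of
  integrability.\<close>

lemma nn_integral_lborel_linear:
  fixes f :: "real^'n \<Rightarrow> real^'n" and g :: "real^'n \<Rightarrow> ennreal"
  assumes "linear f" "det (matrix f) \<noteq> 0" "g \<in> borel_measurable borel"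
  shows "(\<integral>\<^sup>+x. g x \<partial>lborel) = ennreal \<bar>det (matrix f)\<bar> * (\<integral>\<^sup>+x. g (f x) \<partial>lborel)"
proof -
  have bm: "h \<in> borel_measurable borel" if "linear h" for h :: "real^'n \<Rightarrow> real^'n"
    using that by (intro borel_measurable_continuous_onI linear_continuous_on linear_conv_bounded_linear[THEN iffD1])
  let ?P = "\<lambda>f :: real^'n \<Rightarrow> real^'n. linear f \<and> (det (matrix f) \<noteq> 0 \<longrightarrow>
     (\<forall>g\<in>borel_measurable borel. (\<integral>\<^sup>+x. g x \<partial>lborel) = ennreal \<bar>det (matrix f)\<bar> * (\<integral>\<^sup>+x. g (f x) \<partial>lborel)))"
  have "?P f"
  proof (rule induct_linear_elementary[OF \<open>linear f\<close>])
    fix f h :: "real^'n \<Rightarrow> real^'n"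
    assume lin: "linear f" "linear h" and P: "?P f" "?P h"
    have d: "det (matrix (f \<circ> h)) = det (matrix f) * det (matrix h)"
      by (simp add: matrix_compose lin det_mul)
    show "?P (f \<circ> h)"
    proof (intro conjI impI ballI)
      show "linear (f \<circ> h)" using lin by (simp add: linear_compose)
      fix g :: "real^'n \<Rightarrow> ennreal" assume g: "g \<in> borel_measurable borel"
      assume "det (matrix (f \<circ> h)) \<noteq> 0"
      with d have nz: "det (matrix f) \<noteq> 0" "det (matrix h) \<noteq> 0" by auto
      have "(\<lambda>x. g (f x)) \<in> borel_measurable borel"
        using measurable_compose[OF bm[OF lin(1)] g] .
      then have "(\<integral>\<^sup>+x. g (f x) \<partial>lborel) = ennreal \<bar>det (matrix h)\<bar> * (\<integral>\<^sup>+x. g (f (h x)) \<partial>lborel)"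
        using P(2) nz(2) by blast
      moreover have "(\<integral>\<^sup>+x. g x \<partial>lborel) = ennreal \<bar>det (matrix f)\<bar> * (\<integral>\<^sup>+x. g (f x) \<partial>lborel)"
        using P(1) nz(1) g by blast
      ultimately show "(\<integral>\<^sup>+x. g x \<partial>lborel)
          = ennreal \<bar>det (matrix (f \<circ> h))\<bar> * (\<integral>\<^sup>+x. g ((f \<circ> h) x) \<partial>lborel)"
        by (simp add: d abs_mult ennreal_mult mult.assoc)
    qed
  next
    fix f :: "real^'n \<Rightarrow> real^'n" and i
    assume "linear f" and 0: "\<And>x. f x $ i = 0"
    then have "\<not> inj f"
      by (metis (full_types) linear_injective_imp_surjective one_neq_zero surjE vec_component)
    then show "?P f"
      using \<open>linear f\<close> det_nz_iff_inj by blast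
  next
    fix c :: "'n \<Rightarrow> real"
    let ?f = "\<lambda>x::real^'n. \<chi> i. c i * x $ i"
    have lin: "linear ?f"
      by (intro linearI) (auto simp: vec_eq_iff algebra_simps)
    have d: "det (matrix ?f) = prod c UNIV"
      by (simp add: axis_def matrix_def det_diagonal)
    show "?P ?f"
    proof (intro conjI lin impI ballI)
      fix g :: "real^'n \<Rightarrow> ennreal" assume g: "g \<in> borel_measurable borel"
      assume "det (matrix ?f) \<noteq> 0"
      then have nz: "c i \<noteq> 0" for i using d by simp
      define c' :: "real^'n \<Rightarrow> real" where "c' j = c (SOME i. j = axis i 1)" for j
      have c': "c' (axis i 1) = c i" for i
        by (simp add: c'_def axis_eq_axis)
      have f_eq: "?f = (\<lambda>x. 0 + (\<Sum>j\<in>Basis. (c' j * (x \<bullet> j)) *\<^sub>R j))"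
      proof
        fix x :: "real^'n"
        have "(\<Sum>j\<in>Basis. (c' j * (x \<bullet> j)) *\<^sub>R j) = (\<Sum>k\<in>UNIV. (c k * x $ k) *\<^sub>R axis k 1)"
          by (simp add: sum_Basis_cart c' inner_axis)
        also have "\<dots> = ?f x"
          by (auto simp: vec_eq_iff axis_def if_distrib cong: if_cong)
        finally show "?f x = 0 + (\<Sum>j\<in>Basis. (c' j * (x \<bullet> j)) *\<^sub>R j)"
          by simp
      qed
      have "c' j \<noteq> 0" if "j \<in> Basis" for j
        using that nz c' by (auto simp: Basis_vec_def)
      then have eq: "lborel = density (distr lborel borel ?f) (\<lambda>_. (\<Prod>j\<in>Basis. \<bar>c' j\<bar>))"
        unfolding f_eq by (rule lborel_affine_euclidean)
      have pr: "(\<Prod>j\<in>(Basis::(real^'n) set). \<bar>c' j\<bar>) = \<bar>prod c UNIV\<bar>"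
        by (simp add: prod_Basis_cart c' abs_prod)
      have "(\<integral>\<^sup>+x. g x \<partial>lborel) = (\<integral>\<^sup>+x. g x \<partial>density (distr lborel borel ?f) (\<lambda>_. (\<Prod>j\<in>Basis. \<bar>c' j\<bar>)))"
        by (subst eq) (rule refl)
      also have "\<dots> = ennreal \<bar>prod c UNIV\<bar> * (\<integral>\<^sup>+x. g (?f x) \<partial>lborel)"
        unfolding pr using g bm[OF lin]
        by (simp add: nn_integral_density nn_integral_cmult nn_integral_distr)
      finally show "(\<integral>\<^sup>+x. g x \<partial>lborel) = ennreal \<bar>det (matrix ?f)\<bar> * (\<integral>\<^sup>+x. g (?f x) \<partial>lborel)"
        by (simp add: d)
    qed
  next
    fix m n :: 'n assume "m \<noteq> n"
    let ?t = "Transposition.transpose m n"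
    let ?f = "\<lambda>x::real^'n. \<chi> i. x $ ?t i"
    have lin: "linear ?f"
      by (intro linearI) (auto simp: vec_eq_iff algebra_simps)
    have "matrix ?f = transpose (\<chi> i. (mat 1 :: real^'n^'n) $ ?t i)"
      by (auto simp: matrix_def transpose_def vec_eq_iff axis_def mat_def Transposition.transpose_def)
    then have d: "\<bar>det (matrix ?f)\<bar> = 1"
      using det_permute_rows[of ?t "mat 1 :: real^'n^'n"] permutes_swap_id[of m UNIV n]
      by (simp add: abs_mult sign_swap_id \<open>m \<noteq> n\<close>)
    have eq: "lborel = distr lborel borel ?f"
    proof (rule lborel_eqI)
      fix l u :: "real^'n" assume le: "\<And>b. b \<in> Basis \<Longrightarrow> l \<bullet> b \<le> u \<bullet> b"
      have vim: "?f -` box l u = box (?f l) (?f u)"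
        by (auto simp: mem_box_cart) (metis transpose_involutory)+
      have le': "l $ i \<le> u $ i" for i
        using le[of "axis i 1"] by (auto simp: inner_axis)
      have "(\<Prod>i\<in>UNIV. u $ ?t i - l $ ?t i) = (\<Prod>i\<in>UNIV. u $ i - l $ i)"
        using prod.permute[OF permutes_swap_id[of m UNIV n], of "\<lambda>i. u $ i - l $ i"] by (simp add: o_def)
      then have "(\<Prod>b\<in>Basis. (?f u - ?f l) \<bullet> b) = (\<Prod>b\<in>Basis. (u - l) \<bullet> b)"
        by (simp add: prod_Basis_cart inner_axis)
      moreover have "?f l \<bullet> b \<le> ?f u \<bullet> b" if "b \<in> Basis" for b
        using that le' by (auto simp: Basis_vec_def inner_axis)
      ultimately show "emeasure (distr lborel borel ?f) (box l u) = ennreal (\<Prod>b\<in>Basis. (u - l) \<bullet> b)"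
        using bm[OF lin] by (simp add: emeasure_distr vim emeasure_lborel_box)
    qed simp
    show "?P ?f"
    proof (intro conjI lin impI ballI)
      fix g :: "real^'n \<Rightarrow> ennreal" assume g: "g \<in> borel_measurable borel"
      have "(\<integral>\<^sup>+x. g x \<partial>lborel) = (\<integral>\<^sup>+x. g x \<partial>distr lborel borel ?f)"
        by (subst eq) (rule refl)
      then show "(\<integral>\<^sup>+x. g x \<partial>lborel) = ennreal \<bar>det (matrix ?f)\<bar> * (\<integral>\<^sup>+x. g (?f x) \<partial>lborel)"
        using g bm[OF lin] by (simp add: nn_integral_distr d)
    qed
  next
    fix m n :: 'n assume "m \<noteq> n"
    let ?f = "\<lambda>x::real^'n. \<chi> i. if i = m then x $ m + x $ n else x $ i"
    have lin: "linear ?f"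
      by (intro linearI) (auto simp: vec_eq_iff algebra_simps)
    have "matrix ?f = (\<chi> k. if k = m then row m (mat 1) + 1 *s row n (mat 1) else row k (mat 1 :: real^'n^'n))"
      by (auto simp: matrix_def vec_eq_iff axis_def mat_def row_def)
    then have d: "det (matrix ?f) = 1"
      using det_row_operation[OF \<open>m \<noteq> n\<close>, where c = 1 and A = "mat 1 :: real^'n^'n"] by simp
    have f_eq: "?f x = x + (x $ n) *\<^sub>R axis m 1" for x
      using \<open>m \<noteq> n\<close> by (auto simp: vec_eq_iff axis_def)
    show "?P ?f"
    proof (intro conjI lin impI ballI)
      fix g :: "real^'n \<Rightarrow> ennreal" assume g: "g \<in> borel_measurable borel"
      have "(\<integral>\<^sup>+x. g (x + (x $ n) *\<^sub>R axis m 1) \<partial>lborel) = (\<integral>\<^sup>+x. g x \<partial>lborel)"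
        using \<open>m \<noteq> n\<close> by (intro nn_integral_shear g) (auto simp: axis_def)
      then show "(\<integral>\<^sup>+x. g x \<partial>lborel) = ennreal \<bar>det (matrix ?f)\<bar> * (\<integral>\<^sup>+x. g (?f x) \<partial>lborel)"
        unfolding f_eq[symmetric] by (simp add: d)
    qed
  qed
  then show ?thesis using assms by blast
qed

text \<open>Obtained from an equality of measures, so that \<open>g\<close> may be any measurable
  function: if it is not integrable, both sides are 0 by default.\<close>

lemma integral_lborel_affine:
  fixes f :: "real^'n \<Rightarrow> real^'n" and g :: "real^'n \<Rightarrow> real"
  assumes lin: "linear f" and nz: "det (matrix f) \<noteq> 0" and g: "g \<in> borel_measurable borel"
  shows "(\<integral>x. g x \<partial>lborel) = \<bar>det (matrix f)\<bar> * (\<integral>x. g (c + f x) \<partial>lborel)"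
proof -
  have fm [measurable]: "f \<in> borel_measurable borel"
    using lin by (intro borel_measurable_continuous_onI linear_continuous_on linear_conv_bounded_linear[THEN iffD1])
  have eq: "lborel = density (distr lborel borel (\<lambda>x. c + f x)) (\<lambda>_. ennreal \<bar>det (matrix f)\<bar>)"
  proof (rule measure_eqI)
    fix S :: "(real^'n) set" assume "S \<in> sets lborel"
    then have [measurable]: "S \<in> sets borel" by simp
    have "emeasure lborel S = (\<integral>\<^sup>+x. indicator S x \<partial>lborel)"
      by simp
    also have "\<dots> = (\<integral>\<^sup>+x. indicator S (c + x) \<partial>lborel)"
      by (rule nn_integral_lborel_translation[symmetric]) measurable
    also have "\<dots> = ennreal \<bar>det (matrix f)\<bar> * (\<integral>\<^sup>+x. indicator S (c + f x) \<partial>lborel)"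
      by (rule nn_integral_lborel_linear[OF lin nz]) measurable
    also have "\<dots> = ennreal \<bar>det (matrix f)\<bar> * (\<integral>\<^sup>+x. indicator S x \<partial>distr lborel borel (\<lambda>x. c + f x))"
      by (subst nn_integral_distr) auto
    also have "\<dots> = emeasure (density (distr lborel borel (\<lambda>x. c + f x)) (\<lambda>_. ennreal \<bar>det (matrix f)\<bar>)) S"
      by (simp add: emeasure_density nn_integral_cmult)
    finally show "emeasure lborel S
        = emeasure (density (distr lborel borel (\<lambda>x. c + f x)) (\<lambda>_. ennreal \<bar>det (matrix f)\<bar>)) S" .
  qed simp
  have "(\<integral>x. g x \<partial>lborel)
      = (\<integral>x. g x \<partial>density (distr lborel borel (\<lambda>x. c + f x)) (\<lambda>_. ennreal \<bar>det (matrix f)\<bar>))"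
    by (subst eq) (rule refl)
  also have "\<dots> = \<bar>det (matrix f)\<bar> * (\<integral>x. g (c + f x) \<partial>lborel)"
    using g by (simp add: integral_density integral_distr)
  finally show ?thesis .
qed

text \<open>The second variation shears by a height function that is not known to be linear, so the
  determinant formula does not cover it; measurability and constancy along \<open>n\<close> are
  enough.\<close>

lemma integral_lborel_shear:
  fixes g :: "'a::euclidean_space \<Rightarrow> real" and \<alpha> :: "'a \<Rightarrow> real"
  assumes g: "g \<in> borel_measurable borel" and \<alpha> [measurable]: "\<alpha> \<in> borel_measurable borel"
    and inv: "\<And>x s. \<alpha> (x + s *\<^sub>R n) = \<alpha> x"
  shows "(\<integral>x. g (x + \<alpha> x *\<^sub>R n) \<partial>lborel) = (\<integral>x. g x \<partial>lborel)"
proof -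
  have eq: "lborel = distr lborel borel (\<lambda>x. x + \<alpha> x *\<^sub>R n)"
  proof (rule measure_eqI)
    fix S :: "'a set" assume "S \<in> sets lborel"
    then have [measurable]: "S \<in> sets borel" by simp
    have "emeasure lborel S = (\<integral>\<^sup>+x. indicator S x \<partial>lborel)"
      by simp
    also have "\<dots> = (\<integral>\<^sup>+x. indicator S (x + \<alpha> x *\<^sub>R n) \<partial>lborel)"
      by (rule nn_integral_shear[symmetric]) (use inv in auto)
    also have "\<dots> = (\<integral>\<^sup>+x. indicator S x \<partial>distr lborel borel (\<lambda>x. x + \<alpha> x *\<^sub>R n))"
      by (subst nn_integral_distr) auto
    finally show "emeasure lborel S = emeasure (distr lborel borel (\<lambda>x. x + \<alpha> x *\<^sub>R n)) S"
      by simp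
  qed simp
  have "(\<integral>x. g x \<partial>lborel) = (\<integral>x. g x \<partial>distr lborel borel (\<lambda>x. x + \<alpha> x *\<^sub>R n))"
    by (subst eq[symmetric]) (rule refl)
  then show ?thesis
    using g by (simp add: integral_distr)
qed

lemma set_integral_affine_image:
  fixes f :: "real^'n \<Rightarrow> real^'n" and g :: "real^'n \<Rightarrow> real"
  assumes lin: "linear f" and nz: "det (matrix f) \<noteq> 0" and S: "compact S"
    and g: "g \<in> borel_measurable borel"
  shows "(LINT x:(\<lambda>x. c + f x) ` S|lborel. g x) = \<bar>det (matrix f)\<bar> * (LINT x:S|lborel. g (c + f x))"
proof -
  have inj: "inj f"
    using nz det_nz_iff_inj[OF lin] by blast
  have "compact ((\<lambda>x. c + f x) ` S)"
    using S lin by (intro compact_continuous_image continuous_intros linear_continuous_on linear_conv_bounded_linear[THEN iffD1])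
  then have m [measurable]: "(\<lambda>x. c + f x) ` S \<in> sets borel"
    by (auto dest: compact_imp_closed)
  have "(LINT x:(\<lambda>x. c + f x) ` S|lborel. g x)
      = (\<integral>x. indicator ((\<lambda>x. c + f x) ` S) x * g x \<partial>lborel)"
    by (simp add: set_lebesgue_integral_def)
  also have "\<dots> = \<bar>det (matrix f)\<bar> * (\<integral>x. indicator ((\<lambda>x. c + f x) ` S) (c + f x) * g (c + f x) \<partial>lborel)"
    using g by (intro integral_lborel_affine lin nz) measurable
  also have "(\<lambda>x. indicator ((\<lambda>x. c + f x) ` S) (c + f x) :: real) = indicator S"
    using inj by (auto simp: indicator_def fun_eq_iff inj_eq)
  finally show ?thesis
    by (simp add: set_lebesgue_integral_def)
qed

section \<open>Affine invariance and isotropic position\<close>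

text \<open>This is L_K to the power 2d; the root is monotone, so maximality can be expressed
  without it.\<close>

definition affine_invariant :: "(real^'n) set \<Rightarrow> real" where
  "affine_invariant K = det (covariance_matrix K) / (measure lborel K)\<^sup>2"

text \<open>Mean 0 and covariance matrix I, tested against linear functionals and multiplied through
  by the volume.\<close>

definition isotropic :: "(real^'n) set \<Rightarrow> bool" where
  "isotropic K \<longleftrightarrow> convex_body K \<and> (\<forall>a. (LINT x:K|lborel. a \<bullet> x) = 0) \<and>
     (\<forall>a b. (LINT x:K|lborel. (a \<bullet> x) * (b \<bullet> x)) = measure lborel K * (a \<bullet> b))"

lemma isotropic_constant_le_iff:
  fixes K L :: "(real^'n) set"
  shows "isotropic_constant K \<le> isotropic_constant L \<longleftrightarrow> affine_invariant K \<le> affine_invariant L"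
  by (simp add: isotropic_constant_def affine_invariant_def)

lemma set_integrable_compact:
  fixes f :: "'a::euclidean_space \<Rightarrow> 'b::{banach, second_countable_topology}"
  assumes "compact S" "continuous_on S f"
  shows "set_integrable lborel S f"
  using borel_integrable_compact[OF assms] by (simp add: set_integrable_def)

lemma convex_body_measure_pos:
  assumes "convex_body K"
  shows "0 < measure lborel K"
proof -
  have K: "compact K" "interior K \<noteq> {}"
    using assms by (auto simp: convex_body_def)
  then have "measure lborel K \<noteq> 0"
    using negligible_iff_measure0[of K] lmeasurable_compact[of K] open_not_negligible[of "interior K"]
      negligible_subset[OF _ interior_subset] by (auto dest: compact_imp_closed)
  then show ?thesis
    using zero_less_measure_iff by blast
qed

lemma convex_body_if_measure_pos:
  fixes K :: "(real^'n) set"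
  assumes "compact K" "convex K" "0 < measure lborel K"
  shows "convex_body K"
proof -
  have "\<not> negligible K"
    using assms negligible_imp_measure0[of K] by (auto dest: compact_imp_closed)
  then show ?thesis
    using assms negligible_convex_interior by (auto simp: convex_body_def)
qed

lemma integral_uniform_measure_compact:
  fixes f :: "real^'n \<Rightarrow> 'b::{banach, second_countable_topology}"
  assumes K: "compact K" and pos: "0 < measure lborel K" and f: "continuous_on UNIV f"
  shows "(\<integral>x. f x \<partial>uniform_measure lborel K) = (1 / measure lborel K) *\<^sub>R (LINT x:K|lborel. f x)"
proof -
  have [measurable]: "K \<in> sets borel" using K by (auto dest: compact_imp_closed)
  have [measurable]: "f \<in> borel_measurable borel" using f by (rule borel_measurable_continuous_onI)
  have em: "emeasure lborel K = ennreal (measure lborel K)"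
    using emeasure_compact_finite[OF K] by (intro emeasure_eq_ennreal_measure) auto
  have eq: "indicator K x / emeasure lborel K = ennreal (indicator K x / measure lborel K)" for x
    unfolding em using pos by (auto simp: indicator_def divide_ennreal[symmetric])
  have "(\<integral>x. f x \<partial>uniform_measure lborel K)
      = (\<integral>x. f x \<partial>density lborel (\<lambda>x. ennreal (indicator K x / measure lborel K)))"
    by (simp add: uniform_measure_def eq)
  also have "\<dots> = (\<integral>x. (indicator K x / measure lborel K) *\<^sub>R f x \<partial>lborel)"
    by (subst integral_density) auto
  also have "(\<lambda>x. (indicator K x / measure lborel K) *\<^sub>R f x)
      = (\<lambda>x. (1 / measure lborel K) *\<^sub>R (indicator K x *\<^sub>R f x))"
    by (auto simp: fun_eq_iff)
  also have "integral\<^sup>L lborel \<dots> = (1 / measure lborel K) *\<^sub>R (LINT x:K|lborel. f x)"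
    by (simp only: integral_scaleR_right set_lebesgue_integral_def)
  finally show ?thesis .
qed

lemma set_integral_Un_negligible:
  fixes g :: "'a::euclidean_space \<Rightarrow> real"
  assumes c: "compact A" "compact B" and neg: "negligible (A \<inter> B)" and g: "continuous_on UNIV g"
  shows "(LINT x:A \<union> B|lborel. g x) = (LINT x:A|lborel. g x) + (LINT x:B|lborel. g x)"
proof (rule set_integral_Un_AE)
  have "A \<inter> B \<in> sets borel" using c by (auto dest!: compact_imp_closed)
  then have "A \<inter> B \<in> null_sets lborel"
    using neg by (auto simp: negligible_iff_null_sets null_sets_completion_iff)
  from AE_not_in[OF this] show "AE x in lborel. \<not> (x \<in> A \<and> x \<in> B)" by simp
qed (use c g in \<open>auto intro!: set_integrable_compact intro: continuous_on_subset dest: compact_imp_closed\<close>)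

lemma set_integral_UN_negligible:
  fixes g :: "'a::euclidean_space \<Rightarrow> real"
  assumes "finite I" and c: "\<And>i. i \<in> I \<Longrightarrow> compact (A i)"
    and neg: "\<And>i j. i \<in> I \<Longrightarrow> j \<in> I \<Longrightarrow> i \<noteq> j \<Longrightarrow> negligible (A i \<inter> A j)" and g: "continuous_on UNIV g"
  shows "(LINT x:(\<Union>i\<in>I. A i)|lborel. g x) = (\<Sum>i\<in>I. LINT x:A i|lborel. g x)"
  using assms(1) c neg
proof (induction I)
  case (insert i I)
  have "negligible (A i \<inter> (\<Union>j\<in>I. A j))"
  proof -
    have "negligible (A i \<inter> A j)" if "j \<in> I" for j
      by (rule insert.prems(2)) (use that insert.hyps in auto)
    then have "negligible (\<Union>j\<in>I. A i \<inter> A j)"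
      using insert.hyps by (intro negligible_Union finite_imageI) auto
    then show ?thesis by (simp only: Int_UN_distrib)
  qed
  moreover have "compact (\<Union>j\<in>I. A j)" using insert by (intro compact_UN) auto
  ultimately show ?case
    using insert set_integral_Un_negligible[OF _ _ _ g, of "A i" "\<Union>j\<in>I. A j"] by simp
qed (simp add: set_lebesgue_integral_def)

lemma set_integral_inner:
  fixes f :: "'a::euclidean_space \<Rightarrow> 'b::euclidean_space"
  assumes "compact S" "continuous_on S f"
  shows "b \<bullet> (LINT x:S|lborel. f x) = (LINT x:S|lborel. b \<bullet> f x)"
  using integral_inner_right[of b lborel "\<lambda>x. indicator S x *\<^sub>R f x"]
    borel_integrable_compact[OF assms]
  by (simp add: set_lebesgue_integral_def)

lemma set_integral_const:
  assumes "compact S"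
  shows "(LINT x:S|lborel. c) = measure lborel S * (c::real)"
  using assms by (simp add: set_lebesgue_integral_def emeasure_compact_finite compact_imp_closed)

lemma centroid_inner:
  assumes K: "compact K" and pos: "0 < measure lborel K"
  shows "a \<bullet> centroid K = (LINT x:K|lborel. a \<bullet> x) / measure lborel K"
proof -
  have "a \<bullet> (LINT x:K|lborel. x) = (LINT x:K|lborel. a \<bullet> x)"
    by (rule set_integral_inner) (auto intro: K)
  then show ?thesis
    unfolding centroid_def
    by (subst integral_uniform_measure_compact[OF K pos]) auto
qed

lemma covariance_matrix_nth:
  fixes K :: "(real^'n) set"
  assumes K: "compact K" and pos: "0 < measure lborel K"
  shows "covariance_matrix K $ i $ j
    = (LINT x:K|lborel. (x - centroid K) $ i * (x - centroid K) $ j) / measure lborel K"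
proof -
  let ?f = "\<lambda>x::real^'n. columnvector (x - centroid K) ** (rowvector (x - centroid K) :: real^'n^1)"
  have f: "?f x = (\<chi> i j. (x - centroid K) $ i * (x - centroid K) $ j)" for x
    by (simp add: vec_eq_iff columnvector_mult_rowvector_nth)
  have cont: "continuous_on S ?f" for S
    unfolding f by (intro continuous_intros)
  have nth: "A $ i $ j = axis i (axis j 1) \<bullet> A" for A :: "real^'n^'n"
    by (simp add: inner_axis')
  have "axis i (axis j 1) \<bullet> covariance_matrix K
      = (1 / measure lborel K) * (LINT x:K|lborel. axis i (axis j 1) \<bullet> ?f x)"
    unfolding covariance_matrix_def
    by (subst integral_uniform_measure_compact[OF K pos cont]) (simp add: set_integral_inner[OF K cont])
  then show ?thesis
    by (simp only: nth) (simp only: nth[symmetric] columnvector_mult_rowvector_nth, simp)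
qed

lemma set_integral_covariance:
  assumes K: "compact K" and pos: "0 < measure lborel K"
  shows "(LINT x:K|lborel. (a \<bullet> (x - centroid K)) * (b \<bullet> (x - centroid K))) / measure lborel K
    = (LINT x:K|lborel. (a \<bullet> x) * (b \<bullet> x)) / measure lborel K
      - (LINT x:K|lborel. a \<bullet> x) / measure lborel K * ((LINT x:K|lborel. b \<bullet> x) / measure lborel K)"
proof -
  let ?c = "centroid K" and ?V = "measure lborel K"
  have int: "set_integrable lborel K (\<lambda>x. (a \<bullet> x) * (b \<bullet> x))"
    "set_integrable lborel K (\<lambda>x. (a \<bullet> ?c) * (b \<bullet> x))" "set_integrable lborel K (\<lambda>x. (b \<bullet> ?c) * (a \<bullet> x))"
    "set_integrable lborel K (\<lambda>x. (a \<bullet> ?c) * (b \<bullet> ?c))"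
    by (intro set_integrable_compact K continuous_intros)+
  have "(LINT x:K|lborel. (a \<bullet> (x - ?c)) * (b \<bullet> (x - ?c)))
      = (LINT x:K|lborel. (a \<bullet> x) * (b \<bullet> x) - (a \<bullet> ?c) * (b \<bullet> x) - (b \<bullet> ?c) * (a \<bullet> x) + (a \<bullet> ?c) * (b \<bullet> ?c))"
    by (simp add: algebra_simps)
  also have "\<dots> = (LINT x:K|lborel. (a \<bullet> x) * (b \<bullet> x)) - (a \<bullet> ?c) * (LINT x:K|lborel. b \<bullet> x)
      - (b \<bullet> ?c) * (LINT x:K|lborel. a \<bullet> x) + ?V * ((a \<bullet> ?c) * (b \<bullet> ?c))"
    using int by (simp add: set_integral_diff set_integral_add set_integral_const[OF K])
  moreover have "(Q - A / V * B - B / V * A + V * (A / V * (B / V))) / V = Q / V - A / V * (B / V)"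
    if "0 < V" for Q A B V :: real
    using that by (simp add: field_simps)
  ultimately show ?thesis
    using pos by (simp add: centroid_inner[OF K pos])
qed

lemma covariance_matrix_nth':
  fixes K :: "(real^'n) set"
  assumes K: "compact K" and pos: "0 < measure lborel K"
  shows "covariance_matrix K $ i $ j = (LINT x:K|lborel. x $ i * x $ j) / measure lborel K
      - (LINT x:K|lborel. x $ i) / measure lborel K * ((LINT x:K|lborel. x $ j) / measure lborel K)"
  using set_integral_covariance[OF K pos, of "axis i 1" "axis j 1"] covariance_matrix_nth[OF K pos, of i j]
  by (simp add: inner_axis')

lemma isotropic_D:
  assumes "isotropic K"
  shows "convex_body K" "compact K" "convex K" "0 < measure lborel K"
    "(LINT x:K|lborel. a \<bullet> x) = 0"
    "(LINT x:K|lborel. (a \<bullet> x) * (b \<bullet> x)) = measure lborel K * (a \<bullet> b)"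
  using assms convex_body_measure_pos by (auto simp: isotropic_def convex_body_def)

lemma affine_invariant_isotropic:
  assumes "isotropic K"
  shows "affine_invariant K = 1 / (measure lborel K)\<^sup>2"
proof -
  note K = isotropic_D[OF assms]
  have "covariance_matrix K = mat 1"
    using K(5)[of "axis _ 1"] K(6)[of "axis _ 1" "axis _ 1"] K(4)
    by (auto simp: vec_eq_iff covariance_matrix_nth'[OF K(2,4)] inner_axis' mat_def) (auto simp: axis_def)
  then show ?thesis
    by (simp add: affine_invariant_def)
qed

lemma measure_affine_image:
  fixes f :: "real^'n \<Rightarrow> real^'n"
  assumes "linear f" "det (matrix f) \<noteq> 0" "compact S"
  shows "measure lborel ((\<lambda>x. c + f x) ` S) = \<bar>det (matrix f)\<bar> * measure lborel S"
proof -
  have c: "compact ((\<lambda>x. c + f x) ` S)"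
    using assms by (intro compact_continuous_image continuous_intros linear_continuous_on linear_conv_bounded_linear[THEN iffD1])
  show ?thesis
    using set_integral_affine_image[OF assms, of "\<lambda>_. 1" c]
    by (simp add: set_integral_const[OF c] set_integral_const[OF assms(3)])
qed

lemma convex_body_affine_image:
  fixes f :: "real^'n \<Rightarrow> real^'n"
  assumes f: "linear f" "det (matrix f) \<noteq> 0" and K: "convex_body K"
  shows "convex_body ((\<lambda>x. c + f x) ` K)"
proof (rule convex_body_if_measure_pos)
  have K': "compact K" "convex K" using K by (auto simp: convex_body_def)
  show "compact ((\<lambda>x. c + f x) ` K)"
    using f K' by (intro compact_continuous_image continuous_intros linear_continuous_on linear_conv_bounded_linear[THEN iffD1])
  show "convex ((\<lambda>x. c + f x) ` K)"
    using convex_translation[OF convex_linear_image[OF f(1) K'(2)], of c] by (simp add: image_image)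
  show "0 < measure lborel ((\<lambda>x. c + f x) ` K)"
    using convex_body_measure_pos[OF K] f measure_affine_image[OF f K'(1)] by simp
qed

text \<open>If F is the matrix of the linear part, the covariance matrix A becomes F A F^T; its
  determinant gains the square of det F, and so does the squared volume.\<close>

lemma affine_invariant_affine_image:
  fixes f :: "real^'n \<Rightarrow> real^'n"
  assumes f: "linear f" "det (matrix f) \<noteq> 0" and K: "convex_body K"
  shows "affine_invariant ((\<lambda>x. c + f x) ` K) = affine_invariant K"
proof -
  let ?T = "\<lambda>x. c + f x" and ?D = "\<bar>det (matrix f)\<bar>" and ?V = "measure lborel K"
  have K': "compact K" and pos: "0 < ?V"
    using K convex_body_measure_pos by (auto simp: convex_body_def)
  have TK: "compact (?T ` K)" "0 < measure lborel (?T ` K)"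
    using convex_body_affine_image[OF f K] convex_body_measure_pos by (auto simp: convex_body_def)
  have vol: "measure lborel (?T ` K) = ?D * ?V"
    by (rule measure_affine_image[OF f K'])
  have adj: "a \<bullet> f x = adjoint f a \<bullet> x" for a x
    using adjoint_works[OF f(1), of x a] by (simp add: inner_commute)
  have cen: "centroid (?T ` K) = ?T (centroid K)"
  proof (rule vector_eq_rdot[THEN iffD1], rule allI)
    fix a
    have "(LINT x:?T ` K|lborel. a \<bullet> x) = ?D * (LINT x:K|lborel. a \<bullet> (c + f x))"
      by (rule set_integral_affine_image[OF f K']) simp
    also have "(LINT x:K|lborel. a \<bullet> (c + f x)) = (LINT x:K|lborel. a \<bullet> c + adjoint f a \<bullet> x)"
      by (simp add: inner_add_right adj)
    also have "\<dots> = ?V * (a \<bullet> c) + (LINT x:K|lborel. adjoint f a \<bullet> x)"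
      by (subst set_integral_add) (auto intro!: set_integrable_compact K' continuous_intros simp: set_integral_const[OF K'])
    also have "(LINT x:K|lborel. adjoint f a \<bullet> x) = ?V * (a \<bullet> f (centroid K))"
      using centroid_inner[OF K' pos, of "adjoint f a"] pos by (simp add: adj)
    finally have "a \<bullet> centroid (?T ` K) = a \<bullet> ?T (centroid K)"
      using pos f(2) by (simp add: centroid_inner[OF TK] vol inner_add_right field_simps)
    then show "centroid (?T ` K) \<bullet> a = ?T (centroid K) \<bullet> a"
      by (simp add: inner_commute)
  qed
  let ?F = "matrix f"
  have nth: "f x $ i = (\<Sum>k\<in>UNIV. ?F $ i $ k * x $ k)" for x i
    using matrix_vector_mul_component[of ?F x i] f(1)
    by (simp add: inner_vec_def matrix_vector_mul)
  have "covariance_matrix (?T ` K) = ?F ** covariance_matrix K ** transpose ?F"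
  proof -
    have "covariance_matrix (?T ` K) $ i $ j = (?F ** covariance_matrix K ** transpose ?F) $ i $ j" for i j
    proof -
      let ?y = "\<lambda>x. x - centroid K"
      have "(LINT x:?T ` K|lborel. (x - centroid (?T ` K)) $ i * (x - centroid (?T ` K)) $ j)
          = ?D * (LINT x:K|lborel. (c + f x - centroid (?T ` K)) $ i * (c + f x - centroid (?T ` K)) $ j)"
        by (rule set_integral_affine_image[OF f K'])
          (auto intro!: borel_measurable_continuous_onI continuous_intros)
      also have "(\<lambda>x. (c + f x - centroid (?T ` K)) $ i * (c + f x - centroid (?T ` K)) $ j)
          = (\<lambda>x. \<Sum>l\<in>UNIV. \<Sum>k\<in>UNIV. ?F $ i $ k * ?F $ j $ l * (?y x $ k * ?y x $ l))"
      proof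
        fix x
        have "c + f x - centroid (?T ` K) = f (?y x)"
          by (simp add: cen linear_diff[OF f(1)])
        then show "(c + f x - centroid (?T ` K)) $ i * (c + f x - centroid (?T ` K)) $ j
          = (\<Sum>l\<in>UNIV. \<Sum>k\<in>UNIV. ?F $ i $ k * ?F $ j $ l * (?y x $ k * ?y x $ l))"
          by (simp only: nth sum_product) (subst sum.swap, simp add: algebra_simps)
      qed
      also have "(LINT x:K|lborel. (\<Sum>l\<in>UNIV. \<Sum>k\<in>UNIV. ?F $ i $ k * ?F $ j $ l * (?y x $ k * ?y x $ l)))
          = (\<Sum>l\<in>UNIV. \<Sum>k\<in>UNIV. ?F $ i $ k * ?F $ j $ l * (LINT x:K|lborel. ?y x $ k * ?y x $ l))"
      proof -
        have "integrable lborel (\<lambda>x. indicator K x * (?y x $ k * ?y x $ l))" for k l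
          using set_integrable_compact[OF K', of "\<lambda>x. ?y x $ k * ?y x $ l"]
          by (simp add: set_integrable_def continuous_intros)
        then have "integrable lborel (\<lambda>x. a * (indicator K x * (?y x $ k * ?y x $ l)))" for a k l
          by simp
        moreover have "(\<lambda>x. indicator K x *\<^sub>R (\<Sum>l\<in>UNIV. \<Sum>k\<in>UNIV. ?F $ i $ k * ?F $ j $ l * (?y x $ k * ?y x $ l)))
          = (\<lambda>x. \<Sum>l\<in>UNIV. \<Sum>k\<in>UNIV. (?F $ i $ k * ?F $ j $ l) * (indicator K x * (?y x $ k * ?y x $ l)))"
          by (rule ext) (simp add: sum_distrib_left mult_ac)
        ultimately show ?thesis
          by (simp only: set_lebesgue_integral_def real_scaleR_def
              Bochner_Integration.integral_sum Bochner_Integration.integrable_sum integral_mult_right_zero)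
      qed
      also have "\<dots> = (\<Sum>l\<in>UNIV. \<Sum>k\<in>UNIV. ?F $ i $ k * ?F $ j $ l * (?V * covariance_matrix K $ k $ l))"
        using pos by (simp add: covariance_matrix_nth[OF K' pos])
      also have "\<dots> = ?V * (?F ** covariance_matrix K ** transpose ?F) $ i $ j"
        by (simp add: matrix_matrix_mult_def transpose_def sum_distrib_left sum_distrib_right algebra_simps)
      finally show ?thesis
        using pos f(2) by (simp add: covariance_matrix_nth[OF TK] vol)
    qed
    then show ?thesis by (simp add: vec_eq_iff)
  qed
  then show ?thesis
    using f(2) by (simp add: affine_invariant_def det_mul vol power_mult_distrib field_simps power2_eq_square)
qed

text \<open>Gram-Schmidt in extremal form: a largest orthonormal set spans, since otherwise an
  outside vector minus its projection could be normalized and added. Applied to the covariance form,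
  it takes the place of an inverse square root of the covariance matrix.\<close>

lemma orthonormal_basis_bilinear:
  fixes q :: "'a::euclidean_space \<Rightarrow> 'a \<Rightarrow> real"
  assumes q: "bilinear q" and sym: "\<And>x y. q x y = q y x" and pos: "\<And>x. x \<noteq> 0 \<Longrightarrow> 0 < q x x"
  obtains B where "independent B" "card B = DIM('a)" "\<And>x y. x \<in> B \<Longrightarrow> y \<in> B \<Longrightarrow> q x y = (if x = y then 1 else 0)"
proof -
  note lin = bilinear_ladd[OF q] bilinear_radd[OF q] bilinear_lmul[OF q] bilinear_rmul[OF q]
    bilinear_lzero[OF q] bilinear_rzero[OF q] bilinear_lsub[OF q] bilinear_rsub[OF q]
  let ?on = "\<lambda>B. finite B \<and> (\<forall>x\<in>B. \<forall>y\<in>B. q x y = (if x = y then 1 else 0))"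
  have lsum: "q (sum f B) y = (\<Sum>b\<in>B. q (f b) y)" for f :: "'a \<Rightarrow> 'a" and B y
    using q by (intro linear_sum) (simp add: bilinear_def)
  have coeff: "q (\<Sum>b\<in>B. u b *\<^sub>R b) y = u y" if "?on B" "y \<in> B" for B u y
  proof -
    have "q (\<Sum>b\<in>B. u b *\<^sub>R b) y = (\<Sum>b\<in>B. if b = y then u b else 0)"
      unfolding lsum using that by (intro sum.cong) (auto simp: lin)
    then show ?thesis using that by simp
  qed
  have ind: "independent B" if "?on B" for B
  proof (rule independent_if_scalars_zero)
    show "finite B" using that by blast
    fix u x assume "(\<Sum>x\<in>B. u x *\<^sub>R x) = 0" "x \<in> B"
    then show "u x = 0" using coeff[OF that, of x u] by (simp add: lin)
  qed
  have bound: "card B < Suc DIM('a)" if "?on B" for B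
    using independent_bound[OF ind[OF that]] by simp
  have ex: "?on {}" by simp
  have "\<exists>B. ?on B \<and> (\<forall>C. ?on C \<longrightarrow> card C \<le> card B)"
    using ex by (rule ex_has_greatest_nat[where b = "Suc DIM('a)"]) (use bound less_imp_le in blast)
  then obtain B where B: "?on B" and max: "\<And>C. ?on C \<Longrightarrow> card C \<le> card B"
    by blast
  have "card B = DIM('a)"
  proof (rule ccontr)
    assume "card B \<noteq> DIM('a)"
    then have "span B \<noteq> UNIV"
      using bound[OF B] dim_eq_card_independent[OF ind[OF B]] by (metis dim_UNIV dim_span)
    then obtain x where x: "x \<notin> span B" by (metis UNIV_eq_I)
    define y where "y = x - (\<Sum>b\<in>B. q x b *\<^sub>R b)"
    have "(\<Sum>b\<in>B. q x b *\<^sub>R b) \<in> span B"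
      by (intro span_sum span_scale span_base)
    then have "y \<noteq> 0"
      using x by (auto simp: y_def)
    then have py: "0 < q y y" by (rule pos)
    have yb: "q y b = 0" "q b y = 0" if "b \<in> B" for b
      using coeff[OF B that, of "q x"] sym[of b y] by (auto simp: y_def lin)
    define z where "z = (1 / sqrt (q y y)) *\<^sub>R y"
    have zz: "q z z = 1"
      using py by (simp add: z_def lin flip: power2_eq_square)
    have zb: "q z b = 0" "q b z = 0" if "b \<in> B" for b
      using yb[OF that] by (auto simp: z_def lin)
    have "z \<notin> B" using zz zb by force
    have "?on (insert z B)"
      using B zz zb by auto
    from max[OF this] \<open>z \<notin> B\<close> B show False by simp
  qed
  with ind[OF B] B show ?thesis using that by blast
qed

text \<open>The integrand vanishes only on a hyperplane, which is a null set, whereas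
  \<open>K\<close> has positive volume.\<close>

lemma set_integral_square_pos:
  fixes K :: "(real^'n) set"
  assumes K: "convex_body K" and a: "a \<noteq> 0"
  shows "0 < (LINT x:K|lborel. (a \<bullet> (x - c)) * (a \<bullet> (x - c)))"
proof -
  let ?g = "\<lambda>x. (a \<bullet> (x - c)) * (a \<bullet> (x - c))"
  have K': "compact K" using K by (simp add: convex_body_def)
  then have [measurable]: "K \<in> sets borel" by (auto dest: compact_imp_closed)
  have int: "integrable lborel (\<lambda>x. indicator K x *\<^sub>R ?g x)"
    by (intro borel_integrable_compact K' continuous_intros)
  have nn: "0 \<le> indicator K x *\<^sub>R ?g x" for x
    by (auto simp: indicator_def)
  have "(LINT x:K|lborel. ?g x) \<noteq> 0"
  proof
    assume "(LINT x:K|lborel. ?g x) = 0"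
    then have "AE x in lborel. indicator K x *\<^sub>R ?g x = 0"
      using integral_nonneg_eq_0_iff_AE[OF int] nn by (simp add: set_lebesgue_integral_def)
    moreover have "AE x in lborel. x \<notin> {x. a \<bullet> x = a \<bullet> c}"
    proof (rule AE_not_in)
      have "negligible {x. a \<bullet> x = a \<bullet> c}" using a by (simp add: negligible_hyperplane)
      then show "{x. a \<bullet> x = a \<bullet> c} \<in> null_sets lborel"
        using closed_hyperplane[of a "a \<bullet> c"] by (auto simp: negligible_iff_null_sets null_sets_completion_iff)
    qed
    ultimately have "AE x in lborel. x \<notin> K"
      by eventually_elim (auto simp: indicator_def inner_diff_right split: if_splits)
    then have "emeasure lborel K = 0"
      by (subst (asm) AE_iff_measurable[of K]) auto
    then show False
      using convex_body_measure_pos[OF K] by (simp add: measure_def)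
  qed
  moreover have "0 \<le> (LINT x:K|lborel. ?g x)"
    unfolding set_lebesgue_integral_def by (rule Bochner_Integration.integral_nonneg) (rule nn)
  ultimately show ?thesis by simp
qed

lemma isotropic_position:
  fixes K :: "(real^'n) set"
  assumes K: "convex_body K"
  obtains f c where "linear f" "det (matrix f) \<noteq> 0" "isotropic ((\<lambda>x. c + f x) ` K)"
proof -
  let ?m = "centroid K" and ?V = "measure lborel K"
  have K': "compact K" and pos: "0 < ?V"
    using K convex_body_measure_pos by (auto simp: convex_body_def)
  define q where "q a b = (LINT x:K|lborel. (a \<bullet> (x - ?m)) * (b \<bullet> (x - ?m)))" for a b
  have int: "set_integrable lborel K (\<lambda>x. (a \<bullet> (x - ?m)) * (b \<bullet> (x - ?m)))" for a b
    by (intro set_integrable_compact K' continuous_intros)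
  have sym: "q a b = q b a" for a b by (simp add: q_def mult.commute)
  have "linear (q a)" for a
    by (intro linearI) (simp_all add: q_def inner_add_left distrib_left set_integral_add int mult.left_commute)
  moreover have "(\<lambda>x. q x y) = q y" for y
    by (rule ext) (rule sym)
  ultimately have bil: "bilinear q"
    by (simp add: bilinear_def)
  have "q a a > 0" if "a \<noteq> 0" for a
    unfolding q_def using that by (rule set_integral_square_pos[OF K])
  then obtain B where B: "independent B" "card B = DIM(real^'n)"
    "\<And>x y. x \<in> B \<Longrightarrow> y \<in> B \<Longrightarrow> q x y = (if x = y then 1 else 0)"
    using orthonormal_basis_bilinear[OF bil sym] by metis
  have "finite B" using B(1) by (rule independent_imp_finite)
  moreover have "card B = CARD('n)" using B(2) by simp
  ultimately obtain u where u: "bij_betw u (UNIV :: 'n set) B"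
    using finite_same_card_bij[of "UNIV :: 'n set" B] by auto
  have qu: "q (u i) (u j) = (if i = j then 1 else 0)" for i j
    using B(3) u by (auto simp: bij_betw_def inj_def)
  \<comment> \<open>The form \<open>q\<close> is not divided by the volume, so coordinates with
    respect to \<open>q\<close>-orthonormal functionals have variance 1 / \<open>?V\<close>; the
    factor \<open>s\<close> corrects this to 1.\<close>
  define s where "s = sqrt ?V"
  define f :: "real^'n \<Rightarrow> real^'n" where "f x = (\<chi> i. s * (u i \<bullet> x))" for x
  define c where "c = - f ?m"
  have s: "s \<noteq> 0" "s * s = ?V" using pos by (auto simp: s_def)
  have lin: "linear f"
    by (intro linearI) (auto simp: f_def vec_eq_iff inner_add_right algebra_simps)
  have "inj f"
  proof (rule linear_injective_0[OF lin, THEN iffD2], intro allI impI)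
    fix x assume "f x = 0"
    then have "u i \<bullet> x = 0" for i using s by (auto simp: f_def vec_eq_iff)
    then have "orthogonal x b" if "b \<in> B" for b
      using that u by (auto simp: bij_betw_def orthogonal_def inner_commute)
    moreover have "x \<in> span B"
      using card_eq_dim[of B UNIV] B \<open>finite B\<close> by (auto simp: dim_UNIV)
    ultimately show "x = 0"
      using orthogonal_to_span[of x B x] by (simp add: orthogonal_self)
  qed
  then have nz: "det (matrix f) \<noteq> 0" using det_nz_iff_inj[OF lin] by blast
  let ?L = "(\<lambda>x. c + f x) ` K" and ?D = "\<bar>det (matrix f)\<bar>"
  have T: "c + f x = f (x - ?m)" for x by (simp add: c_def linear_diff[OF lin])
  have vol: "measure lborel ?L = ?D * ?V" by (rule measure_affine_image[OF lin nz K'])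
  have af: "a \<bullet> f y = (s *\<^sub>R (\<Sum>i\<in>UNIV. a $ i *\<^sub>R u i)) \<bullet> y" for a y
    by (simp add: f_def inner_vec_def[of a] inner_sum_left sum_distrib_left mult.left_commute)
  have "isotropic ?L"
    unfolding isotropic_def
  proof (intro conjI allI)
    show "convex_body ?L" by (rule convex_body_affine_image[OF lin nz K])
    fix a
    let ?a = "s *\<^sub>R (\<Sum>i\<in>UNIV. a $ i *\<^sub>R u i)"
    have "(LINT x:?L|lborel. a \<bullet> x) = ?D * (LINT x:K|lborel. a \<bullet> (c + f x))"
      by (rule set_integral_affine_image[OF lin nz K']) simp
    also have "(LINT x:K|lborel. a \<bullet> (c + f x)) = (LINT x:K|lborel. ?a \<bullet> x - ?a \<bullet> ?m)"
      unfolding T af by (simp only: inner_diff_right)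
    also have "\<dots> = (LINT x:K|lborel. ?a \<bullet> x) - ?V * (?a \<bullet> ?m)"
      by (subst set_integral_diff) (auto intro!: set_integrable_compact K' continuous_intros simp: set_integral_const[OF K'])
    also have "\<dots> = 0"
      using pos by (simp only: centroid_inner[OF K' pos]) simp
    finally show "(LINT x:?L|lborel. a \<bullet> x) = 0" by simp
    fix b
    let ?b = "s *\<^sub>R (\<Sum>i\<in>UNIV. b $ i *\<^sub>R u i)"
    have "(LINT x:?L|lborel. (a \<bullet> x) * (b \<bullet> x)) = ?D * (LINT x:K|lborel. (a \<bullet> (c + f x)) * (b \<bullet> (c + f x)))"
      by (rule set_integral_affine_image[OF lin nz K']) simp
    also have "(LINT x:K|lborel. (a \<bullet> (c + f x)) * (b \<bullet> (c + f x))) = q ?a ?b"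
      unfolding T af q_def ..
    also have "q ?a ?b = s * s * (\<Sum>i\<in>UNIV. \<Sum>j\<in>UNIV. a $ i * (b $ j * q (u i) (u j)))"
      using bilinear_sum[OF bil, where S = UNIV and T = UNIV and f = "\<lambda>i. a $ i *\<^sub>R u i" and g = "\<lambda>i. b $ i *\<^sub>R u i"]
      by (simp add: bilinear_lmul[OF bil] bilinear_rmul[OF bil] sum.cartesian_product mult.left_commute)
    also have "\<dots> = ?V * (a \<bullet> b)"
      by (simp add: s qu inner_vec_def if_distrib cong: if_cong)
    finally show "(LINT x:?L|lborel. (a \<bullet> x) * (b \<bullet> x)) = measure lborel ?L * (a \<bullet> b)"
      by (simp add: vol)
  qed
  with lin nz show ?thesis using that by blast
qed

text \<open>Otherwise some nonzero functional is nonnegative on \<open>K\<close> with integral 0,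
  hence 0 almost everywhere, against its positive variance.\<close>

lemma isotropic_zero_interior:
  fixes K :: "(real^'n) set"
  assumes "isotropic K"
  shows "0 \<in> interior K"
proof (rule ccontr)
  note K = isotropic_D[OF assms]
  assume "0 \<notin> interior K"
  then obtain a where a: "a \<noteq> 0" "\<And>x. x \<in> interior K \<Longrightarrow> 0 \<le> a \<bullet> x"
    using separating_hyperplane_set_0[of "interior K"] convex_interior[OF K(3)] by blast
  have nn: "0 \<le> a \<bullet> x" if "x \<in> K" for x
  proof -
    have "closure (interior K) \<subseteq> {x. 0 \<le> a \<bullet> x}"
      using a(2) by (intro closure_minimal closed_halfspace_ge) auto
    moreover have "K \<subseteq> closure (interior K)"
      using K closure_subset convex_closure_interior by (metis convex_body_def)
    ultimately show ?thesis using that by blast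
  qed
  have [measurable]: "K \<in> sets borel" using K(2) by (auto dest: compact_imp_closed)
  have int: "integrable lborel (\<lambda>x. indicator K x *\<^sub>R (a \<bullet> x))"
    by (intro borel_integrable_compact K continuous_intros)
  have "AE x in lborel. indicator K x *\<^sub>R (a \<bullet> x) = 0"
    using integral_nonneg_eq_0_iff_AE[OF int] nn K(5)[of a]
    by (auto simp: set_lebesgue_integral_def indicator_def)
  then have "AE x in lborel. indicator K x *\<^sub>R ((a \<bullet> (x - 0)) * (a \<bullet> (x - 0))) = 0"
    by eventually_elim auto
  then have "(LINT x:K|lborel. (a \<bullet> (x - 0)) * (a \<bullet> (x - 0))) = 0"
    unfolding set_lebesgue_integral_def by (rule integral_eq_zero_AE)
  with set_integral_square_pos[OF K(1) a(1), of 0] show False by simp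
qed

section \<open>Determinants of perturbations of the identity\<close>

lemma det_orthogonal_conjugate:
  fixes f T :: "real^'n \<Rightarrow> real^'n"
  assumes f: "linear f" and T: "orthogonal_transformation T"
  shows "det (matrix (T \<circ> f \<circ> adjoint T)) = det (matrix f)"
proof -
  have linT: "linear T" and T': "linear (adjoint T)"
    using T by (auto simp: orthogonal_transformation_def adjoint_linear)
  have "T \<circ> adjoint T = id"
  proof
    fix x
    have "surj T" using T by (rule orthogonal_transformation_surj)
    then obtain y where y: "x = T y" by blast
    have "adjoint T (T y) \<bullet> z = y \<bullet> z" for z
      using adjoint_works[OF linT, of z "T y"] T by (simp add: orthogonal_transformation_def inner_commute)
    then have "adjoint T (T y) = y" using vector_eq_rdot by blast
    then show "(T \<circ> adjoint T) x = id x" by (simp add: y)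
  qed
  then have "matrix T ** matrix (adjoint T) = mat 1"
    using matrix_compose[OF T' linT] by (metis matrix_id_mat_1)
  then have "det (matrix T) * det (matrix (adjoint T)) = 1"
    by (metis det_I det_mul)
  then show ?thesis
    using f linT T' by (simp add: matrix_compose linear_compose det_mul mult.assoc mult.left_commute)
qed

lemma linear_rank_one_update: "linear (\<lambda>x. x + (v \<bullet> x) *\<^sub>R u)"
  by (intro linearI) (simp_all add: inner_add_right scaleR_add_left algebra_simps)

text \<open>Rotating \<open>v\<close> onto a multiple of a coordinate vector leaves a matrix that
  differs from the identity in one column only, and Cramer's rule reads off its determinant. The
  formula serves for swaps of vertices, for moving the apex of a simplex and for the covariance
  matrix of a sheared body.\<close>

lemma det_rank_one_update:
  fixes u v :: "real^'n"
  shows "det (matrix (\<lambda>x. x + (v \<bullet> x) *\<^sub>R u)) = 1 + u \<bullet> v"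
proof -
  let ?f = "\<lambda>x. x + (v \<bullet> x) *\<^sub>R u"
  fix k :: 'n
  have lin: "linear ?f"
    by (rule linear_rank_one_update)
  obtain T :: "real^'n \<Rightarrow> real^'n" where T: "orthogonal_transformation T" "T v = norm v *\<^sub>R axis k 1"
    using orthogonal_transformation_exists[of v "norm v *\<^sub>R axis k 1"] by auto
  have linT: "linear T" and T_inner: "\<And>x y. T x \<bullet> T y = x \<bullet> y"
    using T by (auto simp: orthogonal_transformation_def)
  let ?w = "norm v *\<^sub>R T u"
  have "T \<circ> ?f \<circ> adjoint T = (\<lambda>x. x + (x $ k) *\<^sub>R ?w)"
  proof
    fix x
    obtain y where y: "x = T y" using orthogonal_transformation_surj[OF T(1)] by blast
    have "adjoint T (T y) \<bullet> z = y \<bullet> z" for z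
      using adjoint_works[OF linT, of z "T y"] T_inner by (simp add: inner_commute)
    then have a: "adjoint T x = y" unfolding y using vector_eq_rdot by blast
    have "v \<bullet> y = norm v * x $ k"
      using T_inner[of v y] by (simp add: y[symmetric] T(2) inner_axis')
    then show "(T \<circ> ?f \<circ> adjoint T) x = x + (x $ k) *\<^sub>R ?w"
      by (simp add: a linear_add[OF linT] linear_scale[OF linT] y[symmetric] mult.commute)
  qed
  then have "det (matrix ?f) = det (matrix (\<lambda>x. x + (x $ k) *\<^sub>R ?w))"
    using det_orthogonal_conjugate[OF lin T(1)] by simp
  also have "matrix (\<lambda>x. x + (x $ k) *\<^sub>R ?w)
      = (\<chi> i j. if j = k then (mat 1 *v (axis k 1 + ?w)) $ i else (mat 1 :: real^'n^'n) $ i $ j)"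
    unfolding matrix_vector_mul_lid by (auto simp: matrix_def vec_eq_iff axis_def mat_def)
  also have "det \<dots> = 1 + ?w $ k"
    by (subst cramer_lemma) simp
  also have "?w $ k = u \<bullet> v"
    using T_inner[of u v] by (simp add: T(2) inner_axis)
  finally show ?thesis .
qed

text \<open>In the Leibniz formula, differentiating one factor of a nonidentity term still leaves an
  off-diagonal entry of the identity, so only the identity permutation contributes.\<close>

lemma DERIV_det_at_identity:
  fixes M :: "real \<Rightarrow> real^'n^'n"
  assumes M: "\<And>i j. ((\<lambda>t. M t $ i $ j) has_real_derivative M' $ i $ j) (at t0)" and M0: "M t0 = mat 1"
  shows "((\<lambda>t. det (M t)) has_real_derivative (\<Sum>i\<in>UNIV. M' $ i $ i)) (at t0)"
proof -
  let ?U = "UNIV :: 'n set"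
  let ?d = "\<lambda>p. \<Sum>i\<in>?U. M' $ i $ p i * (\<Prod>j\<in>?U - {i}. M t0 $ j $ p j)"
  have der: "((\<lambda>t. det (M t)) has_real_derivative (\<Sum>p | p permutes ?U. of_int (sign p) * ?d p)) (at t0)"
    unfolding det_def
    by (intro DERIV_sum DERIV_cmult has_field_derivative_prod M)
  have "?d p = (if p = id then (\<Sum>i\<in>?U. M' $ i $ i) else 0)" if p: "p permutes ?U" for p
  proof (cases "p = id")
    case True
    then show ?thesis by (simp add: M0 mat_def)
  next
    case False
    have "(\<Prod>j\<in>?U - {i}. M t0 $ j $ p j) = 0" for i
    proof -
      \<comment> \<open>Both \<open>a\<close> and \<open>p a\<close> are moved by \<open>p\<close>,
        and at least one of them differs from \<open>i\<close>, so its factor stays in the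
        product.\<close>
      obtain a where a: "p a \<noteq> a" using False by (auto simp: fun_eq_iff)
      have inj: "inj p" using p permutes_inj by blast
      then have "p (p a) \<noteq> p a" using a by (auto dest: injD)
      then obtain b where "b \<noteq> i" "p b \<noteq> b" using a by metis
      then show ?thesis by (intro prod_zero bexI[of _ b]) (auto simp: M0 mat_def)
    qed
    with False show ?thesis by (simp only: mult_zero_right sum.neutral_const if_False)
  qed
  then have "(\<Sum>p | p permutes ?U. of_int (sign p) * ?d p)
      = (\<Sum>p | p permutes ?U. of_int (sign p) * (if p = id then (\<Sum>i\<in>?U. M' $ i $ i) else 0))"
    by (intro sum.cong) auto
  also have "(\<Sum>p | p permutes ?U. of_int (sign p) * (if p = id then (\<Sum>i\<in>?U. M' $ i $ i) else 0)) =
      (\<Sum>p | p permutes ?U. if p = id then (\<Sum>i\<in>?U. M' $ i $ i) else 0)"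
    by (intro sum.cong) (auto simp: sign_id)
  also have "\<dots> = (\<Sum>i\<in>?U. M' $ i $ i)"
    using finite_permutations[of ?U] by (simp add: permutes_id)
  finally show ?thesis using der by simp
qed

subsection \<open>Moments of simplices\<close>

abbreviation std_simplex :: "(real^'n) set" where
  "std_simplex \<equiv> convex hull (insert 0 Basis)"

text \<open>The d + 1 vertices are indexed by \<open>'n option\<close>, with \<open>None\<close> for
  the origin, so that all barycentric coordinates are treated alike and any two can be
  exchanged.\<close>

fun bary_vertex :: "'n option \<Rightarrow> real^'n" where
  "bary_vertex None = 0"
| "bary_vertex (Some i) = axis i 1"

fun bary_grad :: "'n option \<Rightarrow> real^'n" where
  "bary_grad None = (\<chi> i. - 1)"
| "bary_grad (Some i) = axis i 1"

definition bary :: "'n option \<Rightarrow> real^'n \<Rightarrow> real" where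
  "bary s x = of_bool (s = None) + bary_grad s \<bullet> x"

lemma bary_simps: "bary None x = 1 - (\<Sum>i\<in>UNIV. x $ i)" "bary (Some i) x = x $ i"
  by (simp_all add: bary_def inner_axis') (simp add: inner_vec_def sum_negf)

lemma sum_option: "(\<Sum>s\<in>UNIV. f s) = f None + (\<Sum>i\<in>UNIV. f (Some i))"
  for f :: "'n::finite option \<Rightarrow> 'b::comm_monoid_add"
  by (simp add: UNIV_option_conv sum.reindex)

lemma sum_bary: "(\<Sum>s\<in>UNIV. bary s x) = 1"
  by (simp add: sum_option bary_simps)

lemma std_simplex_iff: "x \<in> std_simplex \<longleftrightarrow> (\<forall>s. 0 \<le> bary s x)" for x :: "real^'n"
proof -
  have "(\<Sum>b\<in>Basis. x \<bullet> b) = (\<Sum>i\<in>UNIV. x $ i)"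
    by (simp add: sum_Basis_cart inner_axis)
  moreover have "(\<forall>b\<in>Basis. 0 \<le> x \<bullet> b) \<longleftrightarrow> (\<forall>i. 0 \<le> x $ i)"
    unfolding Basis_cart by (auto simp: inner_axis)
  ultimately show ?thesis
    by (auto simp add: std_simplex split_option_all bary_simps)
qed

lemma bary_vertex: "bary s (bary_vertex t) = of_bool (s = t)"
  by (cases s; cases t) (auto simp: bary_simps axis_def)

lemma bary_grad_vertex: "bary_grad s \<bullet> bary_vertex t = of_bool (s = t) - of_bool (s = None)"
  using bary_vertex[of s t] by (simp add: bary_def)

lemma compact_std_simplex: "compact (std_simplex :: (real^'n) set)"
  by (intro finite_imp_compact_convex_hull) simp

lemma set_integrable_std_simplex:
  fixes g :: "real^'n \<Rightarrow> real"
  assumes "continuous_on UNIV g"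
  shows "set_integrable lborel std_simplex g"
  using assms by (intro set_integrable_compact compact_std_simplex) (auto intro: continuous_on_subset)

lemma continuous_bary [continuous_intros]: "continuous_on S (bary s)"
  unfolding bary_def by (intro continuous_intros)

text \<open>The affine map exchanging the vertices \<open>s\<close> and \<open>t\<close> and fixing
  the others, written as a translation after a rank-one update so that its determinant, -1, is at
  hand.\<close>

definition bary_swap :: "'n option \<Rightarrow> 'n option \<Rightarrow> real^'n \<Rightarrow> real^'n" where
  "bary_swap s t x = (of_bool (s = None) - of_bool (t = None)) *\<^sub>R (bary_vertex t - bary_vertex s)
     + (x + ((bary_grad s - bary_grad t) \<bullet> x) *\<^sub>R (bary_vertex t - bary_vertex s))"

lemma bary_swap_eq: "bary_swap s t x = x + (bary s x - bary t x) *\<^sub>R (bary_vertex t - bary_vertex s)"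
  by (simp add: bary_swap_def bary_def inner_diff_left algebra_simps)

lemma bary_bary_swap: "bary r (bary_swap s t x) = bary (Transposition.transpose s t r) x"
proof -
  have "bary r (x + c *\<^sub>R (bary_vertex t - bary_vertex s)) = bary r x + c * (of_bool (r = t) - of_bool (r = s))" for c
    by (simp add: bary_def inner_add_right inner_diff_right bary_grad_vertex)
  then show ?thesis
    by (auto simp: bary_swap_eq Transposition.transpose_def)
qed

lemma bary_inject: "(\<forall>s. bary s x = bary s y) \<longleftrightarrow> x = y"
  by (auto simp: vec_eq_iff split_option_all bary_simps)

lemma bary_swap_swap: "bary_swap s t (bary_swap s t x) = x"
  by (simp add: bary_inject[symmetric] bary_bary_swap)

lemma set_integral_bary_swap:
  fixes g :: "real^'n \<Rightarrow> real"
  assumes st: "s \<noteq> t" and S: "compact S" and g: "g \<in> borel_measurable borel"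
  shows "(LINT x:bary_swap s t ` S|lborel. g x) = (LINT x:S|lborel. g (bary_swap s t x))"
proof -
  let ?u = "bary_vertex t - bary_vertex s" and ?v = "bary_grad s - bary_grad t"
  let ?f = "\<lambda>x. x + (?v \<bullet> x) *\<^sub>R ?u"
  have lin: "linear ?f"
    by (rule linear_rank_one_update)
  have "det (matrix ?f) = -1"
    unfolding det_rank_one_update inner_commute[of ?u ?v] using st
    by (simp add: inner_diff_left inner_diff_right bary_grad_vertex)
  then show ?thesis
    using set_integral_affine_image[OF lin _ S g, of "(of_bool (s = None) - of_bool (t = None)) *\<^sub>R ?u"]
    unfolding bary_swap_def by simp
qed

lemma bary_swap_std_simplex:
  fixes s t :: "'n::finite option"
  shows "bary_swap s t ` std_simplex = std_simplex"
proof
  show le: "bary_swap s t ` std_simplex \<subseteq> std_simplex"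
    by (auto simp: std_simplex_iff bary_bary_swap)
  show "std_simplex \<subseteq> bary_swap s t ` std_simplex"
  proof
    fix x :: "real^'n" assume "x \<in> std_simplex"
    then have "bary_swap s t x \<in> std_simplex" using le by blast
    then show "x \<in> bary_swap s t ` std_simplex" by (metis bary_swap_swap imageI)
  qed
qed

text \<open>Exchanging vertices preserves the simplex and the volume. Hence the second moments of
  the barycentric coordinates take only two values, one on the diagonal and one off it.\<close>

lemma moment_bary_swap:
  fixes s t r q :: "'n::finite option"
  shows "(LINT x:std_simplex|lborel. bary (Transposition.transpose s t r) x * bary (Transposition.transpose s t q) x)
    = (LINT x:std_simplex|lborel. bary r x * bary q (x :: real^'n))"
proof (cases "s = t")
  case False
  have "(LINT x:bary_swap s t ` std_simplex|lborel. bary r x * bary q x)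
      = (LINT x:std_simplex|lborel. bary r (bary_swap s t x) * bary q (bary_swap s t x))"
    by (intro set_integral_bary_swap False compact_std_simplex borel_measurable_continuous_onI continuous_intros)
  then show ?thesis by (simp only: bary_swap_std_simplex bary_bary_swap)
qed simp

text \<open>
  Cutting the standard simplex at \<open>x $ i = bary None x\<close> gives two congruent halves; one of them is
  the image of the whole simplex under halving \<open>x $ i\<close>.
\<close>

lemma moment_bary_square:
  fixes i :: "'n::finite"
  shows "(LINT x:std_simplex|lborel. bary (Some i) x * bary (Some i) x)
    = 2 * (LINT x:std_simplex|lborel. bary None x * bary (Some i) x)"
proof -
  let ?N = "None :: 'n option" and ?I = "Some i"
  let ?g = "\<lambda>x. bary ?I x * bary ?I x"
  define H where "H = {x :: real^'n. (\<forall>s. 0 \<le> bary s x) \<and> bary ?I x \<le> bary ?N x}"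
  let ?f = "\<lambda>x. x + ((- (1/2)) *\<^sub>R axis i 1 \<bullet> x) *\<^sub>R axis i (1::real)"
  have lin: "linear ?f"
    by (rule linear_rank_one_update)
  have det: "det (matrix ?f) = 1 / 2"
    unfolding det_rank_one_update by (simp add: inner_axis_axis)
  have f_nth: "?f x $ k = (if k = i then x $ i / 2 else x $ k)" for x k
    by (simp add: inner_axis') (simp add: axis_def)
  have bf: "bary ?I (?f x) = bary ?I x / 2" "bary ?N (?f x) = bary ?N x + bary ?I x / 2"
    "bary (Some k) (?f x) = (if k = i then bary ?I x / 2 else bary (Some k) x)" for x k
  proof -
    have "(\<Sum>k\<in>UNIV. ?f x $ k) = (\<Sum>k\<in>UNIV. x $ k) - x $ i / 2"
      unfolding f_nth by (subst (1 2) sum.remove[of _ i]) auto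
    then show "bary ?N (?f x) = bary ?N x + bary ?I x / 2" by (simp only: bary_simps)
  qed (simp_all only: bary_simps f_nth simp_thms if_True)
  have fH: "?f ` std_simplex = H"
  proof (intro subset_antisym subsetI)
    fix y assume "y \<in> ?f ` std_simplex"
    then obtain x where x: "x \<in> std_simplex" "y = ?f x" by blast
    then show "y \<in> H"
      unfolding H_def std_simplex_iff split_option_all mem_Collect_eq bf x(2) by auto
  next
    fix y assume y: "y \<in> H"
    define x where "x = y + (y $ i) *\<^sub>R axis i 1"
    have "?f x $ k = y $ k" for k unfolding f_nth by (auto simp: x_def axis_def)
    then have "?f x = y" unfolding vec_eq_iff by blast
    moreover have "x \<in> std_simplex"
    proof -
      have "(\<Sum>k\<in>UNIV. x $ k) = (\<Sum>k\<in>UNIV. y $ k) + y $ i"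
        by (subst (1 2) sum.remove[of _ i]) (auto simp: x_def axis_def)
      then show ?thesis
        using y by (auto simp: H_def std_simplex_iff split_option_all bary_simps x_def axis_def)
    qed
    ultimately show "y \<in> ?f ` std_simplex" by blast
  qed
  have "continuous_on UNIV ?f" by (intro continuous_intros)
  then have cH: "compact H"
    unfolding fH[symmetric] by (intro compact_continuous_image compact_std_simplex) (auto intro: continuous_on_subset)
  let ?\<tau> = "bary_swap ?I ?N"
  have tau: "bary ?I (?\<tau> x) = bary ?N x" "bary ?N (?\<tau> x) = bary ?I x" for x
    by (simp_all add: bary_bary_swap)
  have cT: "compact (?\<tau> ` H)"
    by (intro compact_continuous_image cH) (auto simp: bary_swap_eq[abs_def] intro!: continuous_intros)
  have un: "H \<union> ?\<tau> ` H = std_simplex"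
  proof (intro subset_antisym subsetI)
    fix x :: "real^'n" assume x: "x \<in> std_simplex"
    then have tx: "?\<tau> x \<in> std_simplex" using bary_swap_std_simplex by blast
    show "x \<in> H \<union> ?\<tau> ` H"
    proof (cases "bary ?I x \<le> bary ?N x")
      case False
      then have "?\<tau> x \<in> H" using tx tau[of x] by (auto simp: H_def std_simplex_iff)
      then show ?thesis by (metis UnI2 bary_swap_swap imageI)
    qed (use x in \<open>auto simp: H_def std_simplex_iff\<close>)
  next
    have "H \<subseteq> std_simplex" by (auto simp: H_def std_simplex_iff)
    moreover fix x :: "real^'n" assume "x \<in> H \<union> ?\<tau> ` H"
    ultimately show "x \<in> std_simplex" using bary_swap_std_simplex by blast
  qed
  have neg: "negligible (H \<inter> ?\<tau> ` H)"
  proof -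
    have sub: "H \<inter> ?\<tau> ` H \<subseteq> {x. (bary_grad ?I - bary_grad ?N) \<bullet> x = 1}"
    proof
      fix x assume "x \<in> H \<inter> ?\<tau> ` H"
      then have "bary ?I x = bary ?N x" by (auto simp: H_def tau)
      then show "x \<in> {x. (bary_grad ?I - bary_grad ?N) \<bullet> x = 1}"
        by (simp add: bary_def inner_diff_left)
    qed
    have "bary_grad ?I - bary_grad ?N \<noteq> 0"
      by (auto simp: vec_eq_iff axis_def intro!: exI[of _ i])
    then show ?thesis
      using sub negligible_hyperplane negligible_subset by blast
  qed
  note int = set_integrable_std_simplex[where 'n = 'n]
  have gH: "(LINT x:H|lborel. h x) = 1/2 * (LINT x:std_simplex|lborel. h (?f x))"
    if "continuous_on UNIV h" for h :: "real^'n \<Rightarrow> real"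
  proof -
    have "det (matrix ?f) \<noteq> 0" "\<bar>det (matrix ?f)\<bar> = 1/2" unfolding det by simp_all
    with set_integral_affine_image[OF lin _ compact_std_simplex borel_measurable_continuous_onI[OF that], of 0]
    show ?thesis by (simp only: add_0 fH not_False_eq_True)
  qed
  let ?A = "LINT x:std_simplex|lborel. ?g x" and ?B = "LINT x:std_simplex|lborel. bary ?N x * bary ?I x"
  have NN: "(LINT x:std_simplex|lborel. bary ?N x * bary ?N x) = ?A"
    using moment_bary_swap[of ?I ?N ?I ?I] by simp
  have e1: "?A = (LINT x:H|lborel. ?g x) + (LINT x:?\<tau> ` H|lborel. ?g x)"
    unfolding un[symmetric] by (intro set_integral_Un_negligible cH cT neg continuous_intros)
  have e2: "(LINT x:?\<tau> ` H|lborel. ?g x) = (LINT x:H|lborel. bary ?N x * bary ?N x)"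
    by (subst set_integral_bary_swap) (auto simp: cH tau intro!: borel_measurable_continuous_onI continuous_intros)
  have e3: "(LINT x:H|lborel. ?g x) = 1/2 * (LINT x:std_simplex|lborel. (1/4) * ?g x)"
    by (subst gH) (auto simp only: bf intro!: continuous_intros, simp)
  have e4: "(LINT x:H|lborel. bary ?N x * bary ?N x)
      = 1/2 * (LINT x:std_simplex|lborel. bary ?N x * bary ?N x + bary ?N x * bary ?I x + (1/4) * ?g x)"
    by (subst gH) (auto simp only: bf intro!: continuous_intros, simp add: algebra_simps)
  have e5: "(LINT x:std_simplex|lborel. bary ?N x * bary ?N x + bary ?N x * bary ?I x + (1/4) * ?g x)
      = ?A + ?B + 1/4 * ?A"
  proof -
    have "set_integrable lborel std_simplex (\<lambda>x. bary ?N x * bary ?N x)"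
      "set_integrable lborel std_simplex (\<lambda>x. bary ?N x * bary ?I x)"
      "set_integrable lborel std_simplex (\<lambda>x. (1/4) * ?g x)"
      by (intro int continuous_intros)+
    then show ?thesis
      using set_integral_add(2)[of lborel std_simplex "\<lambda>x. bary ?N x * bary ?N x + bary ?N x * bary ?I x" "\<lambda>x. (1/4) * ?g x"]
        set_integral_add[of lborel std_simplex "\<lambda>x. bary ?N x * bary ?N x" "\<lambda>x. bary ?N x * bary ?I x"]
      by (simp only: NN set_integral_mult_right)
  qed
  \<comment> \<open>With \<open>x\<close> the moment of the square and \<open>y\<close> the mixed
    one, the summands are the contributions of the two halves. Each has the factor 1/2 from the
    volume; on the first the coordinate is halved, on the second it is a full coordinate plus half
    of the other one.\<close>
  have "x = 2 * y" if "x = 1/2 * (1/4 * x) + 1/2 * (x + y + 1/4 * x)" for x y :: real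
    using that by (simp add: field_simps)
  then show ?thesis
    using e1 unfolding e2 e3 e4 e5 set_integral_mult_right by blast
qed

text \<open>No iterated integral is evaluated. If \<open>b\<close> is the off-diagonal moment, the
  diagonal one is 2b, and multiplying by the sum 1 of all coordinates gives (d + 2) b for a first
  moment and (d + 1)(d + 2) b for the volume.\<close>

lemma moment_bary:
  fixes s t :: "'n::finite option"
  shows "(LINT x:std_simplex|lborel. bary s x)
      = measure lborel (std_simplex :: (real^'n) set) / (real CARD('n) + 1)" (is ?A)
    and "(LINT x:std_simplex|lborel. bary s x * bary t x)
      = measure lborel (std_simplex :: (real^'n) set) * (1 + of_bool (s = t))
        / ((real CARD('n) + 1) * (real CARD('n) + 2))" (is ?B)
proof -
  let ?N = "None :: 'n option" and ?d = "real CARD('n)" and ?V = "measure lborel (std_simplex :: (real^'n) set)"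
  fix i0 :: 'n
  let ?E = "\<lambda>s t. LINT x:std_simplex|lborel. bary s x * bary t (x :: real^'n)"
  note int = set_integrable_std_simplex[where 'n = 'n]
  define b where "b = ?E ?N (Some i0)"
  have sym: "?E s t = ?E t s" for s t by (simp add: mult.commute)
  have off0: "?E ?N t = b" if "t \<noteq> ?N" for t
    using moment_bary_swap[of t "Some i0" ?N "Some i0"] that
    by (simp add: b_def Transposition.transpose_def)
  have off: "?E s t = b" if "s \<noteq> t" for s t
  proof (cases "s = ?N")
    case False
    have "?E s t = ?E ?N (Transposition.transpose s ?N t)"
      using moment_bary_swap[of s ?N s t] by simp
    moreover have "Transposition.transpose s ?N t \<noteq> ?N"
      using that by (auto simp: Transposition.transpose_def)
    ultimately show ?thesis using off0 by simp
  qed (use off0 that in metis)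
  have diag: "?E s s = 2 * b" for s
  proof -
    have "?E s s = ?E (Some i0) (Some i0)"
      using moment_bary_swap[of s "Some i0" s s] by simp
    then show ?thesis using moment_bary_square[of i0] by (simp add: b_def)
  qed
  have card: "real CARD('n option) = ?d + 1" by simp
  have first: "(LINT x:std_simplex|lborel. bary s x) = (?d + 2) * b" for s :: "'n option"
  proof -
    have "(LINT x:std_simplex|lborel. bary s (x :: real^'n)) = (LINT x:std_simplex|lborel. (\<Sum>t\<in>UNIV. bary s x * bary t x))"
      by (simp add: sum_distrib_left[symmetric] sum_bary)
    also have "\<dots> = (\<Sum>t\<in>UNIV. ?E s t)"
      unfolding set_lebesgue_integral_def scaleR_sum_right
      by (rule Bochner_Integration.integral_sum)
        (rule int[unfolded set_integrable_def], intro continuous_intros)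
    also have "\<dots> = (\<Sum>t\<in>UNIV. b + (if t = s then b else 0))"
      using diag off by (intro sum.cong) auto
    also have "\<dots> = (?d + 2) * b"
      by (simp add: sum.distrib algebra_simps)
    finally show ?thesis .
  qed
  have "?V = (LINT x:std_simplex|lborel. (\<Sum>s\<in>UNIV. bary s (x :: real^'n)))"
    by (simp add: sum_bary set_integral_const compact_std_simplex)
  also have "\<dots> = (\<Sum>s\<in>UNIV. LINT x:std_simplex|lborel. bary s (x :: real^'n))"
    unfolding set_lebesgue_integral_def scaleR_sum_right
    by (rule Bochner_Integration.integral_sum)
      (rule int[unfolded set_integrable_def], intro continuous_intros)
  also have "\<dots> = (?d + 1) * (?d + 2) * b"
    by (simp add: first algebra_simps)
  finally have V: "?V = (?d + 1) * (?d + 2) * b" .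
  show ?A unfolding first V by simp
  show ?B using off[of s t] diag[of s] unfolding V by (cases "s = t") auto
qed

text \<open>The linear part of the affine map that carries the standard simplex to the simplex with
  apex \<open>p\<close> and opposite vertices \<open>u i\<close>.\<close>

definition simplex_map :: "real^'n \<Rightarrow> ('n \<Rightarrow> real^'n) \<Rightarrow> real^'n \<Rightarrow> real^'n" where
  "simplex_map p u x = (\<Sum>i\<in>UNIV. x $ i *\<^sub>R (u i - p))"

lemma linear_simplex_map: "linear (simplex_map p u)"
  unfolding simplex_map_def by (intro linearI) (auto simp: scaleR_add_left sum.distrib scaleR_sum_right)

lemma simplex_map_axis: "simplex_map p u (axis i 1) = u i - p"
  by (simp add: simplex_map_def axis_def if_distrib[of "\<lambda>c. c *\<^sub>R _"] cong: if_cong)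

lemma simplex_map_image: "(\<lambda>x. p + simplex_map p u x) ` std_simplex = convex hull (insert p (range u))"
proof -
  have "(\<lambda>x. p + simplex_map p u x) ` std_simplex = (+) p ` (simplex_map p u ` std_simplex)"
    by (simp add: image_image)
  also have "\<dots> = convex hull ((+) p ` simplex_map p u ` insert 0 Basis)"
    unfolding convex_hull_linear_image[OF linear_simplex_map] convex_hull_translation ..
  also have "(+) p ` simplex_map p u ` insert 0 Basis = insert p (range u)"
    unfolding Basis_cart by (auto simp: image_image simplex_map_axis linear_0[OF linear_simplex_map])
  finally show ?thesis .
qed

text \<open>The factor \<open>1 + of_bool (s = t)\<close> of the barycentric moments splits the
  double sum over the vertices: the 1 yields the product of the two vertex sums, the diagonal the
  single sum over the vertices.\<close>

lemma simplex_moments: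
  fixes p :: "real^'n" and u :: "'n \<Rightarrow> real^'n"
  assumes nz: "det (matrix (simplex_map p u)) \<noteq> 0"
  defines "\<Delta> \<equiv> convex hull (insert p (range u))" and "S \<equiv> p + (\<Sum>i\<in>UNIV. u i)"
  shows "measure lborel \<Delta> = \<bar>det (matrix (simplex_map p u))\<bar> * measure lborel (std_simplex :: (real^'n) set)"
    and "(LINT x:\<Delta>|lborel. a \<bullet> x) = measure lborel \<Delta> * (a \<bullet> S) / (real CARD('n) + 1)"
    and "(LINT x:\<Delta>|lborel. (a \<bullet> x) * (b \<bullet> x)) = measure lborel \<Delta> *
      ((a \<bullet> S) * (b \<bullet> S) + (a \<bullet> p) * (b \<bullet> p) + (\<Sum>i\<in>UNIV. (a \<bullet> u i) * (b \<bullet> u i)))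
      / ((real CARD('n) + 1) * (real CARD('n) + 2))"
proof -
  let ?f = "simplex_map p u" and ?D = "\<bar>det (matrix (simplex_map p u))\<bar>" and ?d = "real CARD('n)"
  let ?V = "measure lborel (std_simplex :: (real^'n) set)"
  note lin = linear_simplex_map[of p u] and int = set_integrable_std_simplex[where 'n = 'n]
  note im = simplex_map_image[of p u, folded \<Delta>_def]
  show V: "measure lborel \<Delta> = ?D * ?V"
    using measure_affine_image[OF lin nz compact_std_simplex, of p] by (simp add: im)
  define w where "w s = (case s of None \<Rightarrow> p | Some i \<Rightarrow> u i)" for s
  have w: "a \<bullet> (p + ?f x) = (\<Sum>s\<in>UNIV. (a \<bullet> w s) * bary s x)" for a x
    by (simp add: sum_option w_def bary_simps simplex_map_def inner_add_right inner_sum_right inner_diff_right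
        algebra_simps sum_distrib_left sum_subtractf)
  have sw: "(\<Sum>s\<in>UNIV. a \<bullet> w s) = a \<bullet> S" for a
    by (simp add: sum_option w_def S_def inner_add_right inner_sum_right)
  have "(LINT x:\<Delta>|lborel. a \<bullet> x) = ?D * (LINT x:std_simplex|lborel. a \<bullet> (p + ?f x))"
    unfolding im[symmetric] by (rule set_integral_affine_image[OF lin nz compact_std_simplex]) simp
  also have "(LINT x:std_simplex|lborel. a \<bullet> (p + ?f x))
      = (\<Sum>s\<in>UNIV. LINT x:std_simplex|lborel. (a \<bullet> w s) * bary s x)"
  proof -
    have "integrable lborel (\<lambda>x. indicator std_simplex x *\<^sub>R ((a \<bullet> w s) * bary s x))" for s
      by (rule int[unfolded set_integrable_def]) (intro continuous_intros)
    then show ?thesis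
      unfolding w set_lebesgue_integral_def scaleR_sum_right
      by (simp only: Bochner_Integration.integral_sum)
  qed
  also have "\<dots> = (\<Sum>s\<in>UNIV. (a \<bullet> w s) * (?V / (?d + 1)))"
    by (simp add: moment_bary)
  also have "\<dots> = ?V * (a \<bullet> S) / (?d + 1)"
    by (simp only: sum_distrib_right[symmetric] sw) simp
  finally show "(LINT x:\<Delta>|lborel. a \<bullet> x) = measure lborel \<Delta> * (a \<bullet> S) / (?d + 1)"
    by (simp add: V)
  have "(LINT x:\<Delta>|lborel. (a \<bullet> x) * (b \<bullet> x))
      = ?D * (LINT x:std_simplex|lborel. (a \<bullet> (p + ?f x)) * (b \<bullet> (p + ?f x)))"
    unfolding im[symmetric] by (rule set_integral_affine_image[OF lin nz compact_std_simplex]) simp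
  also have "(LINT x:std_simplex|lborel. (a \<bullet> (p + ?f x)) * (b \<bullet> (p + ?f x)))
      = (LINT x:std_simplex|lborel. (\<Sum>s\<in>UNIV. \<Sum>t\<in>UNIV. ((a \<bullet> w s) * (b \<bullet> w t)) * (bary s x * bary t x)))"
    unfolding w sum_product by (simp add: algebra_simps)
  also have "\<dots> = (\<Sum>s\<in>UNIV. \<Sum>t\<in>UNIV. LINT x:std_simplex|lborel. ((a \<bullet> w s) * (b \<bullet> w t)) * (bary s x * bary t x))"
  proof -
    have "integrable lborel (\<lambda>x. indicator std_simplex x *\<^sub>R (((a \<bullet> w s) * (b \<bullet> w t)) * (bary s x * bary t x)))" for s t
      by (rule int[unfolded set_integrable_def]) (intro continuous_intros)
    then show ?thesis
      unfolding set_lebesgue_integral_def scaleR_sum_right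
      by (simp only: Bochner_Integration.integral_sum Bochner_Integration.integrable_sum)
  qed
  also have "\<dots> = (\<Sum>s\<in>UNIV. \<Sum>t\<in>UNIV. ((a \<bullet> w s) * (b \<bullet> w t)) * (?V * (1 + of_bool (s = t)) / ((?d + 1) * (?d + 2))))"
    by (simp add: moment_bary)
  also have "\<dots> = ?V / ((?d + 1) * (?d + 2)) * ((\<Sum>s\<in>UNIV. \<Sum>t\<in>UNIV. (a \<bullet> w s) * (b \<bullet> w t))
      + (\<Sum>s\<in>UNIV. \<Sum>t\<in>UNIV. if t = s then (a \<bullet> w s) * (b \<bullet> w t) else 0))"
    unfolding distrib_left sum_distrib_left sum.distrib[symmetric]
    by (intro sum.cong refl) (auto simp: algebra_simps)
  also have "(\<Sum>s\<in>UNIV. \<Sum>t\<in>UNIV. (a \<bullet> w s) * (b \<bullet> w t)) = (a \<bullet> S) * (b \<bullet> S)"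
    by (simp add: sum_product[symmetric] sw)
  also have "(\<Sum>s\<in>UNIV. \<Sum>t\<in>UNIV. if t = s then (a \<bullet> w s) * (b \<bullet> w t) else 0)
      = (a \<bullet> p) * (b \<bullet> p) + (\<Sum>i\<in>UNIV. (a \<bullet> u i) * (b \<bullet> u i))"
    by (simp add: sum_option w_def)
  finally show "(LINT x:\<Delta>|lborel. (a \<bullet> x) * (b \<bullet> x)) = measure lborel \<Delta> *
      ((a \<bullet> S) * (b \<bullet> S) + (a \<bullet> p) * (b \<bullet> p) + (\<Sum>i\<in>UNIV. (a \<bullet> u i) * (b \<bullet> u i)))
      / ((?d + 1) * (?d + 2))"
    by (simp only: V times_divide_eq_left times_divide_eq_right mult.assoc add.assoc)
qed

subsection \<open>Simplicial cones\<close>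

text \<open>Applied to bases only: outside the span of \<open>V\<close>, or for dependent
  \<open>V\<close>, \<open>representation\<close> is 0 by default and every such point would count
  as a member.\<close>

definition simplicial_cone :: "'a::euclidean_space set \<Rightarrow> 'a set" where
  "simplicial_cone V = {x. \<forall>v\<in>V. 0 \<le> representation V x v}"

text \<open>The vertex set of a simplicial facet: the hyperplane of the facet avoids the interior
  point 0, so its d affinely independent vertices are linearly independent.\<close>

locale vector_basis =
  fixes V :: "'a::euclidean_space set"
  assumes independent: "independent V" and card: "card V = DIM('a)"
begin

lemma finite: "finite V"
  using independent by (rule independent_imp_finite)

lemma span: "span V = UNIV"
  using card_eq_dim[of V UNIV] independent card finite by (auto simp: dim_UNIV)

lemma linear_coord: "linear (\<lambda>x. representation V x v)"
  by (intro linearI) (simp_all add: representation_add representation_scale independent span)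

lemma coord_sum: "(\<Sum>v\<in>V. representation V x v *\<^sub>R v) = x"
  using sum_representation_eq[OF independent _ finite order_refl] span by auto

lemma coord_basis: "v \<in> V \<Longrightarrow> representation V v u = (if u = v then 1 else 0)"
  using representation_basis[OF independent] by simp

lemma coord_combination:
  assumes "v \<in> V"
  shows "representation V (\<Sum>u\<in>V. c u *\<^sub>R u) v = c v"
proof -
  have "representation V (\<Sum>u\<in>V. c u *\<^sub>R u) v = (\<Sum>u\<in>V. c u * representation V u v)"
    using linear_sum[OF linear_coord[of v], of "\<lambda>u. c u *\<^sub>R u" V] linear_scale[OF linear_coord[of v]] by simp
  also have "\<dots> = (\<Sum>u\<in>V. if u = v then c u else 0)"
    by (intro sum.cong) (auto simp: coord_basis)
  finally show ?thesis using assms finite by simp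
qed

lemma continuous_coord [continuous_intros]:
  "continuous_on S f \<Longrightarrow> continuous_on S (\<lambda>x. representation V (f x) v)"
  using continuous_on_compose2[of UNIV "\<lambda>x. representation V x v" S f] linear_coord[of v]
  by (simp add: linear_continuous_on linear_conv_bounded_linear)

lemma simplicial_coneI: "(\<And>v. v \<in> V \<Longrightarrow> 0 \<le> c v) \<Longrightarrow> (\<Sum>v\<in>V. c v *\<^sub>R v) \<in> simplicial_cone V"
  by (simp add: simplicial_cone_def coord_combination)

lemma open_coord_pos: "open {x. \<forall>v\<in>T. 0 < representation V x v}" if "T \<subseteq> V"
proof -
  have "{x. \<forall>v\<in>T. 0 < representation V x v} = (\<Inter>v\<in>T. {x. 0 < representation V x v})" by auto
  also have "open \<dots>"
    using that finite by (intro open_INT ballI open_Collect_less continuous_intros) (auto intro: finite_subset)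
  finally show ?thesis .
qed

lemma closed_simplicial_cone: "closed (simplicial_cone V)"
proof -
  have "simplicial_cone V = (\<Inter>v\<in>V. {x. 0 \<le> representation V x v})"
    by (auto simp: simplicial_cone_def)
  also have "closed \<dots>"
    by (intro closed_INT ballI closed_Collect_le continuous_intros)
  finally show ?thesis .
qed

lemma inner_eq_sum_coord:
  assumes "\<And>v. v \<in> V \<Longrightarrow> a \<bullet> v = 1"
  shows "a \<bullet> x = (\<Sum>v\<in>V. representation V x v)"
proof -
  have "a \<bullet> x = a \<bullet> (\<Sum>v\<in>V. representation V x v *\<^sub>R v)" by (simp add: coord_sum)
  then show ?thesis by (simp add: inner_sum_right assms)
qed

lemma inner_eq_onI:
  assumes "\<And>v. v \<in> V \<Longrightarrow> a \<bullet> v = b \<bullet> v"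
  shows "a = b"
proof -
  have "a \<bullet> x = b \<bullet> x" for x
  proof -
    have "a \<bullet> (\<Sum>v\<in>V. representation V x v *\<^sub>R v) = b \<bullet> (\<Sum>v\<in>V. representation V x v *\<^sub>R v)"
      by (simp add: inner_sum_right assms)
    then show ?thesis by (simp add: coord_sum)
  qed
  then show ?thesis using vector_eq_rdot by blast
qed

lemma convex_hull_insert_0_iff:
  "x \<in> convex hull (insert 0 V) \<longleftrightarrow> x \<in> simplicial_cone V \<and> (\<Sum>v\<in>V. representation V x v) \<le> 1"
proof -
  have "0 \<notin> V" using independent dependent_zero by blast
  then have "x \<in> convex hull (insert 0 V) \<longleftrightarrow>
      (\<exists>c. (\<forall>v\<in>V. 0 \<le> c v) \<and> sum c V \<le> 1 \<and> (\<Sum>v\<in>V. c v *\<^sub>R v) = x)"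
    using finite unfolding Starlike.simplex[OF finite \<open>0 \<notin> V\<close>] by simp
  also have "\<dots> \<longleftrightarrow> x \<in> simplicial_cone V \<and> (\<Sum>v\<in>V. representation V x v) \<le> 1"
  proof (intro iffI; elim exE conjE)
    fix c assume c: "\<forall>v\<in>V. 0 \<le> c v" "sum c V \<le> 1" and x: "(\<Sum>v\<in>V. c v *\<^sub>R v) = x"
    have "representation V x v = c v" if "v \<in> V" for v
      using coord_combination[OF that, of c] x by simp
    then show "x \<in> simplicial_cone V \<and> (\<Sum>v\<in>V. representation V x v) \<le> 1"
      using c by (simp add: simplicial_cone_def)
  next
    assume "x \<in> simplicial_cone V" "(\<Sum>v\<in>V. representation V x v) \<le> 1"
    then show "\<exists>c. (\<forall>v\<in>V. 0 \<le> c v) \<and> sum c V \<le> 1 \<and> (\<Sum>v\<in>V. c v *\<^sub>R v) = x"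
      by (intro exI[of _ "representation V x"]) (simp add: simplicial_cone_def coord_sum)
  qed
  finally show ?thesis .
qed

lemma extreme_point_iff: "x extreme_point_of (convex hull V) \<longleftrightarrow> x \<in> V"
  using extreme_point_of_convex_hull_affine_independent[of V x] affine_dependent_imp_dependent independent by blast

end

text \<open>
  The spherical triangulation determined by a simplicial polytope containing the origin in its
  interior: \<open>\<V>\<close> consists of the vertex sets of the facets and \<open>a V \<bullet> x = 1\<close> is the hyperplane of the
  facet with vertex set \<open>V\<close>.
\<close>

locale simplicial_fan =
  fixes P :: "'a::euclidean_space set" and \<V> :: "'a set set" and a :: "'a set \<Rightarrow> 'a"
  assumes finite_facets: "finite \<V>"
    and basis: "V \<in> \<V> \<Longrightarrow> vector_basis V"
    and normal: "V \<in> \<V> \<Longrightarrow> v \<in> V \<Longrightarrow> a V \<bullet> v = 1"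
    and P_eq: "P = {x. \<forall>V\<in>\<V>. a V \<bullet> x \<le> 1}"
    and facet: "V \<in> \<V> \<Longrightarrow> P \<inter> {x. a V \<bullet> x = 1} = convex hull V"
    and bounded: "bounded P"
begin

lemma vertex_in:
  assumes "V \<in> \<V>" "v \<in> V"
  shows "v \<in> P"
  using facet[OF assms(1)] hull_inc[OF assms(2), of convex] by blast

lemma inner_vertex_le: "W \<in> \<V> \<Longrightarrow> V \<in> \<V> \<Longrightarrow> v \<in> V \<Longrightarrow> a W \<bullet> v \<le> 1"
  using vertex_in[of V v] P_eq by auto

text \<open>Every normal is at most 1 on the vertices of \<open>V\<close>, where \<open>a V\<close>
  equals 1. So the cone over \<open>V\<close> lies where \<open>a V\<close> is the largest of the
  normals; for nonzero points this maximum is the gauge of \<open>P\<close>.\<close>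

lemma inner_le_in_cone:
  assumes "V \<in> \<V>" "W \<in> \<V>" "x \<in> simplicial_cone V"
  shows "a W \<bullet> x \<le> a V \<bullet> x"
proof -
  interpret vector_basis V by (rule basis) fact
  have "a W \<bullet> x = a W \<bullet> (\<Sum>v\<in>V. representation V x v *\<^sub>R v)" by (simp add: coord_sum)
  also have "\<dots> = (\<Sum>v\<in>V. representation V x v * (a W \<bullet> v))"
    by (simp add: inner_sum_right)
  also have "\<dots> \<le> (\<Sum>v\<in>V. representation V x v)"
    using assms inner_vertex_le by (intro sum_mono) (auto simp: simplicial_cone_def mult_left_le)
  also have "\<dots> = a V \<bullet> x"
    using inner_eq_sum_coord[of "a V" x] normal assms by simp
  finally show ?thesis .
qed

text \<open>Otherwise the whole ray through \<open>x\<close> would satisfy the inequalities,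
  although \<open>P\<close> is bounded.\<close>

lemma normal_pos:
  assumes "x \<noteq> 0"
  shows "\<exists>V\<in>\<V>. 0 < a V \<bullet> x"
proof (rule ccontr)
  assume "\<not> ?thesis"
  then have le: "a V \<bullet> x \<le> 0" if "V \<in> \<V>" for V using that by force
  obtain B where B: "\<And>y. y \<in> P \<Longrightarrow> norm y \<le> B"
    using bounded by (auto simp: bounded_iff)
  define t where "t = (\<bar>B\<bar> + 1) / norm x"
  have "t \<ge> 0" by (simp add: t_def)
  then have "t *\<^sub>R x \<in> P"
    unfolding P_eq using le by (auto simp: mult_nonneg_nonpos intro: order_trans[of _ 0])
  from B[OF this] show False using assms by (simp add: t_def)
qed

text \<open>Choose a facet whose normal is largest at \<open>x\<close>; dividing \<open>x\<close> by
  that positive maximum puts it on the facet.\<close>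

lemma cone_cover:
  obtains V where "V \<in> \<V>" "x \<in> simplicial_cone V"
proof (cases "x = 0")
  case True
  \<comment> \<open>The origin lies in every cone; a nonzero vector only serves to show that there
    is a facet at all.\<close>
  obtain y :: 'a where "y \<noteq> 0" using nonzero_Basis SOME_Basis by blast
  then obtain V where "V \<in> \<V>" using normal_pos by blast
  then show ?thesis
    using that True by (auto simp: simplicial_cone_def representation_zero)
next
  case False
  then obtain V0 where V0: "V0 \<in> \<V>" "0 < a V0 \<bullet> x" using normal_pos by blast
  define m where "m = Max ((\<lambda>V. a V \<bullet> x) ` \<V>)"
  have fin: "finite ((\<lambda>V. a V \<bullet> x) ` \<V>)" "(\<lambda>V. a V \<bullet> x) ` \<V> \<noteq> {}" using finite_facets V0 by auto
  obtain V where V: "V \<in> \<V>" "a V \<bullet> x = m" using Max_in[OF fin] by (auto simp: m_def)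
  have le: "a W \<bullet> x \<le> m" if "W \<in> \<V>" for W using that fin by (auto simp: m_def)
  have "m > 0" using le[OF V0(1)] V0(2) by simp
  interpret vector_basis V by (rule basis) fact
  define y where "y = (1 / m) *\<^sub>R x"
  have "y \<in> P \<inter> {x. a V \<bullet> x = 1}"
    unfolding P_eq using le V \<open>m > 0\<close> by (auto simp: y_def)
  then have "y \<in> convex hull V" using facet V by blast
  then have "y \<in> convex hull (insert 0 V)" by (meson hull_mono subsetD subset_insertI)
  then have "y \<in> simplicial_cone V" by (simp add: convex_hull_insert_0_iff)
  moreover have "representation V x v = m * representation V y v" for v
    using linear_scale[OF linear_coord[of v], of m y] \<open>m > 0\<close> by (simp add: y_def)
  ultimately have "x \<in> simplicial_cone V"
    using \<open>m > 0\<close> by (simp add: simplicial_cone_def)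
  then show ?thesis using that V by blast
qed

lemma mem_iff: "V \<in> \<V> \<Longrightarrow> x \<in> simplicial_cone V \<Longrightarrow> x \<in> P \<longleftrightarrow> a V \<bullet> x \<le> 1"
  unfolding P_eq using inner_le_in_cone by (auto intro: order_trans)

lemma mem_simplex_iff:
  assumes "V \<in> \<V>"
  shows "x \<in> convex hull (insert 0 V) \<longleftrightarrow> x \<in> P \<and> x \<in> simplicial_cone V"
proof -
  interpret vector_basis V by (rule basis) fact
  show ?thesis
    using inner_eq_sum_coord[of "a V" x] normal assms mem_iff
    by (auto simp: convex_hull_insert_0_iff)
qed

lemma P_eq_Union: "P = (\<Union>V\<in>\<V>. convex hull (insert 0 V))"
proof -
  have "x \<in> P \<longleftrightarrow> (\<exists>V\<in>\<V>. x \<in> convex hull (insert 0 V))" for x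
  proof -
    obtain V where "V \<in> \<V>" "x \<in> simplicial_cone V" by (rule cone_cover)
    then show ?thesis by (auto simp: mem_simplex_iff)
  qed
  then show ?thesis by auto
qed

lemma P_eq_Inter: "P = (\<Inter>V\<in>\<V>. {x. a V \<bullet> x \<le> 1})"
  unfolding P_eq by auto

lemma convex_P: "convex P"
  by (subst P_eq_Inter) (simp add: convex_INT convex_halfspace_le)

lemma compact_P: "compact P"
proof -
  have "closed P" by (subst P_eq_Inter) (simp add: closed_INT closed_halfspace_le)
  then show ?thesis using bounded compact_eq_bounded_closed by blast
qed

lemma extreme_point: "V \<in> \<V> \<Longrightarrow> v \<in> V \<Longrightarrow> v extreme_point_of P"
proof -
  assume V: "V \<in> \<V>" "v \<in> V"
  interpret vector_basis V by (rule basis) fact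
  have "(P \<inter> {x. a V \<bullet> x = 1}) face_of P"
    by (rule face_of_Int_supporting_hyperplane_le[OF convex_P]) (use P_eq V in auto)
  then have "(convex hull V) face_of P" using facet[OF V(1)] by simp
  then show "v extreme_point_of P"
    using extreme_point_of_face V(2) extreme_point_iff by blast
qed

text \<open>Being extreme in \<open>P\<close>, the vertex is extreme in every facet that contains
  it, and the extreme points of a simplex are its vertices.\<close>

lemma vertex_in_other_facet:
  assumes "V \<in> \<V>" "W \<in> \<V>" "v \<in> V" "a W \<bullet> v = 1"
  shows "v \<in> W"
proof -
  interpret W: vector_basis W by (rule basis) fact
  have "v \<in> convex hull W" using facet[OF assms(2)] vertex_in[OF assms(1,3)] assms(4) by blast
  moreover have "convex hull W \<subseteq> P" using facet[OF assms(2)] by blast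
  ultimately have "v extreme_point_of (convex hull W)"
    using extreme_point[OF assms(1,3)] by (auto simp: extreme_point_of_def)
  then show ?thesis using W.extreme_point_iff by simp
qed

lemma facet_subset_imp_eq:
  assumes "V \<in> \<V>" "W \<in> \<V>" "V \<subseteq> W"
  shows "V = W"
proof -
  interpret V: vector_basis V by (rule basis) fact
  interpret W: vector_basis W by (rule basis) fact
  show ?thesis using card_subset_eq[OF W.finite assms(3)] V.card W.card by simp
qed

lemma normal_inj:
  assumes "V \<in> \<V>" "W \<in> \<V>" "a V = a W"
  shows "V = W"
proof -
  have "v \<in> W" if "v \<in> V" for v
    using vertex_in_other_facet[OF assms(1,2) that] normal[OF assms(1) that] assms(3) by simp
  then show ?thesis using facet_subset_imp_eq[OF assms(1,2)] by blast
qed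

text \<open>Equality is forced in the comparison of \<open>a U\<close> with \<open>a W\<close> at
  this sum, hence at each vertex of \<open>U\<close> separately, so that all of \<open>U\<close>
  lies on the facet of \<open>W\<close>.\<close>

lemma sum_facet_in_cone:
  assumes "U \<in> \<V>" "W \<in> \<V>" "\<Sum>U \<in> simplicial_cone W"
  shows "U = W"
proof -
  interpret U: vector_basis U by (rule basis) fact
  have eq: "a U \<bullet> \<Sum>U = card U" using normal[OF assms(1)] by (simp add: inner_sum_right)
  have "a U \<bullet> \<Sum>U \<le> a W \<bullet> \<Sum>U" by (rule inner_le_in_cone) fact+
  then have "(\<Sum>u\<in>U. 1 - a W \<bullet> u) \<le> 0"
    using eq by (simp add: inner_sum_right sum_subtractf)
  moreover have nn: "0 \<le> 1 - a W \<bullet> u" if "u \<in> U" for u using inner_vertex_le assms that by force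
  ultimately have "(\<Sum>u\<in>U. 1 - a W \<bullet> u) = 0" by (meson order_antisym sum_nonneg)
  then have "a W \<bullet> u = 1" if "u \<in> U" for u
    using nn that U.finite by (subst (asm) sum_nonneg_eq_0_iff) auto
  then have "U \<subseteq> W" using vertex_in_other_facet[OF assms(1,2)] by blast
  then show ?thesis by (rule facet_subset_imp_eq[OF assms(1,2)])
qed

text \<open>Start at the vertex sum of the ridge and step across it, a little way against
  \<open>v\<close>. The facet whose cone contains the new point must contain the ridge, and its
  remaining vertex has to account for the negative coordinate at \<open>v\<close>.\<close>

lemma neighbour:
  assumes V: "V \<in> \<V>" and v: "v \<in> V"
  obtains w where "insert w (V - {v}) \<in> \<V>" "representation V w v < 0"
proof -
  interpret V: vector_basis V by (rule basis) fact
  define R where "R = V - {v}"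
  define z where "z = \<Sum>R"
  have finR: "finite R" using V.finite by (simp add: R_def)
  \<comment> \<open>A facet contains the ridge exactly when its normal takes the value
    \<open>card R\<close> at \<open>z\<close>. For all others there is a gap, which small
    \<open>e\<close> preserves, so that at \<open>z - e *\<^sub>R v\<close> they stay below
    \<open>a V\<close>, whose value there is \<open>card R - e\<close>.\<close>
  have "\<forall>\<^sub>F e in at_right (0::real). \<forall>W\<in>\<V>. a W \<bullet> z < card R \<longrightarrow> a W \<bullet> z - e * (a W \<bullet> v) < real (card R) - e"
  proof (intro eventually_ball_finite finite_facets ballI)
    fix W assume "W \<in> \<V>"
    show "\<forall>\<^sub>F e in at_right (0::real). a W \<bullet> z < card R \<longrightarrow> a W \<bullet> z - e * (a W \<bullet> v) < real (card R) - e"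
    proof (cases "a W \<bullet> z < card R")
      case True
      have "((\<lambda>e::real. (a W \<bullet> z - e * (a W \<bullet> v)) - (real (card R) - e)) \<longlongrightarrow> (a W \<bullet> z - 0 * (a W \<bullet> v)) - (real (card R) - 0)) (at_right 0)"
        by (intro tendsto_intros)
      then have "\<forall>\<^sub>F e in at_right 0. (a W \<bullet> z - e * (a W \<bullet> v)) - (real (card R) - e) < 0"
        using True by (intro order_tendstoD) auto
      then show ?thesis by eventually_elim auto
    qed simp
  qed
  moreover have "\<forall>\<^sub>F e in at_right (0::real). 0 < e" by (rule eventually_at_right_less)
  ultimately have "\<forall>\<^sub>F e in at_right (0::real). 0 < e \<and> (\<forall>W\<in>\<V>. a W \<bullet> z < card R \<longrightarrow> a W \<bullet> z - e * (a W \<bullet> v) < real (card R) - e)"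
    by eventually_elim simp
  then obtain e :: real where e: "0 < e" "\<And>W. W \<in> \<V> \<Longrightarrow> a W \<bullet> z < card R \<Longrightarrow> a W \<bullet> z - e * (a W \<bullet> v) < real (card R) - e"
    using eventually_happens'[OF trivial_limit_at_right_real] by blast
  define x where "x = z - e *\<^sub>R v"
  obtain W where W: "W \<in> \<V>" "x \<in> simplicial_cone W" by (rule cone_cover)
  interpret W: vector_basis W by (rule basis) fact
  have VR: "a V \<bullet> z = card R" using normal[OF V] by (simp add: z_def inner_sum_right R_def)
  have "a V \<bullet> x \<le> a W \<bullet> x" by (rule inner_le_in_cone) (use V W in auto)
  then have "real (card R) - e \<le> a W \<bullet> z - e * (a W \<bullet> v)"
    using VR normal[OF V v] by (simp add: x_def inner_diff_right)
  then have "card R \<le> a W \<bullet> z" using e(2)[OF W(1)] by force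
  then have "(\<Sum>r\<in>R. 1 - a W \<bullet> r) \<le> 0"
    by (simp add: z_def inner_sum_right sum_subtractf)
  moreover have nn: "0 \<le> 1 - a W \<bullet> r" if "r \<in> R" for r
    using inner_vertex_le[OF W(1) V, of r] that by (simp add: R_def)
  ultimately have "(\<Sum>r\<in>R. 1 - a W \<bullet> r) = 0" by (meson order_antisym sum_nonneg)
  then have "a W \<bullet> r = 1" if "r \<in> R" for r
    using nn that finR by (subst (asm) sum_nonneg_eq_0_iff) auto
  then have RW: "R \<subseteq> W"
    using vertex_in_other_facet[OF V W(1)] by (auto simp: R_def)
  have "card (W - R) = 1"
    using card_Diff_subset[OF finR RW] V.card W.card V.finite v by (simp add: R_def)
  then obtain w where "W - R = {w}" by (rule card_1_singletonE)
  then have W_eq: "W = insert w R" and wR: "w \<notin> R" using RW by auto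
  let ?c = "representation V"
  have zv: "?c z v = 0"
  proof -
    have "?c z v = (\<Sum>r\<in>R. ?c r v)"
      unfolding z_def using linear_sum[OF V.linear_coord[of v], of "\<lambda>r. r" R] by simp
    also have "\<dots> = 0" by (intro sum.neutral) (auto simp: R_def V.coord_basis)
    finally show ?thesis .
  qed
  have xv: "?c x v = - e"
    unfolding x_def using linear_diff[OF V.linear_coord[of v]] linear_scale[OF V.linear_coord[of v]] zv
    by (simp add: V.coord_basis v)
  let ?d = "representation W x"
  \<comment> \<open>All vertices of the ridge have coordinate 0 at \<open>v\<close>, so the
    coordinate \<open>- e\<close> of \<open>x\<close> comes from \<open>w\<close> alone, with a
    nonnegative factor.\<close>
  have "x = ?d w *\<^sub>R w + (\<Sum>r\<in>R. ?d r *\<^sub>R r)"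
    using W.coord_sum[of x] finR wR unfolding W_eq by simp
  then have "?c x v = ?c (?d w *\<^sub>R w + (\<Sum>r\<in>R. ?d r *\<^sub>R r)) v" by simp
  also have "\<dots> = ?d w * ?c w v + (\<Sum>r\<in>R. ?d r * ?c r v)"
    using linear_add[OF V.linear_coord[of v]] linear_scale[OF V.linear_coord[of v]]
      linear_sum[OF V.linear_coord[of v], of "\<lambda>r. ?d r *\<^sub>R r" R] by simp
  also have "(\<Sum>r\<in>R. ?d r * ?c r v) = 0"
    by (intro sum.neutral) (auto simp: R_def V.coord_basis)
  finally have "?d w * ?c w v = - e" using xv by simp
  moreover have "0 \<le> ?d w" using W(2) by (simp add: simplicial_cone_def W_eq)
  ultimately have "?c w v < 0"
    using e(1) by (smt (verit) mult_nonneg_nonneg)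
  then show ?thesis using that W(1) W_eq by (simp add: R_def)
qed

lemma negligible_simplices_Int:
  assumes "V \<in> \<V>" "W \<in> \<V>" "V \<noteq> W"
  shows "negligible (convex hull (insert 0 V) \<inter> convex hull (insert 0 W))"
proof (rule negligible_subset)
  have "a V \<noteq> a W" using normal_inj assms by blast
  then show "negligible {x. (a V - a W) \<bullet> x = 0}"
    by (intro negligible_hyperplane) auto
  show "convex hull (insert 0 V) \<inter> convex hull (insert 0 W) \<subseteq> {x. (a V - a W) \<bullet> x = 0}"
  proof
    fix x assume "x \<in> convex hull (insert 0 V) \<inter> convex hull (insert 0 W)"
    then have "x \<in> simplicial_cone V" "x \<in> simplicial_cone W"
      using assms by (auto simp: mem_simplex_iff)
    then have "a W \<bullet> x \<le> a V \<bullet> x" "a V \<bullet> x \<le> a W \<bullet> x"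
      using inner_le_in_cone assms by auto
    then show "x \<in> {x. (a V - a W) \<bullet> x = 0}" by (simp add: inner_diff_left)
  qed
qed

end

subsection \<open>Balanced fans\<close>

text \<open>
  The stationarity condition at an isotropic maximizer. It pins down the neighbour of a facet across a ridge,
  so that a fan is determined by any one of its facets.
\<close>

definition balanced :: "real \<Rightarrow> 'a::euclidean_space set \<Rightarrow> bool" where
  "balanced \<kappa> V \<longleftrightarrow> (\<forall>v\<in>V. v \<bullet> (v + \<Sum>V) = \<kappa>)"

text \<open>The two vertex sums differ by \<open>v - w\<close>, so subtracting the conditions at a
  common vertex makes that vertex orthogonal to \<open>v - w\<close>; the conditions at
  \<open>v\<close> and \<open>w\<close> then differ only by their squared norms.\<close>

lemma balanced_neighbour_eq:
  assumes V: "vector_basis V" and v: "v \<in> V"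
    and bal: "balanced \<kappa> V" "balanced \<kappa> (insert w (V - {v}))"
    and w: "w \<notin> V - {v}"
  shows "norm w = norm v" "\<And>r. r \<in> V - {v} \<Longrightarrow> r \<bullet> w = r \<bullet> v"
proof -
  interpret vector_basis V by fact
  let ?R = "V - {v}"
  have fin: "finite ?R" using finite by simp
  have sV: "\<Sum>V = v + \<Sum>?R" using v finite by (simp add: sum.remove)
  have sW: "\<Sum>(insert w ?R) = w + \<Sum>?R" using w fin by simp
  show rw: "r \<bullet> w = r \<bullet> v" if "r \<in> ?R" for r
  proof -
    have "r \<bullet> (r + \<Sum>V) = \<kappa>" "r \<bullet> (r + \<Sum>(insert w ?R)) = \<kappa>"
      using bal that by (auto simp only: balanced_def)
    then show ?thesis unfolding sV sW by (simp add: inner_add_right)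
  qed
  have "w \<bullet> \<Sum>?R = v \<bullet> \<Sum>?R"
    using rw by (simp add: inner_sum_right inner_commute)
  moreover have "v \<bullet> (v + \<Sum>V) = \<kappa>" "w \<bullet> (w + \<Sum>(insert w ?R)) = \<kappa>"
    using bal v by (auto simp only: balanced_def)
  ultimately have "w \<bullet> w = v \<bullet> v" unfolding sV sW by (simp add: inner_add_right)
  then show "norm w = norm v" by (simp add: norm_eq)
qed

text \<open>Both candidates arise from \<open>v\<close> by a displacement along the normal line of
  the ridge. On that line just two points have the norm of \<open>v\<close>, namely \<open>v\<close>
  and its mirror image, and the negative coordinate excludes \<open>v\<close>.\<close>

lemma balanced_neighbour_unique:
  assumes V: "vector_basis V" and v: "v \<in> V" and bal: "balanced \<kappa> V"
    and b1: "balanced \<kappa> (insert w1 (V - {v}))" "representation V w1 v < 0"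
    and b2: "balanced \<kappa> (insert w2 (V - {v}))" "representation V w2 v < 0"
  shows "w1 = w2"
proof -
  interpret vector_basis V by fact
  let ?R = "V - {v}"
  have notin: "w \<notin> ?R" if "representation V w v < 0" for w
    using that coord_basis[of w v] by (auto split: if_splits)
  note n1 = balanced_neighbour_eq[OF V v bal b1(1) notin[OF b1(2)]]
    and n2 = balanced_neighbour_eq[OF V v bal b2(1) notin[OF b2(2)]]
  define x1 x2 where "x1 = w1 - v" and "x2 = w2 - v"
  define c1 c2 where "c1 = representation V w1 v - 1" and "c2 = representation V w2 v - 1"
  have perp: "r \<bullet> x1 = 0" "r \<bullet> x2 = 0" if "r \<in> ?R" for r
    using n1(2) n2(2) that by (auto simp: x1_def x2_def inner_diff_right)
  \<comment> \<open>The combination is chosen to have coordinate 0 at \<open>v\<close>: it lies in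
    the span of the ridge and is orthogonal to it, hence vanishes, and the two displacements are
    parallel.\<close>
  define y where "y = c2 *\<^sub>R x1 - c1 *\<^sub>R x2"
  have lin: "representation V (c *\<^sub>R p - d *\<^sub>R q) u = c * representation V p u - d * representation V q u" for c d p q u
    using linear_diff[OF linear_coord[of u]] linear_scale[OF linear_coord[of u]] by simp
  have cx: "representation V x1 v = c1" "representation V x2 v = c2"
    using linear_diff[OF linear_coord[of v]] coord_basis[OF v] by (auto simp: x1_def x2_def c1_def c2_def)
  have "representation V y v = 0"
    by (simp add: y_def lin cx)
  then have "y = (\<Sum>r\<in>?R. representation V y r *\<^sub>R r)"
    using coord_sum[of y] v finite by (simp add: sum.remove)
  then have "y \<bullet> y = (\<Sum>r\<in>?R. representation V y r *\<^sub>R r) \<bullet> y" by simp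
  also have "\<dots> = 0"
    by (simp add: inner_sum_left y_def inner_diff_right perp)
  finally have y0: "c2 *\<^sub>R x1 = c1 *\<^sub>R x2" by (simp add: y_def)
  have c: "c1 < 0" "c2 < 0" using b1 b2 by (auto simp: c1_def c2_def)
  define s where "s = c2 / c1"
  have "x2 = (1 / c1) *\<^sub>R (c1 *\<^sub>R x2)" using c by simp
  also have "\<dots> = s *\<^sub>R x1" unfolding y0[symmetric] s_def by simp
  finally have s: "x2 = s *\<^sub>R x1" "s > 0"
    using c by (auto simp: s_def divide_neg_neg)
  have nv: "(v + x1) \<bullet> (v + x1) = v \<bullet> v" "(v + x2) \<bullet> (v + x2) = v \<bullet> v"
    using n1(1) n2(1) by (auto simp: x1_def x2_def norm_eq)
  then have e1: "2 * (v \<bullet> x1) + x1 \<bullet> x1 = 0" and "2 * (s * (v \<bullet> x1)) + s * (s * (x1 \<bullet> x1)) = 0"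
    unfolding s by (auto simp: inner_add_left inner_add_right inner_commute)
  then have "s * (s - 1) * (x1 \<bullet> x1) = 0"
    by algebra
  moreover have "x1 \<noteq> 0" using cx c representation_zero[of V] by force
  ultimately have "s = 1" using s by simp
  then show ?thesis using s by (simp add: x1_def x2_def)
qed

text \<open>Follow a segment from a generic point of a shared cone to a point inside a missing one,
  up to the last point in the union of the shared cones. By genericity it lies inside a shared cone
  or inside a wall between two cones. Since both fans have the same neighbour across the wall, a
  whole neighbourhood is covered by shared cones, against the choice of the last point.\<close>

lemma balanced_fan_subset:
  fixes \<V> \<W> :: "'a::euclidean_space set set"
  assumes P: "simplicial_fan P \<V> a" and Q: "simplicial_fan Q \<W> b"
    and balP: "\<And>V. V \<in> \<V> \<Longrightarrow> balanced \<kappa> V" and balQ: "\<And>V. V \<in> \<W> \<Longrightarrow> balanced \<kappa> V"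
    and V0: "V0 \<in> \<V>" "V0 \<in> \<W>"
  shows "\<V> \<subseteq> \<W>"
proof (rule ccontr)
  interpret P: simplicial_fan P \<V> a by fact
  interpret Q: simplicial_fan Q \<W> b by fact
  interpret V0: vector_basis V0 by (rule P.basis) fact
  assume "\<not> \<V> \<subseteq> \<W>"
  then obtain U where U: "U \<in> \<V>" "U \<notin> \<W>" by blast
  define C where "C = (\<Union>V\<in>\<V> \<inter> \<W>. simplicial_cone V)"
  have "closed C"
    unfolding C_def using P.finite_facets
    by (intro closed_UN) (auto intro: vector_basis.closed_simplicial_cone P.basis)
  define y where "y = \<Sum>U"
  have yC: "y \<notin> C"
    using P.sum_facet_in_cone[OF U(1)] U(2) by (auto simp: C_def y_def)
  \<comment> \<open>Faces with at most d - 2 vertices. Together with the target \<open>y\<close>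
    they span at most d - 1 dimensions, so the starting points to be avoided form a null
    set.\<close>
  define \<T> where "\<T> = {T. (\<exists>V\<in>\<V>. T \<subseteq> V) \<and> Suc (card T) < DIM('a)}"
  have "\<T> \<subseteq> (\<Union>V\<in>\<V>. Pow V)" by (auto simp: \<T>_def)
  moreover have "finite (\<Union>V\<in>\<V>. Pow V)"
    using P.finite_facets vector_basis.finite[OF P.basis] by blast
  ultimately have "finite \<T>" by (rule finite_subset)
  define N where "N = (\<Union>T\<in>\<T>. span (insert y T))"
  have "negligible N"
    unfolding N_def
  proof (intro negligible_Union finite_imageI \<open>finite \<T>\<close>; clarify)
    fix T assume T: "T \<in> \<T>"
    then have "finite T"
      using vector_basis.finite[OF P.basis] finite_subset by (auto simp: \<T>_def)
    then have "dim (span (insert y T)) \<le> card (insert y T)"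
      by (simp add: dim_le_card' del: dim_insert)
    also have "\<dots> \<le> Suc (card T)" by (rule card_insert_le_m1[THEN order_trans]) (auto simp: \<open>finite T\<close> card_insert_if)
    also have "\<dots> < DIM('a)" using T by (simp add: \<T>_def)
    finally show "negligible (span (insert y T))" by (rule negligible_lowdim)
  qed
  let ?O = "{x. \<forall>v\<in>V0. 0 < representation V0 x v}"
  have "open ?O" by (rule V0.open_coord_pos) simp
  moreover have "\<Sum>V0 \<in> ?O"
    using V0.coord_combination[of _ "\<lambda>_. 1"] by simp
  ultimately have "\<not> negligible ?O" using open_not_negligible by blast
  then obtain x where x: "x \<in> ?O" "x \<notin> N"
    using \<open>negligible N\<close> negligible_subset by blast
  then have "x \<in> simplicial_cone V0" by (auto simp: simplicial_cone_def less_imp_le)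
  then have xC: "x \<in> C" using V0 by (auto simp: C_def)
  define \<gamma> where "\<gamma> t = x + t *\<^sub>R (y - x)" for t :: real
  have cont: "continuous_on S \<gamma>" for S unfolding \<gamma>_def by (intro continuous_intros)
  let ?S = "{0..1} \<inter> \<gamma> -` C"
  have "compact ?S"
    using continuous_closed_preimage[OF cont[of "{0..1}"] _ \<open>closed C\<close>] by (simp add: compact_eq_bounded_closed bounded_Int)
  moreover have "0 \<in> ?S" using xC by (simp add: \<gamma>_def)
  ultimately obtain t where t: "t \<in> ?S" and max: "\<And>s. s \<in> ?S \<Longrightarrow> s \<le> t"
    using compact_attains_sup[of ?S] by blast
  have "\<gamma> 1 = y" by (simp add: \<gamma>_def)
  then have t1: "0 \<le> t" "t < 1" using t yC by (auto simp: less_le)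
  define z where "z = \<gamma> t"
  obtain V where V: "V \<in> \<V>" "V \<in> \<W>" "z \<in> simplicial_cone V" using t by (auto simp: C_def z_def)
  interpret V: vector_basis V by (rule P.basis) fact
  let ?c = "representation V"
  \<comment> \<open>Since \<open>t < 1\<close>, the start \<open>x\<close> lies on the line through
    \<open>z\<close> and \<open>y\<close>; if \<open>z\<close> were in the span of a small face,
    \<open>x\<close> would be in an excluded subspace.\<close>
  have nonspan: "z \<notin> span T" if "T \<subseteq> V" "Suc (card T) < DIM('a)" for T
  proof
    assume zT: "z \<in> span T"
    have "z - t *\<^sub>R y = (1 - t) *\<^sub>R x"
      by (simp add: z_def \<gamma>_def algebra_simps)
    then have "x = (1 / (1 - t)) *\<^sub>R (z - t *\<^sub>R y)"
      using t1 by simp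
    moreover have "z \<in> span (insert y T)" "y \<in> span (insert y T)"
      using zT span_mono[of T "insert y T"] by (auto intro: span_base)
    ultimately have "x \<in> span (insert y T)" by (simp add: span_scale span_diff)
    moreover have "T \<in> \<T>" using that V by (auto simp: \<T>_def)
    ultimately show False using x(2) by (auto simp: N_def)
  qed
  have "\<exists>G. open G \<and> z \<in> G \<and> G \<subseteq> C"
  proof (cases "\<forall>v\<in>V. 0 < ?c z v")
    case True
    then have "open {p. \<forall>v\<in>V. 0 < ?c p v} \<and> z \<in> {p. \<forall>v\<in>V. 0 < ?c p v} \<and> {p. \<forall>v\<in>V. 0 < ?c p v} \<subseteq> C"
      using V.open_coord_pos[of V] V(1,2) by (auto simp: C_def simplicial_cone_def less_imp_le)
    then show ?thesis by blast
  next
    case False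
    then obtain v where v: "v \<in> V" "?c z v = 0"
      using V(3) by (force simp: simplicial_cone_def)
    let ?R = "V - {v}"
    have finR: "finite ?R" using V.finite by simp
    have rpos: "0 < ?c z r" if r: "r \<in> ?R" for r
    proof (rule ccontr)
      assume "\<not> 0 < ?c z r"
      then have r0: "?c z r = 0" using V(3) r by (force simp: simplicial_cone_def)
      let ?T = "?R - {r}"
      have "(\<Sum>u\<in>V. ?c z u *\<^sub>R u) = (\<Sum>u\<in>?T. ?c z u *\<^sub>R u)"
        using v r r0 V.finite by (intro sum.mono_neutral_right) auto
      then have "z = (\<Sum>u\<in>?T. ?c z u *\<^sub>R u)" by (simp add: V.coord_sum)
      moreover have "(\<Sum>u\<in>?T. ?c z u *\<^sub>R u) \<in> span ?T"
        by (intro span_sum span_scale span_base)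
      moreover have "Suc (card ?T) < DIM('a)"
        using card.remove[OF V.finite v(1)] card.remove[OF finR r] V.card by simp
      ultimately show False using nonspan[of ?T] by auto
    qed
    obtain w where w: "insert w ?R \<in> \<V>" "?c w v < 0" using P.neighbour[OF V(1) v(1)] .
    obtain w' where w': "insert w' ?R \<in> \<W>" "?c w' v < 0" using Q.neighbour[OF V(2) v(1)] .
    have "w = w'"
      using balanced_neighbour_unique[OF V.vector_basis_axioms v(1) balP[OF V(1)] balP[OF w(1)] w(2) balQ[OF w'(1)] w'(2)] .
    then have wW: "insert w ?R \<in> \<W>" using w' by simp
    let ?W = "insert w ?R"
    interpret W: vector_basis ?W by (rule P.basis) fact
    have wR: "w \<notin> ?R" using w(2) V.coord_basis[of w v] by (auto split: if_splits)
    \<comment> \<open>Eliminating \<open>v\<close> in favour of \<open>w\<close>: in the basis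
      \<open>insert w ?R\<close>, the point \<open>p\<close> has coordinate
      \<open>?c p v / ?c w v\<close> at \<open>w\<close> and \<open>h p r\<close> at
      \<open>r\<close>. Near \<open>z\<close> the latter are positive, so the sign of
      \<open>?c p v\<close> decides between the two cones.\<close>
    define h where "h p r = ?c p r - ?c p v / ?c w v * ?c w r" for p r
    define G where "G = {p. \<forall>r\<in>?R. 0 < ?c p r} \<inter> (\<Inter>r\<in>?R. {p. 0 < h p r})"
    have "open G"
      unfolding G_def h_def using w(2)
      by (intro open_Int V.open_coord_pos open_INT finR ballI open_Collect_less continuous_intros V.continuous_coord) auto
    moreover have "z \<in> G" using rpos v(2) by (simp add: G_def h_def)
    moreover have "p \<in> C" if p: "p \<in> G" for p
    proof (cases "0 \<le> ?c p v")
      case True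
      have "0 \<le> ?c p u" if "u \<in> V" for u
        using p True that by (cases "u = v") (auto simp: G_def less_imp_le)
      then have "p \<in> simplicial_cone V" by (simp add: simplicial_cone_def)
      then show ?thesis using V by (auto simp: C_def)
    next
      case False
      let ?k = "?c p v / ?c w v"
      define f where "f u = (if u = w then ?k else h p u)" for u
      have "0 < ?k" using False w(2) by (simp add: divide_neg_neg)
      have wexp: "w = ?c w v *\<^sub>R v + (\<Sum>r\<in>?R. ?c w r *\<^sub>R r)" and pexp: "p = ?c p v *\<^sub>R v + (\<Sum>r\<in>?R. ?c p r *\<^sub>R r)"
        using V.coord_sum[of w] V.coord_sum[of p] v(1) V.finite by (auto simp: sum.remove)
      have "(\<Sum>u\<in>?W. f u *\<^sub>R u) = ?k *\<^sub>R w + (\<Sum>r\<in>?R. h p r *\<^sub>R r)"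
      proof -
        have "(\<Sum>u\<in>?R. f u *\<^sub>R u) = (\<Sum>r\<in>?R. h p r *\<^sub>R r)"
          using wR by (intro sum.cong) (auto simp: f_def)
        then show ?thesis using finR wR by (simp add: f_def)
      qed
      also have "(\<Sum>r\<in>?R. h p r *\<^sub>R r) = (\<Sum>r\<in>?R. ?c p r *\<^sub>R r) - ?k *\<^sub>R (\<Sum>r\<in>?R. ?c w r *\<^sub>R r)"
        by (simp add: h_def scaleR_diff_left sum_subtractf scaleR_sum_right)
      also have "(\<Sum>r\<in>?R. ?c p r *\<^sub>R r) = p - ?c p v *\<^sub>R v" using pexp by (metis add_diff_cancel_left')
      also have "(\<Sum>r\<in>?R. ?c w r *\<^sub>R r) = w - ?c w v *\<^sub>R v" using wexp by (metis add_diff_cancel_left')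
      also have "?k *\<^sub>R w + (p - ?c p v *\<^sub>R v - ?k *\<^sub>R (w - ?c w v *\<^sub>R v)) = p"
        using w(2) by (simp add: scaleR_diff_right)
      finally have "p = (\<Sum>u\<in>?W. f u *\<^sub>R u)" by simp
      moreover have "0 \<le> f u" if "u \<in> ?W" for u
        using that p \<open>0 < ?k\<close> by (auto simp: f_def G_def less_imp_le)
      ultimately have "p \<in> simplicial_cone ?W" using W.simplicial_coneI[of f] by simp
      then show ?thesis using w(1) wW by (auto simp: C_def)
    qed
    ultimately show ?thesis by blast
  qed
  then obtain G where G: "open G" "z \<in> G" "G \<subseteq> C" by blast
  have "open (\<gamma> -` G)" using cont[of UNIV] G(1) by (simp add: open_vimage continuous_on_eq_continuous_at)
  moreover have "t \<in> \<gamma> -` G" using G(2) by (simp add: z_def)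
  ultimately obtain e where e: "0 < e" "\<And>s. dist s t < e \<Longrightarrow> s \<in> \<gamma> -` G"
    by (auto simp: open_dist)
  define s where "s = t + min (e / 2) (1 - t)"
  have s: "t < s" "s \<le> 1" "dist s t < e" using e(1) t1 by (auto simp: s_def dist_real_def)
  then have "s \<in> ?S" using e(2) G(3) t1 by auto
  then show False using max s by force
qed

lemma simplicial_fan_facets_determine:
  assumes "simplicial_fan P \<V> a" "simplicial_fan Q \<W> b" "\<V> \<subseteq> \<W>"
  shows "P \<subseteq> Q"
  using assms simplicial_fan.P_eq_Union by blast

section \<open>The fan of a simplicial polytope\<close>

lemma affine_independent_imp_independent:
  fixes V :: "'a::euclidean_space set"
  assumes "\<not> affine_dependent V" "0 \<notin> affine hull V"
  shows "independent V"
proof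
  assume "dependent V"
  moreover have "0 \<notin> V" using assms(2) hull_inc by metis
  ultimately have "affine_dependent (insert 0 V)"
    using dependent_imp_affine_dependent[of 0 V] by simp
  then show False using affine_independent_insert assms by blast
qed

text \<open>In a minimal description by half-spaces each one cuts out a facet, and 0 in the interior
  makes the offsets positive, so that the normals can be scaled to offset 1.\<close>

lemma simplicial_fan_exists:
  fixes P :: "(real^'n) set"
  assumes P: "simplicial_polytope P" and 0: "0 \<in> interior P"
  obtains \<V> a where "simplicial_fan P \<V> a"
proof -
  have poly: "polytope P" and simp: "\<And>C. C facet_of P \<Longrightarrow> \<exists>n. n simplex C"
    using P by (auto simp: simplicial_polytope_def)
  have "polyhedron P" using poly by (rule polytope_imp_polyhedron)
  then obtain F where finF: "finite F" and seq: "P = affine hull P \<inter> \<Inter>F"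
    and half: "\<forall>h\<in>F. \<exists>a b. a \<noteq> 0 \<and> h = {x. a \<bullet> x \<le> b}"
    and min: "\<And>F'. F' \<subset> F \<Longrightarrow> P \<subset> affine hull P \<inter> \<Inter>F'"
    by (auto simp: polyhedron_Int_affine_minimal)
  obtain a b where ab: "\<And>h. h \<in> F \<Longrightarrow> a h \<noteq> 0 \<and> h = {x. a h \<bullet> x \<le> b h}"
    using half by metis
  have aff: "affine hull P = UNIV"
    using 0 by (intro affine_hull_nonempty_interior) auto
  have bpos: "0 < b h" if "h \<in> F" for h
  proof -
    have "0 \<in> rel_interior P" using 0 interior_subset_rel_interior by blast
    then show ?thesis
      using rel_interior_polyhedron_explicit[OF finF seq ab min] that by auto
  qed
  define N where "N h = (1 / b h) *\<^sub>R a h" for h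
  have N: "N h \<bullet> x \<le> 1 \<longleftrightarrow> a h \<bullet> x \<le> b h" "N h \<bullet> x = 1 \<longleftrightarrow> a h \<bullet> x = b h" if "h \<in> F" for h x
    using bpos[OF that] by (auto simp: N_def field_simps)
  have "x \<in> P \<longleftrightarrow> (\<forall>h\<in>F. N h \<bullet> x \<le> 1)" for x
  proof -
    have "x \<in> P \<longleftrightarrow> (\<forall>h\<in>F. x \<in> h)" using seq aff by auto
    also have "\<dots> \<longleftrightarrow> (\<forall>h\<in>F. N h \<bullet> x \<le> 1)"
    proof (rule ball_cong[OF refl])
      fix h assume h: "h \<in> F"
      have "x \<in> h \<longleftrightarrow> a h \<bullet> x \<le> b h" using ab[OF h] by (metis mem_Collect_eq)
      then show "x \<in> h \<longleftrightarrow> N h \<bullet> x \<le> 1" using N(1)[OF h] by simp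
    qed
    finally show ?thesis .
  qed
  then have P_eq: "P = {x. \<forall>h\<in>F. N h \<bullet> x \<le> 1}" by auto
  have "\<exists>V. vector_basis V \<and> P \<inter> {x. N h \<bullet> x = 1} = convex hull V \<and> (\<forall>v\<in>V. N h \<bullet> v = 1)" if h: "h \<in> F" for h
  proof -
    let ?C = "P \<inter> {x. a h \<bullet> x = b h}"
    have fac: "?C facet_of P"
      using facet_of_polyhedron_explicit[OF finF seq ab min] h by blast
    obtain n where n: "n simplex ?C" using simp[OF fac] by blast
    then obtain V where V: "\<not> affine_dependent V" "int (card V) = n + 1" "?C = convex hull V"
      by (auto simp: simplex_def)
    have "n = aff_dim ?C" using aff_dim_simplex[OF n] by simp
    also have "\<dots> = int CARD('n) - 1"
      using fac aff aff_dim_affine_hull[of P] by (simp add: facet_of_def)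
    finally have card: "card V = DIM(real^'n)" using V(2) by simp
    have one: "N h \<bullet> v = 1" if "v \<in> V" for v
      using that V(3) hull_inc[of v V convex] N(2)[OF h] by blast
    have "affine hull V \<subseteq> {x. N h \<bullet> x = 1}"
      using one by (intro hull_minimal affine_hyperplane) auto
    then have "0 \<notin> affine hull V" by auto
    then have "vector_basis V"
      using V(1) card by (intro vector_basis.intro affine_independent_imp_independent)
    moreover have "P \<inter> {x. N h \<bullet> x = 1} = convex hull V" using V(3) N(2)[OF h] by simp
    ultimately show ?thesis using one by blast
  qed
  then obtain V where V: "\<And>h. h \<in> F \<Longrightarrow> vector_basis (V h)"
    "\<And>h. h \<in> F \<Longrightarrow> P \<inter> {x. N h \<bullet> x = 1} = convex hull (V h)" "\<And>h v. h \<in> F \<Longrightarrow> v \<in> V h \<Longrightarrow> N h \<bullet> v = 1"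
    by metis
  \<comment> \<open>Normals come indexed by half-spaces, but a fan is indexed by vertex sets; since
    \<open>V h\<close> is a basis, the normal is the only vector with value 1 on all of it.\<close>
  define A where "A W = (SOME n. \<forall>v\<in>W. n \<bullet> v = 1)" for W :: "(real^'n) set"
  have A: "A (V h) = N h" if "h \<in> F" for h
  proof (rule vector_basis.inner_eq_onI[OF V(1)[OF that]])
    have "\<exists>n. \<forall>v\<in>V h. n \<bullet> v = 1" using V(3)[OF that] by blast
    then have "\<forall>v\<in>V h. A (V h) \<bullet> v = 1" unfolding A_def by (rule someI_ex)
    then show "A (V h) \<bullet> v = N h \<bullet> v" if "v \<in> V h" for v using that V(3)[OF \<open>h \<in> F\<close>] by simp
  qed
  have "simplicial_fan P (V ` F) A"
  proof (rule simplicial_fan.intro)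
    show "finite (V ` F)" using finF by simp
    show "P = {x. \<forall>W\<in>V ` F. A W \<bullet> x \<le> 1}" unfolding P_eq using A by auto
    show "bounded P" using poly polytope_imp_bounded by blast
    fix W assume "W \<in> V ` F"
    then obtain h where h: "h \<in> F" "W = V h" by blast
    show "vector_basis W" using V(1) h by simp
    show "P \<inter> {x. A W \<bullet> x = 1} = convex hull W" using V(2)[OF h(1)] h A by simp
    show "A W \<bullet> v = 1" if "v \<in> W" for v using V(3)[OF h(1), of v] that h A by simp
  qed
  then show ?thesis using that by blast
qed

section \<open>First-order perturbation of an isotropic body\<close>

text \<open>The matrix is the covariance matrix after a piece of volume \<open>e * \<kappa>\<close>
  with mean \<open>\<beta>\<close> and second moments \<open>q\<close> has been added to an
  isotropic body of volume \<open>V\<close>. The product of the means is of order e^2, so the left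
  side grows at the rate \<open>\<kappa> / V\<close> times (trace of \<open>q\<close> minus d), the
  right side at the rate \<open>2 * \<kappa> / V\<close>.\<close>

lemma first_order_det_le:
  fixes q :: "'n::finite \<Rightarrow> 'n \<Rightarrow> real \<Rightarrow> real" and \<beta> :: "'n \<Rightarrow> real \<Rightarrow> real"
  assumes pos: "0 < V" "0 < \<kappa>" "0 < e0"
    and q: "\<And>i j. (q i j has_real_derivative q' i j) (at 0)"
    and \<beta>: "\<And>i. (\<beta> i has_real_derivative \<beta>' i) (at 0)"
    and le: "\<And>e. 0 < e \<Longrightarrow> e < e0 \<Longrightarrow>
      det (\<chi> i j. (V * of_bool (i = j) + e * \<kappa> * q i j e) / (V + e * \<kappa>)
        - (e * \<kappa> * \<beta> i e) / (V + e * \<kappa>) * ((e * \<kappa> * \<beta> j e) / (V + e * \<kappa>))) \<le> ((V + e * \<kappa>) / V)\<^sup>2"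
  shows "(\<Sum>i\<in>UNIV. q i i 0) \<le> real CARD('n) + 2"
proof (rule ccontr)
  define M :: "real \<Rightarrow> real^'n^'n" where "M e = (\<chi> i j. (V * of_bool (i = j) + e * \<kappa> * q i j e) / (V + e * \<kappa>)
        - (e * \<kappa> * \<beta> i e) / (V + e * \<kappa>) * ((e * \<kappa> * \<beta> j e) / (V + e * \<kappa>)))" for e
  define M' :: "real^'n^'n" where "M' = (\<chi> i j. \<kappa> / V * (q i j 0 - of_bool (i = j)))"
  have dM: "((\<lambda>e. M e $ i $ j) has_real_derivative M' $ i $ j) (at 0)" for i j
    unfolding M_def M'_def vec_lambda_beta using pos
    by (auto intro!: derivative_eq_intros q \<beta> simp: field_simps power2_eq_square)
  have M0: "M 0 = mat 1"
    using pos by (auto simp: M_def vec_eq_iff mat_def)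
  have d1: "((\<lambda>e. det (M e)) has_real_derivative (\<Sum>i\<in>UNIV. M' $ i $ i)) (at 0)"
    by (rule DERIV_det_at_identity[OF dM M0])
  have d2: "((\<lambda>e. ((V + e * \<kappa>) / V)\<^sup>2) has_real_derivative 2 * \<kappa> / V) (at 0)"
    using pos by (auto intro!: derivative_eq_intros simp: field_simps power2_eq_square)
  have d: "((\<lambda>e. det (M e) - ((V + e * \<kappa>) / V)\<^sup>2) has_real_derivative (\<Sum>i\<in>UNIV. M' $ i $ i) - 2 * \<kappa> / V) (at 0)"
    by (rule DERIV_diff[OF d1 d2])
  have tr: "(\<Sum>i\<in>UNIV. M' $ i $ i) - 2 * \<kappa> / V = \<kappa> / V * ((\<Sum>i\<in>UNIV. q i i 0) - real CARD('n) - 2)"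
  proof -
    have "(\<Sum>i\<in>UNIV. M' $ i $ i) = \<kappa> / V * (\<Sum>i\<in>UNIV. q i i 0 - 1)"
      unfolding sum_distrib_left by (simp add: M'_def)
    then show ?thesis by (simp add: sum_subtractf algebra_simps)
  qed
  assume "\<not> ?thesis"
  then have "0 < (\<Sum>i\<in>UNIV. M' $ i $ i) - 2 * \<kappa> / V"
    unfolding tr using pos by simp
  from has_real_derivative_pos_inc_right[OF d this]
  obtain e1 where e1: "0 < e1" "\<And>h. 0 < h \<Longrightarrow> h < e1 \<Longrightarrow> det (M 0) - ((V + 0 * \<kappa>) / V)\<^sup>2 < det (M h) - ((V + h * \<kappa>) / V)\<^sup>2"
    by auto
  define h where "h = min e0 e1 / 2"
  have h: "0 < h" "h < e0" "h < e1" using e1 pos by (auto simp: h_def)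
  have "0 < det (M h) - ((V + h * \<kappa>) / V)\<^sup>2"
    using e1(2)[OF h(1,3)] M0 pos by simp
  then show False using le[OF h(1,2)] by (simp add: M_def)
qed

subsection \<open>Stationarity of an isotropic maximizer\<close>

definition isotropic_maximizer :: "(real^'n) set \<Rightarrow> bool" where
  "isotropic_maximizer P \<longleftrightarrow> isotropic P \<and> (\<forall>K :: (real^'n) set. convex_body K \<longrightarrow> affine_invariant K \<le> affine_invariant P)"

text \<open>The form in which both variations use maximality: in isotropic position the invariant of
  \<open>P\<close> depends on its volume alone.\<close>

lemma isotropic_maximizer_det_le:
  fixes P K :: "(real^'n) set"
  assumes P: "isotropic_maximizer P" and K: "convex_body K"
  shows "det (covariance_matrix K) \<le> (measure lborel K / measure lborel P)\<^sup>2"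
proof -
  have "affine_invariant K \<le> 1 / (measure lborel P)\<^sup>2"
    using P K affine_invariant_isotropic by (metis isotropic_maximizer_def)
  then show ?thesis
    using convex_body_measure_pos[OF K] by (simp add: affine_invariant_def field_simps)
qed

context simplicial_fan
begin

text \<open>The point \<open>p\<close> is beyond the facet \<open>V\<close> and no other, so each
  segment from \<open>P\<close> to \<open>p\<close> leaves \<open>P\<close> through that facet and
  continues inside the pyramid over it.\<close>

lemma convex_hull_insert_beyond:
  assumes V: "V \<in> \<V>" and p: "1 < a V \<bullet> p" "\<And>W. W \<in> \<V> \<Longrightarrow> W \<noteq> V \<Longrightarrow> a W \<bullet> p \<le> 1"
  shows "convex hull (insert p P) = P \<union> convex hull (insert p V)"
    and "negligible (P \<inter> convex hull (insert p V))"
proof -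
  have sub: "convex hull V \<subseteq> P" using facet[OF V] by blast
  obtain v where v: "v \<in> V" using vector_basis.card[OF basis[OF V]] by fastforce
  then have ne: "P \<noteq> {}" using vertex_in[OF V] by blast
  have "k \<in> P \<union> convex hull (insert p V)" if k: "k \<in> convex hull (insert p P)" for k
  proof (cases "k \<in> P")
    case False
    obtain u w b where uw: "0 \<le> u" "0 \<le> w" "u + w = 1" "b \<in> P" "k = u *\<^sub>R p + w *\<^sub>R b"
      using k ne hull_same[of convex P, OF convex_P] by (auto simp: convex_hull_insert)
    have bW: "a W \<bullet> b \<le> 1" if "W \<in> \<V>" for W using uw(4) that P_eq by auto
    have kW: "a W \<bullet> k \<le> 1" if "W \<in> \<V>" "W \<noteq> V" for W
    proof -
      have "a W \<bullet> k \<le> u * 1 + w * 1"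
        unfolding uw(5) inner_add_right inner_scaleR_right
        using p(2)[OF that] bW[OF that(1)] uw(1,2) by (intro add_mono mult_left_mono) auto
      then show ?thesis using uw(3) by simp
    qed
    then have kV: "1 < a V \<bullet> k" using False P_eq by force
    define \<beta> \<pi> where "\<beta> = a V \<bullet> b" and "\<pi> = a V \<bullet> p"
    have "\<beta> \<le> 1" "1 < \<pi>" using bW[OF V] p(1) by (auto simp: \<beta>_def \<pi>_def)
    \<comment> \<open>Chosen so that the point at parameter \<open>s\<close> on the segment from
      \<open>b\<close> to \<open>p\<close> lies on the hyperplane of the facet.\<close>
    define s where "s = (1 - \<beta>) / (\<pi> - \<beta>)"
    have s: "0 \<le> s" "s < 1" "s * (\<pi> - \<beta>) = 1 - \<beta>"
      using \<open>\<beta> \<le> 1\<close> \<open>1 < \<pi>\<close> by (auto simp: s_def field_simps)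
    define x where "x = b + s *\<^sub>R (p - b)"
    have w_eq: "w = 1 - u" using uw(3) by simp
    have k_eq: "k = b + u *\<^sub>R (p - b)" unfolding uw(5) w_eq by (simp add: algebra_simps)
    have "1 < \<beta> + u * (\<pi> - \<beta>)" using kV by (simp add: k_eq inner_add_right inner_diff_right \<beta>_def \<pi>_def)
    then have "s * (\<pi> - \<beta>) < u * (\<pi> - \<beta>)" using s(3) by simp
    then have su: "s < u" using \<open>\<beta> \<le> 1\<close> \<open>1 < \<pi>\<close> by simp
    have "a V \<bullet> x = 1" using s(3) by (simp add: x_def inner_add_right inner_diff_right \<beta>_def \<pi>_def)
    moreover have "a W \<bullet> x \<le> 1" if "W \<in> \<V>" "W \<noteq> V" for W
    proof -
      have "x = (1 - s) *\<^sub>R b + s *\<^sub>R p" by (simp add: x_def algebra_simps)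
      then have "a W \<bullet> x = (1 - s) * (a W \<bullet> b) + s * (a W \<bullet> p)" by (simp add: inner_add_right)
      also have "\<dots> \<le> (1 - s) * 1 + s * 1"
        using p(2)[OF that] bW[OF that(1)] s by (intro add_mono mult_left_mono) auto
      finally show ?thesis by simp
    qed
    ultimately have "x \<in> P \<inter> {x. a V \<bullet> x = 1}" unfolding P_eq by auto (metis order_refl)
    then have "x \<in> convex hull V" using facet[OF V] by blast
    then have x: "x \<in> convex hull (insert p V)" by (meson hull_mono subsetD subset_insertI)
    have p': "p \<in> convex hull (insert p V)" by (simp add: hull_inc)
    \<comment> \<open>The point \<open>k\<close> lies between \<open>x\<close> and \<open>p\<close>;
      \<open>\<mu>\<close> is its parameter on this shorter segment.\<close>
    define \<mu> where "\<mu> = (u - s) / (1 - s)"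
    have "u \<le> 1" using uw by simp
    have \<mu>: "0 \<le> \<mu>" "\<mu> \<le> 1" "\<mu> * (1 - s) = u - s" using su s \<open>u \<le> 1\<close> by (auto simp: \<mu>_def)
    have "(1 - \<mu>) *\<^sub>R x + \<mu> *\<^sub>R p = b + (s + \<mu> * (1 - s)) *\<^sub>R (p - b)"
      by (simp add: x_def algebra_simps)
    then have "k = (1 - \<mu>) *\<^sub>R x + \<mu> *\<^sub>R p" using \<mu>(3) by (simp add: k_eq)
    then show ?thesis
      using convexD[OF convex_convex_hull x p', of "1 - \<mu>" \<mu>] \<mu> by auto
  qed simp
  moreover have "P \<subseteq> convex hull (insert p P)" by (meson hull_subset insert_subset)
  moreover have "convex hull (insert p V) \<subseteq> convex hull (insert p P)"
    using vertex_in[OF V] by (intro hull_mono) auto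
  ultimately show "convex hull (insert p P) = P \<union> convex hull (insert p V)" by blast
  have "convex hull (insert p V) \<subseteq> {x. 1 \<le> a V \<bullet> x}"
    using p(1) normal[OF V] convex_halfspace_ge[of 1 "a V"] by (intro hull_minimal) auto
  moreover have "P \<subseteq> {x. a V \<bullet> x \<le> 1}" using V P_eq by auto
  ultimately have "P \<inter> convex hull (insert p V) \<subseteq> {x. a V \<bullet> x = 1}" by force
  moreover have "a V \<noteq> 0" using normal[OF V v] by auto
  ultimately show "negligible (P \<inter> convex hull (insert p V))"
    using negligible_hyperplane negligible_subset by blast
qed

end

lemma vector_basis_enum:
  fixes V :: "(real^'n) set"
  assumes "vector_basis V"
  obtains u :: "'n \<Rightarrow> real^'n" where "inj u" "range u = V"
  using finite_same_card_bij[of "UNIV :: 'n set" V] vector_basis.finite[OF assms] vector_basis.card[OF assms]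
  by (auto simp: bij_betw_def)

lemma det_simplex_map_0:
  fixes u :: "'n \<Rightarrow> real^'n"
  assumes "vector_basis (range u)"
  shows "det (matrix (simplex_map 0 u)) \<noteq> 0"
proof -
  have "range u \<subseteq> range (simplex_map 0 u)"
    using simplex_map_axis[of 0 u] by (metis diff_zero image_subsetI rangeI)
  then have "span (range u) \<subseteq> span (range (simplex_map 0 u))" by (rule span_mono)
  also have "\<dots> = range (simplex_map 0 u)"
    using linear_span_image[OF linear_simplex_map[of 0 u], of UNIV] by simp
  finally have "surj (simplex_map 0 u)"
    using vector_basis.span[OF assms] by blast
  then show ?thesis
    using det_nz_iff_inj[OF linear_simplex_map] linear_surjective_imp_injective[OF linear_simplex_map] by blast
qed

text \<open>Moving the apex from 0 to \<open>p\<close> composes with a rank-one update of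
  determinant \<open>1 - n \<bullet> p\<close>. Up to sign, this factor is the height of the apex
  over the base, measured by \<open>n\<close>.\<close>

lemma det_simplex_map:
  fixes u :: "'n \<Rightarrow> real^'n"
  assumes n: "\<And>i. n \<bullet> u i = 1"
  shows "det (matrix (simplex_map p u)) = (1 - n \<bullet> p) * det (matrix (simplex_map 0 u))"
proof -
  let ?g = "\<lambda>x. x + (n \<bullet> x) *\<^sub>R (- p)"
  have lin: "linear ?g"
    by (rule linear_rank_one_update)
  have "simplex_map p u = ?g \<circ> simplex_map 0 u"
    by (rule ext) (simp add: simplex_map_def inner_sum_right n scaleR_diff_right sum_subtractf scaleR_sum_left)
  then have "det (matrix (simplex_map p u)) = det (matrix ?g) * det (matrix (simplex_map 0 u))"
    by (simp only: matrix_compose[OF linear_simplex_map lin] det_mul)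
  then show ?thesis
    unfolding det_rank_one_update by (simp add: inner_commute)
qed

locale isotropic_maximizer_fan = simplicial_fan P \<V> a
  for P :: "(real^'n) set" and \<V> a +
  assumes maximizer: "isotropic_maximizer P"
begin

lemma isotropic: "isotropic P"
  using maximizer by (simp add: isotropic_maximizer_def)

text \<open>The apex is \<open>(1 + e) *\<^sub>R y\<close>. As all weights in \<open>y\<close> are
  positive and each other facet misses some vertex of \<open>V\<close>, for small \<open>e\<close>
  the apex is beyond this facet only. The normalized moments of the thin pyramid tend to those of a
  flat simplex with vertices \<open>V\<close> and \<open>y\<close>, to which the trace bound d + 2
  applies.\<close>

lemma stationary_interior:
  assumes V: "V \<in> \<V>" and c: "\<And>v. v \<in> V \<Longrightarrow> 0 < c v" "sum c V = 1"
  defines "y \<equiv> \<Sum>v\<in>V. c v *\<^sub>R v"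
  shows "(norm (y + \<Sum>V))\<^sup>2 + (norm y)\<^sup>2 + (\<Sum>v\<in>V. (norm v)\<^sup>2) \<le> (real CARD('n) + 1) * (real CARD('n) + 2)\<^sup>2"
proof -
  let ?d = "real CARD('n)"
  note P = isotropic_D[OF isotropic]
  interpret V: vector_basis V by (rule basis) fact
  obtain u :: "'n \<Rightarrow> real^'n" where u: "inj u" "range u = V"
    using vector_basis_enum[OF V.vector_basis_axioms] .
  have sum_u: "(\<Sum>i\<in>UNIV. f (u i)) = sum f V" for f :: "real^'n \<Rightarrow> 'b::comm_monoid_add"
    using sum.reindex[OF u(1), of f] u(2) by simp
  have ay: "a W \<bullet> y = (\<Sum>v\<in>V. c v * (a W \<bullet> v))" for W by (simp add: y_def inner_sum_right)
  have ayV: "a V \<bullet> y = 1" using normal[OF V] c(2) by (simp add: ay)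
  have ayW: "a W \<bullet> y < 1" if W: "W \<in> \<V>" "W \<noteq> V" for W
  proof -
    obtain v where v: "v \<in> V" "a W \<bullet> v \<noteq> 1"
      using vertex_in_other_facet[OF V W(1)] facet_subset_imp_eq[OF V W(1)] W(2) by blast
    have "(\<Sum>v\<in>V. c v * (a W \<bullet> v)) < (\<Sum>v\<in>V. c v)"
    proof (rule sum_strict_mono_ex1[OF V.finite])
      show "\<forall>v\<in>V. c v * (a W \<bullet> v) \<le> c v"
        using inner_vertex_le[OF W(1) V] c(1) by (auto simp: mult_left_le less_imp_le)
      show "\<exists>v\<in>V. c v * (a W \<bullet> v) < c v"
        using v inner_vertex_le[OF W(1) V v(1)] c(1)[OF v(1)] by (intro bexI[of _ v]) auto
    qed
    then show ?thesis by (simp add: ay c(2))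
  qed
  define p where "p e = (1 + e) *\<^sub>R y" for e :: real
  have "\<forall>\<^sub>F e in at_right (0::real). \<forall>W\<in>\<V> - {V}. a W \<bullet> p e < 1"
  proof (intro eventually_ball_finite ballI)
    fix W assume "W \<in> \<V> - {V}"
    then have "a W \<bullet> y < 1" using ayW by blast
    moreover have "((\<lambda>e. (1 + e) * (a W \<bullet> y)) \<longlongrightarrow> (1 + 0) * (a W \<bullet> y)) (at_right 0)"
      by (intro tendsto_intros)
    ultimately have "\<forall>\<^sub>F e in at_right 0. (1 + e) * (a W \<bullet> y) < 1"
      by (intro order_tendstoD) auto
    then show "\<forall>\<^sub>F e in at_right (0::real). a W \<bullet> p e < 1" by (simp add: p_def)
  qed (use finite_facets in simp)
  then obtain e0 :: real where e0: "0 < e0" "\<And>e W. 0 < e \<Longrightarrow> e < e0 \<Longrightarrow> W \<in> \<V> \<Longrightarrow> W \<noteq> V \<Longrightarrow> a W \<bullet> p e < 1"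
    unfolding eventually_at_right_field by blast
  \<comment> \<open>The volume of the cone over the facet, cut off at the facet. The apex is
    \<open>e\<close> times as far from the facet hyperplane as the origin is, so the pyramid has
    volume \<open>e * \<kappa>\<close>.\<close>
  define \<kappa> where "\<kappa> = \<bar>det (matrix (simplex_map 0 u))\<bar> * measure lborel (std_simplex :: (real^'n) set)"
  have nz: "det (matrix (simplex_map 0 u)) \<noteq> 0"
    using det_simplex_map_0 V.vector_basis_axioms u(2) by blast
  have "0 < measure lborel (std_simplex :: (real^'n) set)" by (simp add: content_std_simplex)
  then have \<kappa>: "0 < \<kappa>" using nz by (simp add: \<kappa>_def)
  define S where "S e = p e + \<Sum>V" for e
  \<comment> \<open>Second moments of the pyramid divided by its volume; \<open>\<beta>\<close>
    below is its centroid.\<close>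
  define q where "q i j e = (S e $ i * S e $ j + p e $ i * p e $ j + (\<Sum>v\<in>V. v $ i * v $ j)) / ((?d + 1) * (?d + 2))" for i j e
  define \<beta> where "\<beta> i e = S e $ i / (?d + 1)" for i e
  have dq: "(q i j has_real_derivative
      (y $ i * S 0 $ j + S 0 $ i * y $ j + 2 * y $ i * y $ j) / ((?d + 1) * (?d + 2))) (at 0)" for i j
    unfolding q_def
    by (rule DERIV_cdivide) (auto simp: S_def p_def algebra_simps intro!: derivative_eq_intros)
  have d\<beta>: "(\<beta> i has_real_derivative y $ i / (?d + 1)) (at 0)" for i
    unfolding \<beta>_def S_def p_def by (auto intro!: derivative_eq_intros)
  let ?V = "measure lborel P"
  have "(\<Sum>i\<in>UNIV. q i i 0) \<le> ?d + 2"
  proof (rule first_order_det_le[where q = q and \<beta> = \<beta>, OF P(4) \<kappa> e0(1) dq d\<beta>])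
    fix e :: real assume e: "0 < e" "e < e0"
    let ?D = "convex hull (insert (p e) V)" and ?K = "convex hull (insert (p e) P)"
    have pV: "a V \<bullet> p e = 1 + e" by (simp add: p_def ayV)
    have "1 < a V \<bullet> p e" using pV e by simp
    moreover have "a W \<bullet> p e \<le> 1" if "W \<in> \<V>" "W \<noteq> V" for W
      using e0(2)[OF e that] by simp
    ultimately have K_eq: "?K = P \<union> ?D" and neg: "negligible (P \<inter> ?D)"
      using convex_hull_insert_beyond[OF V, of "p e"] by blast+
    have det: "det (matrix (simplex_map (p e) u)) = - e * det (matrix (simplex_map 0 u))"
      using det_simplex_map[of "a V" u "p e"] normal[OF V] u(2) pV by auto
    then have nz': "det (matrix (simplex_map (p e) u)) \<noteq> 0" using nz e by simp
    note mom = simplex_moments[OF nz', unfolded u(2) sum_u[of "\<lambda>x. x"]]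
    have cD: "compact ?D" using V.finite by (intro finite_imp_compact_convex_hull) simp
    have cK: "compact ?K" unfolding K_eq using compact_P cD by (rule compact_Un)
    have int: "(LINT x:?K|lborel. g x) = (LINT x:P|lborel. g x) + (LINT x:?D|lborel. g x)"
      if "continuous_on UNIV g" for g :: "real^'n \<Rightarrow> real"
      unfolding K_eq using compact_P cD neg that by (rule set_integral_Un_negligible)
    have volD: "measure lborel ?D = e * \<kappa>"
      using mom(1) e by (simp add: det \<kappa>_def abs_mult)
    have volK: "measure lborel ?K = ?V + e * \<kappa>"
      using int[of "\<lambda>_. 1"] volD by (simp add: set_integral_const[OF cK] set_integral_const[OF compact_P] set_integral_const[OF cD])
    have pos: "0 < measure lborel ?K" using volK P(4) e \<kappa> by (simp add: add_pos_pos)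
    have K: "convex_body ?K" by (rule convex_body_if_measure_pos[OF cK convex_convex_hull pos])
    have nth: "x $ i = axis i 1 \<bullet> x" for x :: "real^'n" and i by (simp add: inner_axis')
    have m1: "(LINT x:?K|lborel. x $ i) = e * \<kappa> * \<beta> i e" for i
      using int[of "\<lambda>x. x $ i"] P(5)[of "axis i 1"] mom(2)[of "axis i 1"]
      by (simp add: nth[symmetric] volD \<beta>_def S_def continuous_intros)
    have m2: "(LINT x:?K|lborel. x $ i * x $ j) = ?V * of_bool (i = j) + e * \<kappa> * q i j e" for i j
      using int[of "\<lambda>x. x $ i * x $ j"] P(6)[of "axis i 1" "axis j 1"] mom(3)[of "axis i 1" "axis j 1"]
      by (simp add: nth[symmetric] volD q_def S_def continuous_intros inner_axis_axis sum_u[of "\<lambda>v. v $ i * v $ j"])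
    have "covariance_matrix ?K = (\<chi> i j. (?V * of_bool (i = j) + e * \<kappa> * q i j e) / (?V + e * \<kappa>)
        - (e * \<kappa> * \<beta> i e) / (?V + e * \<kappa>) * ((e * \<kappa> * \<beta> j e) / (?V + e * \<kappa>)))"
      by (simp only: vec_eq_iff vec_lambda_beta covariance_matrix_nth'[OF cK pos] m1 m2 volK) simp
    then show "det (\<chi> i j. (?V * of_bool (i = j) + e * \<kappa> * q i j e) / (?V + e * \<kappa>)
        - (e * \<kappa> * \<beta> i e) / (?V + e * \<kappa>) * ((e * \<kappa> * \<beta> j e) / (?V + e * \<kappa>))) \<le> ((?V + e * \<kappa>) / ?V)\<^sup>2"
      using isotropic_maximizer_det_le[OF maximizer K] by (simp add: volK)
  qed
  moreover have "(\<Sum>i\<in>UNIV. q i i 0) = ((norm (y + \<Sum>V))\<^sup>2 + (norm y)\<^sup>2 + (\<Sum>v\<in>V. (norm v)\<^sup>2)) / ((?d + 1) * (?d + 2))"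
    unfolding power2_norm_eq_inner inner_vec_def q_def S_def p_def
    by (simp add: sum_divide_distrib[symmetric] sum.distrib) (rule sum.swap)
  moreover have "0 < (?d + 1) * (?d + 2)"
    by (intro mult_pos_pos add_nonneg_pos) auto
  ultimately show ?thesis
    by (simp only: pos_divide_le_eq power2_eq_square mult_ac)
qed

text \<open>An apex over a vertex would be beyond several facets at once, so the vertex is
  approached from the relative interior, on the segment towards the centroid of the facet.\<close>

lemma stationary_vertex:
  assumes V: "V \<in> \<V>" and v: "v \<in> V"
  shows "(norm (v + \<Sum>V))\<^sup>2 + (norm v)\<^sup>2 + (\<Sum>v\<in>V. (norm v)\<^sup>2) \<le> (real CARD('n) + 1) * (real CARD('n) + 2)\<^sup>2"
proof -
  let ?d = "real CARD('n)"
  interpret V: vector_basis V by (rule basis) fact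
  have cardV: "real (card V) = ?d" using V.card by simp
  let ?f = "\<lambda>y. (norm (y + \<Sum>V))\<^sup>2 + (norm y)\<^sup>2 + (\<Sum>v\<in>V. (norm v)\<^sup>2)"
  define \<gamma> where "\<gamma> t = (1 - t) *\<^sub>R v + (t / ?d) *\<^sub>R \<Sum>V" for t :: real
  have "?f (\<gamma> t) \<le> (?d + 1) * (?d + 2)\<^sup>2" if t: "0 < t" "t < 1" for t
  proof -
    define c where "c w = (1 - t) * of_bool (w = v) + t / ?d" for w
    have "(\<Sum>w\<in>V. c w *\<^sub>R w) = \<gamma> t"
    proof -
      have "(\<Sum>w\<in>V. c w *\<^sub>R w) = (\<Sum>w\<in>V. if w = v then (1 - t) *\<^sub>R v else 0) + (\<Sum>w\<in>V. (t / ?d) *\<^sub>R w)"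
        unfolding sum.distrib[symmetric] by (intro sum.cong) (auto simp: c_def scaleR_add_left)
      then show ?thesis using v V.finite by (simp add: \<gamma>_def scaleR_sum_right)
    qed
    moreover have "sum c V = 1"
    proof -
      have "sum c V = (\<Sum>w\<in>V. if w = v then 1 - t else 0) + (\<Sum>w\<in>V. t / ?d)"
        unfolding sum.distrib[symmetric] by (intro sum.cong) (auto simp: c_def)
      then show ?thesis using v V.finite cardV by simp
    qed
    moreover have "0 < c w" for w using t by (simp add: c_def add_nonneg_pos)
    ultimately show ?thesis using stationary_interior[OF V, of c] by simp
  qed
  then have "\<forall>\<^sub>F t in at_right 0. ?f (\<gamma> t) \<le> (?d + 1) * (?d + 2)\<^sup>2"
    unfolding eventually_at_right_field by (intro exI[of _ 1]) auto
  moreover have "((\<lambda>t. ?f (\<gamma> t)) \<longlongrightarrow> ?f (\<gamma> 0)) (at_right 0)"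
    unfolding \<gamma>_def by (intro tendsto_intros) auto
  ultimately have "?f (\<gamma> 0) \<le> (?d + 1) * (?d + 2)\<^sup>2"
    by (intro tendsto_upperbound) auto
  then show ?thesis by (simp add: \<gamma>_def)
qed

text \<open>
  Each facet contributes a nonpositive term to \<open>\<integral>\<^sub>P |x|\<^sup>2 - d vol P\<close>, which vanishes as \<open>P\<close> is isotropic; hence
  all the inequalities of the previous lemma are equalities.
\<close>

lemma facets_balanced:
  assumes V: "V \<in> \<V>"
  shows "balanced ((real CARD('n) + 1) * (real CARD('n) + 2)) V"
proof -
  let ?d = "real CARD('n)"
  note P = isotropic_D[OF isotropic]
  define Q where "Q V = (\<Sum>v\<in>V. (norm v)\<^sup>2)" for V :: "(real^'n) set"
  \<comment> \<open>Up to the positive factor \<open>m V / ((?d + 1) * (?d + 2))\<close>, the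
    integral of |x|^2 - d over the simplex spanned by 0 and the facet.\<close>
  define B where "B V = (norm (\<Sum>V))\<^sup>2 + Q V - ?d * (?d + 1) * (?d + 2)" for V :: "(real^'n) set"
  define m where "m V = measure lborel (convex hull (insert 0 V))" for V :: "(real^'n) set"
  have f_eq: "(norm (v + \<Sum>V))\<^sup>2 + (norm v)\<^sup>2 + Q V
      = (norm (\<Sum>V))\<^sup>2 + Q V + 2 * (v \<bullet> (v + \<Sum>V))" for v V
    by (simp add: power2_norm_eq_inner inner_add_left inner_add_right inner_commute)
  \<comment> \<open>The slacks in the vertex inequalities of a single facet add up to a negative
    multiple of \<open>B\<close>. So \<open>B \<le> 0\<close> facet by facet, and
    \<open>B = 0\<close> makes every slack vanish.\<close>
  have sum_f: "(\<Sum>v\<in>V. (?d + 1) * (?d + 2)\<^sup>2 - ((norm (v + \<Sum>V))\<^sup>2 + (norm v)\<^sup>2 + Q V)) = - ((?d + 2) * B V)"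
    if "V \<in> \<V>" for V
  proof -
    interpret V: vector_basis V by (rule basis) fact
    have c: "real (card V) = ?d" using V.card by simp
    have s: "(\<Sum>v\<in>V. v \<bullet> (v + \<Sum>V)) = Q V + (norm (\<Sum>V))\<^sup>2"
      by (simp add: inner_add_right sum.distrib Q_def power2_norm_eq_inner inner_sum_left)
    have t: "(\<Sum>v\<in>V. C - (E + 2 * (v \<bullet> (v + \<Sum>V)))) = card V * (C - E) - 2 * (\<Sum>v\<in>V. v \<bullet> (v + \<Sum>V))"
      for C E :: real
      by (simp add: sum_subtractf sum.distrib sum_distrib_left right_diff_distrib)
    show ?thesis
      unfolding f_eq t s c B_def by (simp add: power2_eq_square algebra_simps)
  qed
  have nn: "0 \<le> (?d + 1) * (?d + 2)\<^sup>2 - ((norm (v + \<Sum>V))\<^sup>2 + (norm v)\<^sup>2 + Q V)" if "V \<in> \<V>" "v \<in> V" for v V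
    using stationary_vertex[OF that] by (simp add: Q_def)
  have B_le: "B V \<le> 0" if "V \<in> \<V>" for V
  proof -
    have "0 \<le> - ((?d + 2) * B V)"
      unfolding sum_f[OF that, symmetric] using nn[OF that] by (intro sum_nonneg)
    then show ?thesis by (simp add: mult_le_0_iff)
  qed
  have simplex: "0 < m V" "(\<Sum>i\<in>UNIV. LINT x:convex hull (insert 0 V)|lborel. x $ i * x $ i)
      = m V * ((norm (\<Sum>V))\<^sup>2 + Q V) / ((?d + 1) * (?d + 2))" if V: "V \<in> \<V>" for V
  proof -
    interpret V: vector_basis V by (rule basis) fact
    obtain u :: "'n \<Rightarrow> real^'n" where u: "inj u" "range u = V"
      using vector_basis_enum[OF V.vector_basis_axioms] .
    have sum_u: "(\<Sum>i\<in>UNIV. f (u i)) = sum f V" for f :: "real^'n \<Rightarrow> 'b::comm_monoid_add"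
      using sum.reindex[OF u(1), of f] u(2) by simp
    have nz: "det (matrix (simplex_map 0 u)) \<noteq> 0"
      using det_simplex_map_0 V.vector_basis_axioms u(2) by blast
    note mom = simplex_moments[OF nz, unfolded u(2) sum_u[of "\<lambda>x. x"]]
    show "0 < m V" using mom(1) nz by (simp add: m_def content_std_simplex)
    have nth: "x $ i = axis i 1 \<bullet> x" for x :: "real^'n" and i by (simp add: inner_axis')
    have "(LINT x:convex hull (insert 0 V)|lborel. x $ i * x $ i)
        = m V / ((?d + 1) * (?d + 2)) * ((\<Sum>V) $ i * (\<Sum>V) $ i + (\<Sum>v\<in>V. v $ i * v $ i))" for i
      using mom(3)[of "axis i 1" "axis i 1"] by (simp add: nth[symmetric] m_def sum_u[of "\<lambda>v. v $ i * v $ i"])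
    then have "(\<Sum>i\<in>UNIV. LINT x:convex hull (insert 0 V)|lborel. x $ i * x $ i)
        = m V / ((?d + 1) * (?d + 2)) * (\<Sum>i\<in>UNIV. (\<Sum>V) $ i * (\<Sum>V) $ i + (\<Sum>v\<in>V. v $ i * v $ i))"
      by (simp only: sum_distrib_left)
    also have "(\<Sum>i\<in>UNIV. (\<Sum>V) $ i * (\<Sum>V) $ i + (\<Sum>v\<in>V. v $ i * v $ i)) = (norm (\<Sum>V))\<^sup>2 + Q V"
      unfolding Q_def power2_norm_eq_inner inner_vec_def by (simp add: sum.distrib) (rule sum.swap)
    finally show "(\<Sum>i\<in>UNIV. LINT x:convex hull (insert 0 V)|lborel. x $ i * x $ i)
      = m V * ((norm (\<Sum>V))\<^sup>2 + Q V) / ((?d + 1) * (?d + 2))" by simp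
  qed
  have comp: "compact (convex hull (insert 0 V))" if "V \<in> \<V>" for V
    using vector_basis.finite[OF basis[OF that]] by (intro finite_imp_compact_convex_hull) simp
  have dec: "(LINT x:P|lborel. g x) = (\<Sum>V\<in>\<V>. LINT x:convex hull (insert 0 V)|lborel. g x)"
    if "continuous_on UNIV g" for g :: "real^'n \<Rightarrow> real"
    unfolding P_eq_Union
    by (intro set_integral_UN_negligible finite_facets comp negligible_simplices_Int that)
  have vol: "measure lborel P = (\<Sum>V\<in>\<V>. m V)"
    using dec[of "\<lambda>_. 1"] by (simp add: set_integral_const compact_P comp m_def)
  have "?d * measure lborel P = (\<Sum>i\<in>UNIV. LINT x:P|lborel. x $ i * x $ i)"
    using P(6)[of "axis _ 1" "axis _ 1"] by (simp add: inner_axis' )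
  also have "\<dots> = (\<Sum>i\<in>UNIV. \<Sum>V\<in>\<V>. LINT x:convex hull (insert 0 V)|lborel. x $ i * x $ i)"
    by (intro sum.cong refl dec continuous_intros)
  also have "\<dots> = (\<Sum>V\<in>\<V>. \<Sum>i\<in>UNIV. LINT x:convex hull (insert 0 V)|lborel. x $ i * x $ i)"
    by (rule sum.swap)
  also have "\<dots> = (\<Sum>V\<in>\<V>. m V * ((norm (\<Sum>V))\<^sup>2 + Q V) / ((?d + 1) * (?d + 2)))"
    using simplex by simp
  finally have "0 = (\<Sum>V\<in>\<V>. m V * ((norm (\<Sum>V))\<^sup>2 + Q V) / ((?d + 1) * (?d + 2)) - ?d * m V)"
    unfolding vol by (simp add: sum_subtractf sum_distrib_left)
  also have "\<dots> = (\<Sum>V\<in>\<V>. m V * B V / ((?d + 1) * (?d + 2)))"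
  proof (rule sum.cong[OF refl])
    fix V
    have "x * X / D - r * x = x * (X - r * D) / D" if "0 < D" for x X D r :: real
      using that by (simp add: field_simps)
    moreover have "0 < (?d + 1) * (?d + 2)"
      by (intro mult_pos_pos add_nonneg_pos) auto
    ultimately show "m V * ((norm (\<Sum>V))\<^sup>2 + Q V) / ((?d + 1) * (?d + 2)) - ?d * m V
        = m V * B V / ((?d + 1) * (?d + 2))"
      by (simp only: B_def mult.assoc)
  qed
  finally have "(\<Sum>V\<in>\<V>. - (m V * B V / ((?d + 1) * (?d + 2)))) = 0"
    by (simp add: sum_negf)
  moreover have "0 \<le> - (m V * B V / ((?d + 1) * (?d + 2)))" if "V \<in> \<V>" for V
    using B_le[OF that] simplex(1)[OF that] by (simp add: mult_nonneg_nonpos divide_nonpos_pos)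
  ultimately have "- (m V * B V / ((?d + 1) * (?d + 2))) = 0"
    using V finite_facets sum_nonneg_eq_0_iff[of \<V> "\<lambda>V. - (m V * B V / ((?d + 1) * (?d + 2)))"] by blast
  then have B0: "B V = 0" using simplex(1)[OF V] by (auto simp: add_eq_0_iff)
  have finV: "finite V" using vector_basis.finite[OF basis[OF V]] .
  show ?thesis
    unfolding balanced_def
  proof
    fix v assume v: "v \<in> V"
    have "(\<Sum>v\<in>V. (?d + 1) * (?d + 2)\<^sup>2 - ((norm (v + \<Sum>V))\<^sup>2 + (norm v)\<^sup>2 + Q V)) = 0"
      using sum_f[OF V] B0 by simp
    then have "(?d + 1) * (?d + 2)\<^sup>2 - ((norm (v + \<Sum>V))\<^sup>2 + (norm v)\<^sup>2 + Q V) = 0"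
      by (subst (asm) sum_nonneg_eq_0_iff[OF finV]) (use nn[OF V] v in auto)
    \<comment> \<open>Inserting \<open>B V = 0\<close>, that is, |S|^2 + Q = d (d + 1)(d + 2), into
      an inequality without slack leaves (d + 1)(d + 2) times (d + 2) - d = 2.\<close>
    then have "2 * (v \<bullet> (v + \<Sum>V)) = (?d + 1) * (?d + 2)\<^sup>2 - ?d * (?d + 1) * (?d + 2)"
      using f_eq[of v V] B0 by (simp add: B_def)
    then show "v \<bullet> (v + \<Sum>V) = (?d + 1) * (?d + 2)"
      by (simp add: power2_eq_square algebra_simps)
  qed
qed

end

subsection \<open>Shears of an isotropic maximizer\<close>

lemma set_integral_shear_image:
  fixes K :: "'a::euclidean_space set" and g \<alpha> :: "'a \<Rightarrow> real"
  assumes K: "compact K" "compact ((\<lambda>x. x + \<alpha> x *\<^sub>R n) ` K)"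
    and \<alpha>: "\<alpha> \<in> borel_measurable borel" "\<And>x s. \<alpha> (x + s *\<^sub>R n) = \<alpha> x"
    and g: "g \<in> borel_measurable borel"
  shows "(LINT x:(\<lambda>x. x + \<alpha> x *\<^sub>R n) ` K|lborel. g x) = (LINT x:K|lborel. g (x + \<alpha> x *\<^sub>R n))"
proof -
  let ?T = "\<lambda>x. x + \<alpha> x *\<^sub>R n"
  have [measurable]: "?T ` K \<in> sets borel" using K(2) by (auto dest: compact_imp_closed)
  have inj: "?T x \<in> ?T ` K \<longleftrightarrow> x \<in> K" for x
  proof
    assume "?T x \<in> ?T ` K"
    then obtain y where y: "y \<in> K" "?T x = ?T y" by blast
    then have "x = y + (\<alpha> y - \<alpha> x) *\<^sub>R n" by (simp add: algebra_simps)
    then have "\<alpha> x = \<alpha> y" using \<alpha>(2) by metis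
    then show "x \<in> K" using y by simp
  qed simp
  have "(LINT x:?T ` K|lborel. g x) = (\<integral>x. indicator (?T ` K) x * g x \<partial>lborel)"
    by (simp add: set_lebesgue_integral_def)
  also have "\<dots> = (\<integral>x. indicator (?T ` K) (?T x) * g (?T x) \<partial>lborel)"
    by (rule integral_lborel_shear[symmetric]) (use g \<alpha> in auto)
  also have "(\<lambda>x. indicator (?T ` K) (?T x) :: real) = indicator K"
    using inj by (auto simp: indicator_def fun_eq_iff)
  finally show ?thesis by (simp add: set_lebesgue_integral_def)
qed

lemma set_integrable_bounded_measurable:
  fixes f :: "'a::euclidean_space \<Rightarrow> real"
  assumes K: "compact K" and f: "f \<in> borel_measurable borel" and B: "\<And>x. x \<in> K \<Longrightarrow> \<bar>f x\<bar> \<le> B"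
  shows "set_integrable lborel K f"
proof -
  have [measurable]: "K \<in> sets borel" using K by (auto dest: compact_imp_closed)
  have int: "integrable lborel (\<lambda>x. indicator K x *\<^sub>R B)"
    by (intro borel_integrable_compact K continuous_intros)
  have bound: "\<bar>f x\<bar> \<le> \<bar>B\<bar>" if "x \<in> K" for x using B[OF that] by linarith
  show ?thesis
    unfolding set_integrable_def
    by (rule Bochner_Integration.integrable_bound[OF int]) (use f bound in \<open>auto simp: indicator_def\<close>)
qed

lemma compact_continuous_bounded:
  fixes f :: "'a::topological_space \<Rightarrow> real"
  assumes "compact K" "continuous_on K f"
  obtains B where "\<And>x. x \<in> K \<Longrightarrow> \<bar>f x\<bar> \<le> B"
proof -
  have "bounded (f ` K)" using assms by (intro compact_imp_bounded compact_continuous_image)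
  then show ?thesis using that by (auto simp: bounded_iff)
qed

text \<open>
  For \<open>\<alpha>\<close> of mean zero and uncorrelated with the directions orthogonal to \<open>n\<close>, the shear by \<open>t \<alpha>\<close> changes
  the covariance matrix \<open>I\<close> into \<open>I + (2 c\<^sub>0 t + s t\<^sup>2) n n\<^sup>T\<close>, where \<open>s\<close> is the variance of \<open>\<alpha>\<close>; maximality
  for both signs of \<open>t\<close> forces \<open>s = 0\<close>.
\<close>

lemma shear_trivial:
  fixes P :: "(real^'n) set"
  assumes P: "isotropic_maximizer P" and n: "norm n = 1"
    and \<alpha>: "\<alpha> \<in> borel_measurable borel" "\<And>x s. \<alpha> (x + s *\<^sub>R n) = \<alpha> x" "\<And>x. x \<in> P \<Longrightarrow> \<bar>\<alpha> x\<bar> \<le> B"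
    and mean: "(LINT x:P|lborel. \<alpha> x) = 0"
    and uncorrelated: "\<And>b. b \<bullet> n = 0 \<Longrightarrow> (LINT x:P|lborel. \<alpha> x * (b \<bullet> x)) = 0"
    and t: "0 < t"
    and K: "\<And>r. \<bar>r\<bar> = t \<Longrightarrow> compact ((\<lambda>x. x + (r * \<alpha> x) *\<^sub>R n) ` P) \<and> convex ((\<lambda>x. x + (r * \<alpha> x) *\<^sub>R n) ` P)"
  shows "AE x in lborel. x \<in> P \<longrightarrow> \<alpha> x = 0"
proof -
  have iso: "isotropic P" using P by (simp add: isotropic_maximizer_def)
  note I = isotropic_D[OF iso]
  let ?V = "measure lborel P"
  have [measurable]: "P \<in> sets borel" using I(2) by (auto dest: compact_imp_closed)
  have nn: "n \<bullet> n = 1" using n by (simp add: norm_eq_1)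
  define c0 where "c0 = (LINT x:P|lborel. \<alpha> x * (n \<bullet> x))"
  define s where "s = (LINT x:P|lborel. \<alpha> x * \<alpha> x)"
  have B0: "0 \<le> B" if "x \<in> P" for x using \<alpha>(3)[OF that] by linarith
  have intf: "set_integrable lborel P (\<lambda>x. \<alpha> x * f x)" if f: "continuous_on UNIV f" for f :: "real^'n \<Rightarrow> real"
  proof -
    obtain C where C: "\<And>x. x \<in> P \<Longrightarrow> \<bar>f x\<bar> \<le> C"
      using compact_continuous_bounded[OF I(2)] continuous_on_subset[OF f] by (metis subset_UNIV)
    show ?thesis
    proof (rule set_integrable_bounded_measurable[OF I(2)])
      show "(\<lambda>x. \<alpha> x * f x) \<in> borel_measurable borel"
        using \<alpha>(1) borel_measurable_continuous_onI[OF f] by measurable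
      show "\<bar>\<alpha> x * f x\<bar> \<le> B * C" if "x \<in> P" for x
        unfolding abs_mult using \<alpha>(3)[OF that] C[OF that] B0[OF that] by (intro mult_mono) auto
    qed
  qed
  have int\<alpha>: "set_integrable lborel P \<alpha>" using intf[of "\<lambda>_. 1"] by simp
  have int2: "set_integrable lborel P (\<lambda>x. \<alpha> x * \<alpha> x)"
  proof (rule set_integrable_bounded_measurable[OF I(2)])
    show "\<bar>\<alpha> x * \<alpha> x\<bar> \<le> B * B" if "x \<in> P" for x
      unfolding abs_mult using \<alpha>(3)[OF that] B0[OF that] by (intro mult_mono) auto
  qed (use \<alpha>(1) in measurable)
  \<comment> \<open>Split off from the coordinate vector its component along \<open>n\<close>; with
    the orthogonal rest \<open>\<alpha>\<close> is uncorrelated, so the correlation vector of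
    \<open>\<alpha>\<close> and x is a multiple of \<open>n\<close>.\<close>
  have cross: "(LINT x:P|lborel. \<alpha> x * x $ i) = n $ i * c0" for i
  proof -
    define b where "b = axis i 1 - (n $ i) *\<^sub>R n"
    have "b \<bullet> n = 0" by (simp add: b_def inner_diff_left inner_axis' nn)
    have "\<alpha> x * x $ i = \<alpha> x * (b \<bullet> x) + n $ i * (\<alpha> x * (n \<bullet> x))" for x
      by (simp add: b_def inner_diff_left inner_axis' algebra_simps)
    then have "(LINT x:P|lborel. \<alpha> x * x $ i) = (LINT x:P|lborel. \<alpha> x * (b \<bullet> x) + n $ i * (\<alpha> x * (n \<bullet> x)))"
      by (rule arg_cong[OF ext])
    also have "\<dots> = (LINT x:P|lborel. \<alpha> x * (b \<bullet> x)) + n $ i * c0"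
      by (subst set_integral_add(2)) (auto intro!: intf continuous_intros simp: c0_def)
    finally show ?thesis using uncorrelated[OF \<open>b \<bullet> n = 0\<close>] by simp
  qed
  have le: "2 * r * c0 + r\<^sup>2 * s \<le> 0" if r: "\<bar>r\<bar> = t" for r
  proof -
    let ?K = "(\<lambda>x. x + (r * \<alpha> x) *\<^sub>R n) ` P"
    have cK: "compact ?K" "convex ?K" using K[OF r] by auto
    have int: "(LINT x:?K|lborel. g x) = (LINT x:P|lborel. g (x + (r * \<alpha> x) *\<^sub>R n))"
      if "continuous_on UNIV g" for g :: "real^'n \<Rightarrow> real"
      by (rule set_integral_shear_image[OF I(2) cK(1) _ _ borel_measurable_continuous_onI[OF that]])
        (use \<alpha> in auto)
    have vol: "measure lborel ?K = ?V"
      using int[of "\<lambda>_. 1"] by (simp add: set_integral_const[OF cK(1)] set_integral_const[OF I(2)])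
    then have pos: "0 < measure lborel ?K" using I(4) by simp
    have body: "convex_body ?K" by (rule convex_body_if_measure_pos[OF cK pos])
    have e1: "(LINT x:P|lborel. x $ i) = 0" for i
      using I(5)[of "axis i 1"] by (simp add: inner_axis')
    have e2: "(LINT x:P|lborel. x $ i * x $ j) = ?V * of_bool (i = j)" for i j
      using I(6)[of "axis i 1" "axis j 1"] by (simp add: inner_axis' inner_axis_axis) (simp add: axis_def)
    have m1: "(LINT x:?K|lborel. x $ i) = 0" for i
    proof -
      have "(LINT x:?K|lborel. x $ i) = (LINT x:P|lborel. x $ i + (r * n $ i) * \<alpha> x)"
        by (subst int) (auto intro!: continuous_intros simp: mult_ac)
      also have "\<dots> = 0"
      proof -
        have i1: "set_integrable lborel P (\<lambda>x. x $ i)"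
          by (intro set_integrable_compact I(2) continuous_intros)
        have i2: "set_integrable lborel P (\<lambda>x. (r * n $ i) * \<alpha> x)"
          using int\<alpha> by simp
        show ?thesis
          by (simp only: set_integral_add i1 i2 set_integral_mult_right e1 mean mult_zero_right add_0)
      qed
      finally show ?thesis .
    qed
    define k where "k = 2 * r * c0 + r\<^sup>2 * s"
    have m2: "(LINT x:?K|lborel. x $ i * x $ j) = ?V * of_bool (i = j) + k * (n $ i * n $ j)" for i j
    proof -
      have "(LINT x:?K|lborel. x $ i * x $ j) = (LINT x:P|lborel.
          ((x $ i * x $ j + (r * n $ j) * (\<alpha> x * x $ i)) + (r * n $ i) * (\<alpha> x * x $ j)) + (r\<^sup>2 * n $ i * n $ j) * (\<alpha> x * \<alpha> x))"
        by (subst int) (auto intro!: continuous_intros simp: algebra_simps power2_eq_square)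
      also have "\<dots> = ((LINT x:P|lborel. x $ i * x $ j) + (r * n $ j) * (LINT x:P|lborel. \<alpha> x * x $ i))
          + (r * n $ i) * (LINT x:P|lborel. \<alpha> x * x $ j) + (r\<^sup>2 * n $ i * n $ j) * s"
      proof -
        have i1: "set_integrable lborel P (\<lambda>x. x $ i * x $ j)"
          by (intro set_integrable_compact I(2) continuous_intros)
        have i2: "set_integrable lborel P (\<lambda>x. c * (\<alpha> x * x $ l))" for c l
          using intf[of "\<lambda>x. x $ l"] by (simp add: continuous_intros)
        have i3: "set_integrable lborel P (\<lambda>x. c * (\<alpha> x * \<alpha> x))" for c
          using int2 by simp
        show ?thesis
          by (simp only: set_integral_add i1 i2 i3 set_integral_mult_right s_def)
      qed
      also have "\<dots> = ?V * of_bool (i = j) + k * (n $ i * n $ j)"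
        by (simp add: e2 cross k_def algebra_simps power2_eq_square)
      finally show ?thesis .
    qed
    \<comment> \<open>A rank-one update of the identity, so its determinant is exactly
      \<open>1 + k / ?V\<close>, while the volume has not changed: maximality says
      \<open>k \<le> 0\<close>.\<close>
    have "covariance_matrix ?K = matrix (\<lambda>x. x + (n \<bullet> x) *\<^sub>R ((k / ?V) *\<^sub>R n))"
      using I(4)
      by (auto simp: vec_eq_iff covariance_matrix_nth'[OF cK(1) pos] m1 m2 vol matrix_def inner_axis field_simps)
        (auto simp: axis_def)
    then have "det (covariance_matrix ?K) = 1 + k / ?V"
      by (simp only: det_rank_one_update) (simp add: nn)
    then show ?thesis
      using isotropic_maximizer_det_le[OF P body] I(4) by (simp add: vol k_def divide_le_0_iff)
  qed
  have "2 * t * c0 + t\<^sup>2 * s \<le> 0" "- (2 * t * c0) + t\<^sup>2 * s \<le> 0"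
    using le[of t] le[of "-t"] t by auto
  then have "t\<^sup>2 * s \<le> 0" by linarith
  then have s0: "s \<le> 0" using t by (simp add: mult_le_0_iff)
  have nonneg: "0 \<le> indicator P x *\<^sub>R (\<alpha> x * \<alpha> x)" for x by simp
  then have "0 \<le> s"
    unfolding s_def set_lebesgue_integral_def by (intro Bochner_Integration.integral_nonneg)
  with s0 have "s = 0" by simp
  then have "(\<integral>x. indicator P x *\<^sub>R (\<alpha> x * \<alpha> x) \<partial>lborel) = 0"
    by (simp add: s_def set_lebesgue_integral_def)
  then have "AE x in lborel. indicator P x *\<^sub>R (\<alpha> x * \<alpha> x) = 0"
    using integral_nonneg_eq_0_iff_AE[OF int2[unfolded set_integrable_def]] nonneg by simp
  then show ?thesis by eventually_elim (auto simp: indicator_def)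
qed

text \<open>Turns an almost-everywhere identity for a height known only to be measurable into
  conditions valid throughout the interior.\<close>

lemma open_subset_empty_if_AE:
  fixes G :: "'a::euclidean_space set"
  assumes "open G" "AE x in lborel. x \<in> P \<longrightarrow> Q x" "G \<subseteq> P" "\<And>x. x \<in> G \<Longrightarrow> \<not> Q x"
  shows "G = {}"
proof (rule ccontr)
  assume "G \<noteq> {}"
  have "AE x in lborel. x \<notin> G" using assms(2) by eventually_elim (use assms(3,4) in auto)
  then have "G \<in> null_sets lborel"
    using assms(1) by (subst (asm) AE_iff_null_sets[symmetric]) auto
  then have "negligible G"
    by (auto simp: negligible_iff_null_sets null_sets_completionI)
  then show False using open_not_negligible[OF assms(1) \<open>G \<noteq> {}\<close>] by blast
qed

text \<open>
  If the body is symmetric in the hyperplane orthogonal to \<open>n\<close>, with height \<open>g\<close> over it, then the shear by \<open>t g\<close>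
  preserves convexity for \<open>|t| < 1\<close>, because it turns the heights \<open>(-g, g)\<close> into \<open>(-(1 - t) g, (1 + t) g)\<close>.
\<close>

lemma symmetric_maximizer_affine_height:
  fixes P :: "(real^'n) set"
  assumes P: "isotropic_maximizer P" and n: "norm n = 1"
    and sym: "\<And>x. x \<in> P \<Longrightarrow> x - (2 * (x \<bullet> n)) *\<^sub>R n \<in> P"
  obtains m k where "k \<bullet> n = 0"
    "\<And>x. x \<in> P \<Longrightarrow> \<bar>x \<bullet> n\<bar> \<le> m + k \<bullet> x"
    "\<And>x. x \<in> P \<Longrightarrow> x - (x \<bullet> n) *\<^sub>R n + (m + k \<bullet> x) *\<^sub>R n \<in> P"
proof -
  have iso: "isotropic P" using P by (simp add: isotropic_maximizer_def)
  note I = isotropic_D[OF iso]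
  let ?V = "measure lborel P"
  have nn: "n \<bullet> n = 1" using n by (simp add: norm_eq_1)
  have closed: "closed P" using I(2) compact_imp_closed by blast
  define \<pi> where "\<pi> x = x - (x \<bullet> n) *\<^sub>R n" for x
  have \<pi>n: "\<pi> x \<bullet> n = 0" for x by (simp add: \<pi>_def inner_diff_left nn)
  have \<pi>_shift: "\<pi> (x + s *\<^sub>R n) = \<pi> x" for x s
    by (simp add: \<pi>_def inner_add_left nn algebra_simps)
  have \<pi>_idem: "\<pi> (\<pi> x) = \<pi> x" for x by (simp add: \<pi>_def[of "\<pi> x"] \<pi>n)
  have decomp: "\<pi> x + (x \<bullet> n) *\<^sub>R n = x" for x by (simp add: \<pi>_def)
  have cont\<pi>: "continuous_on S \<pi>" for S unfolding \<pi>_def by (intro continuous_intros)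
  have flip: "\<pi> x + (- r) *\<^sub>R n \<in> P" if "\<pi> x + r *\<^sub>R n \<in> P" for x r
  proof -
    have "(\<pi> x + r *\<^sub>R n) \<bullet> n = r" by (simp add: inner_add_left \<pi>n nn)
    then have "\<pi> x + r *\<^sub>R n - (2 * r) *\<^sub>R n \<in> P" using sym[OF that] by metis
    moreover have "\<pi> x + r *\<^sub>R n - (2 * r) *\<^sub>R n = \<pi> x + (- r) *\<^sub>R n"
      unfolding mult_2 scaleR_add_left by simp
    ultimately show ?thesis by metis
  qed
  have shrink: "\<pi> x + s *\<^sub>R n \<in> P" if h: "\<pi> x + r *\<^sub>R n \<in> P" "\<bar>s\<bar> \<le> r" for x s r
  proof (cases "r = 0")
    case False
    then have "0 < r" using h(2) by linarith
    have "\<pi> x - r *\<^sub>R n \<in> P" using flip[OF h(1)] by simp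
    moreover define u where "u = (r + s) / (2 * r)"
    have u: "0 \<le> u" "u \<le> 1" "u * (2 * r) = r + s" using h(2) \<open>0 < r\<close> by (auto simp: u_def field_simps)
    ultimately have "u *\<^sub>R (\<pi> x + r *\<^sub>R n) + (1 - u) *\<^sub>R (\<pi> x - r *\<^sub>R n) \<in> P"
      using convexD[OF I(3) h(1), of "\<pi> x - r *\<^sub>R n" u "1 - u"] by simp
    also have "u *\<^sub>R (\<pi> x + r *\<^sub>R n) + (1 - u) *\<^sub>R (\<pi> x - r *\<^sub>R n) = \<pi> x + (u * (2 * r) - r) *\<^sub>R n"
      by (simp add: vec_eq_iff algebra_simps)
    finally show ?thesis using u(3) by simp
  qed (use h in auto)
  have \<pi>P: "\<pi> x \<in> P" if "x \<in> P" for x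
  proof -
    have "\<pi> x + (x \<bullet> n) *\<^sub>R n \<in> P" using that decomp by simp
    moreover have "\<pi> x + (- (x \<bullet> n)) *\<^sub>R n \<in> P"
      by (rule flip) fact
    ultimately have "\<pi> x + \<bar>x \<bullet> n\<bar> *\<^sub>R n \<in> P" by (simp add: abs_if)
    from shrink[OF this, of 0] show ?thesis by simp
  qed
  obtain M where M: "\<And>x. x \<in> P \<Longrightarrow> norm x \<le> M"
    using compact_imp_bounded[OF I(2)] by (auto simp: bounded_iff)
  have heightM: "s \<le> M" if "\<pi> x + s *\<^sub>R n \<in> P" for x s
  proof -
    have "s = (\<pi> x + s *\<^sub>R n) \<bullet> n" by (simp add: inner_add_left \<pi>n nn)
    also have "\<dots> \<le> norm (\<pi> x + s *\<^sub>R n)" using norm_cauchy_schwarz[of "\<pi> x + s *\<^sub>R n" n] n by simp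
    finally show ?thesis using M[OF that] by simp
  qed
  \<comment> \<open>The value 0 off the shadow of \<open>P\<close> is a default that keeps
    \<open>g\<close> nonnegative everywhere and its positive superlevel sets closed.\<close>
  define g where "g x = (if \<pi> x \<in> P then Sup {s. \<pi> x + s *\<^sub>R n \<in> P} else 0)" for x
  have g_iff: "\<bar>s\<bar> \<le> g x \<longleftrightarrow> \<pi> x + s *\<^sub>R n \<in> P" and g0: "0 \<le> g x" if x: "\<pi> x \<in> P" for x s
  proof -
    let ?S = "{s. \<pi> x + s *\<^sub>R n \<in> P}"
    have 0: "0 \<in> ?S" using x by simp
    have bdd: "bdd_above ?S" using heightM by (auto intro!: bdd_aboveI)
    have "closed ?S"
    proof -
      have "?S = (\<lambda>s. \<pi> x + s *\<^sub>R n) -` P" by auto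
      then show ?thesis using closed
        by (simp add: continuous_closed_vimage continuous_intros)
    qed
    moreover have "?S \<noteq> {}" using 0 by blast
    ultimately have "Sup ?S \<in> ?S" by (intro closed_contains_Sup bdd)
    then have gx: "\<pi> x + g x *\<^sub>R n \<in> P" using x by (simp add: g_def)
    show g0: "0 \<le> g x" using cSup_upper[OF 0 bdd] x by (simp add: g_def)
    show "\<bar>s\<bar> \<le> g x \<longleftrightarrow> \<pi> x + s *\<^sub>R n \<in> P"
    proof
      assume "\<pi> x + s *\<^sub>R n \<in> P"
      then have s: "s \<le> g x" using cSup_upper[OF _ bdd, of s] x by (simp add: g_def)
      have "\<pi> x + (- s) *\<^sub>R n \<in> P" by (rule flip) fact
      then have "- s \<le> g x" using cSup_upper[OF _ bdd, of "- s"] x by (simp add: g_def)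
      with s show "\<bar>s\<bar> \<le> g x" by linarith
    qed (rule shrink[OF gx])
  qed
  have g_shift: "g (x + s *\<^sub>R n) = g x" for x s by (simp add: g_def \<pi>_shift)
  have gM: "\<bar>g x\<bar> \<le> M" if "x \<in> P" for x
    using heightM[of x "g x"] g_iff[OF \<pi>P[OF that], of "g x"] g0[OF \<pi>P[OF that]] by simp
  \<comment> \<open>For \<open>s > 0\<close> the set where \<open>g\<close> is at least
    \<open>s\<close> is the preimage of the closed set \<open>P\<close> under a continuous map; for
    \<open>s \<le> 0\<close> it is the whole space.\<close>
  have g_meas: "g \<in> borel_measurable borel"
    unfolding borel_measurable_iff_ge
  proof
    fix s
    show "{w \<in> space borel. s \<le> g w} \<in> sets borel"
    proof (cases "s \<le> 0")
      case True
      then have "{w \<in> space borel. s \<le> g w} = UNIV"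
        using g0 by (auto simp: g_def intro: order_trans)
      then show ?thesis by simp
    next
      case False
      have "s \<le> g x \<longleftrightarrow> \<pi> x + s *\<^sub>R n \<in> P" for x
      proof (cases "\<pi> x \<in> P")
        case True
        then show ?thesis using g_iff[of x s] False by simp
      next
        case F: False
        have "\<pi> x + s *\<^sub>R n \<notin> P" using \<pi>P[of "\<pi> x + s *\<^sub>R n"] F by (auto simp: \<pi>_shift \<pi>_idem)
        then show ?thesis using F False by (simp add: g_def)
      qed
      then have "{w \<in> space borel. s \<le> g w} = (\<lambda>x. \<pi> x + s *\<^sub>R n) -` P" by auto
      moreover have "closed \<dots>"
        using closed cont\<pi> by (intro continuous_closed_vimage) (auto intro!: continuous_intros simp: \<pi>_def)
      ultimately show ?thesis by simp
    qed
  qed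
  have gint: "set_integrable lborel P (\<lambda>x. g x * f x)" if f: "continuous_on UNIV f" for f :: "real^'n \<Rightarrow> real"
  proof -
    obtain C where C: "\<And>x. x \<in> P \<Longrightarrow> \<bar>f x\<bar> \<le> C"
      using compact_continuous_bounded[OF I(2)] continuous_on_subset[OF f] by (metis subset_UNIV)
    show ?thesis
    proof (rule set_integrable_bounded_measurable[OF I(2)])
      show "(\<lambda>x. g x * f x) \<in> borel_measurable borel"
        using g_meas borel_measurable_continuous_onI[OF f] by measurable
      show "\<bar>g x * f x\<bar> \<le> M * C" if "x \<in> P" for x
        unfolding abs_mult using gM[OF that] C[OF that] by (intro mult_mono) auto
    qed
  qed
  \<comment> \<open>Regression coefficients: as x has mean 0 and covariance matrix I, they are the
    mean of \<open>g\<close> and its correlations with the coordinates. The projection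
    \<open>\<pi>\<close> makes \<open>k\<close> orthogonal to \<open>n\<close>.\<close>
  define m where "m = (LINT x:P|lborel. g x) / ?V"
  define k :: "real^'n" where "k = (\<chi> i. (LINT x:P|lborel. g x * (axis i 1 \<bullet> \<pi> x)) / ?V)"
  have k: "k \<bullet> b = (LINT x:P|lborel. g x * (b \<bullet> \<pi> x)) / ?V" for b
  proof -
    have "integrable lborel (\<lambda>x. indicator P x *\<^sub>R (b $ i * (g x * (axis i 1 \<bullet> \<pi> x))))" for i
      using gint[of "\<lambda>x. b $ i * (axis i 1 \<bullet> \<pi> x)"]
      by (simp add: set_integrable_def mult.left_commute continuous_intros cont\<pi>)
    then have "(LINT x:P|lborel. (\<Sum>i\<in>UNIV. b $ i * (g x * (axis i 1 \<bullet> \<pi> x))))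
        = (\<Sum>i\<in>UNIV. LINT x:P|lborel. b $ i * (g x * (axis i 1 \<bullet> \<pi> x)))"
      unfolding set_lebesgue_integral_def scaleR_sum_right by (rule Bochner_Integration.integral_sum)
    moreover have "g x * (b \<bullet> \<pi> x) = (\<Sum>i\<in>UNIV. b $ i * (g x * (axis i 1 \<bullet> \<pi> x)))" for x
      by (simp add: inner_vec_def[of b] inner_axis' sum_distrib_left mult.left_commute)
    ultimately show ?thesis
      by (simp add: k_def inner_vec_def[of "\<chi> i. _ i"] sum_divide_distrib mult.commute)
  qed
  have kn: "k \<bullet> n = 0"
    unfolding k by (simp add: inner_commute[of n] \<pi>n)
  define \<alpha> where "\<alpha> x = g x - (m + k \<bullet> x)" for x
  have \<alpha>_meas: "\<alpha> \<in> borel_measurable borel"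
    unfolding \<alpha>_def using g_meas by measurable
  have \<alpha>_shift: "\<alpha> (x + s *\<^sub>R n) = \<alpha> x" for x s
    by (simp add: \<alpha>_def g_shift inner_add_right kn)
  obtain C where C: "\<And>x. x \<in> P \<Longrightarrow> \<bar>m + k \<bullet> x\<bar> \<le> C"
    by (rule compact_continuous_bounded[OF I(2), of "\<lambda>x. m + k \<bullet> x"]) (auto intro!: continuous_intros)
  have \<alpha>_bound: "\<bar>\<alpha> x\<bar> \<le> M + C" if "x \<in> P" for x
    using gM[OF that] C[OF that] by (simp add: \<alpha>_def)
  have mean: "(LINT x:P|lborel. \<alpha> x) = 0"
  proof -
    have i: "set_integrable lborel P g" "set_integrable lborel P (\<lambda>x. m)" "set_integrable lborel P (\<lambda>x. k \<bullet> x)"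
      using gint[of "\<lambda>_. 1"] by (auto intro!: set_integrable_compact I(2) continuous_intros)
    have "(LINT x:P|lborel. \<alpha> x) = (LINT x:P|lborel. g x) - ((LINT x:P|lborel. m) + (LINT x:P|lborel. k \<bullet> x))"
      by (simp only: \<alpha>_def set_integral_diff set_integral_add i)
    then show ?thesis
      using I(4) by (simp only: I(5) set_integral_const[OF I(2)]) (simp add: m_def)
  qed
  have uncorr: "(LINT x:P|lborel. \<alpha> x * (b \<bullet> x)) = 0" if b: "b \<bullet> n = 0" for b
  proof -
    have b\<pi>: "b \<bullet> \<pi> x = b \<bullet> x" for x by (simp add: \<pi>_def inner_diff_right b)
    have "(LINT x:P|lborel. \<alpha> x * (b \<bullet> x))
        = (LINT x:P|lborel. (g x * (b \<bullet> x) - m * (b \<bullet> x)) - (k \<bullet> x) * (b \<bullet> x))"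
      by (simp add: \<alpha>_def algebra_simps)
    also have "\<dots> = (LINT x:P|lborel. g x * (b \<bullet> x)) - m * (LINT x:P|lborel. b \<bullet> x) - (LINT x:P|lborel. (k \<bullet> x) * (b \<bullet> x))"
    proof -
      have i: "set_integrable lborel P (\<lambda>x. g x * (b \<bullet> x))" "set_integrable lborel P (\<lambda>x. m * (b \<bullet> x))"
        "set_integrable lborel P (\<lambda>x. (k \<bullet> x) * (b \<bullet> x))"
        by (auto intro!: gint set_integrable_compact I(2) continuous_intros)
      show ?thesis by (simp only: set_integral_diff i set_integral_mult_right)
    qed
    also have "\<dots> = 0" using k[of b] I(4) by (simp add: I(5,6) b\<pi>)
    finally show ?thesis .
  qed
  have convex_image: "compact ((\<lambda>x. x + (r * \<alpha> x) *\<^sub>R n) ` P) \<and> convex ((\<lambda>x. x + (r * \<alpha> x) *\<^sub>R n) ` P)"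
    if r: "\<bar>r\<bar> = 1 / 2" for r
  proof -
    let ?K = "(\<lambda>x. x + (r * \<alpha> x) *\<^sub>R n) ` P"
    \<comment> \<open>The gauge of the interval from \<open>-(1 - r)\<close> to
      \<open>1 + r\<close>, the heights of a sheared fibre in units of \<open>g\<close>.\<close>
    define \<rho> where "\<rho> z = max (z / (1 + r)) (- z / (1 - r))" for z
    have r': "0 < 1 + r" "0 < 1 - r" using r by linarith+
    have \<rho>0: "0 \<le> \<rho> z" for z
      using r' by (cases "0 \<le> z") (auto simp: \<rho>_def le_max_iff_disj divide_nonpos_pos)
    have \<rho>_le: "\<rho> z \<le> c \<longleftrightarrow> z \<le> (1 + r) * c \<and> - z \<le> (1 - r) * c" for z c
      unfolding \<rho>_def max.bounded_iff pos_divide_le_eq[OF r'(1)] pos_divide_le_eq[OF r'(2)]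
      by (simp add: mult.commute)
    \<comment> \<open>The height with the affine part of the shear undone; a point belongs to the
      image exactly if \<open>\<rho> (h x)\<close> does not exceed the height of \<open>P\<close>
      there. This turns membership in \<open>?K\<close> into membership in \<open>P\<close>.\<close>
    define h where "h x = x \<bullet> n + r * (m + k \<bullet> x)" for x
    have K_eq: "?K = {x. \<pi> x + \<rho> (h x) *\<^sub>R n \<in> P}"
    proof (intro subset_antisym subsetI)
      fix x assume "x \<in> ?K"
      then obtain y where y: "y \<in> P" "x = y + (r * \<alpha> y) *\<^sub>R n" by blast
      have "\<bar>y \<bullet> n\<bar> \<le> g y" using g_iff[OF \<pi>P[OF y(1)], of "y \<bullet> n"] y(1) by (simp add: decomp)
      moreover have "h x = y \<bullet> n + r * g y"
        by (simp add: h_def y(2) inner_add_left inner_add_right nn kn \<alpha>_def algebra_simps)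
      ultimately have "\<rho> (h x) \<le> g y" by (simp add: \<rho>_le algebra_simps) linarith
      then have "\<pi> y + \<rho> (h x) *\<^sub>R n \<in> P" using g_iff[OF \<pi>P[OF y(1)]] \<rho>0[of "h x"] by (metis abs_of_nonneg)
      then show "x \<in> {x. \<pi> x + \<rho> (h x) *\<^sub>R n \<in> P}" by (simp add: y(2) \<pi>_shift)
    next
      fix x assume "x \<in> {x. \<pi> x + \<rho> (h x) *\<^sub>R n \<in> P}"
      then have x: "\<pi> x + \<rho> (h x) *\<^sub>R n \<in> P" by simp
      then have \<pi>x: "\<pi> x \<in> P" using \<pi>P[OF x] by (simp add: \<pi>_shift \<pi>_idem)
      have "\<rho> (h x) \<le> g x" using g_iff[OF \<pi>x] x \<rho>0[of "h x"] by (metis abs_of_nonneg)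
      then have hx: "h x \<le> (1 + r) * g x" "- h x \<le> (1 - r) * g x" by (auto simp: \<rho>_le)
      define y where "y = x + (- (r * \<alpha> x)) *\<^sub>R n"
      have yn: "y \<bullet> n = h x - r * g x" by (simp add: y_def h_def inner_add_left nn \<alpha>_def algebra_simps)
      have "\<bar>y \<bullet> n\<bar> \<le> g x" using hx by (simp add: yn algebra_simps abs_le_iff)
      then have "\<pi> x + (y \<bullet> n) *\<^sub>R n \<in> P" using g_iff[OF \<pi>x] by blast
      moreover have "\<pi> x = \<pi> y" unfolding y_def by (rule \<pi>_shift[symmetric])
      ultimately have "y \<in> P" by (simp add: decomp)
      moreover have "\<alpha> y = \<alpha> x" unfolding y_def by (rule \<alpha>_shift)
      then have "x = y + (r * \<alpha> y) *\<^sub>R n" by (simp add: y_def)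
      ultimately show "x \<in> ?K" by blast
    qed
    have "closed ?K"
    proof -
      have "continuous_on UNIV (\<lambda>x. \<pi> x + \<rho> (h x) *\<^sub>R n)"
        unfolding \<rho>_def h_def using r' by (intro continuous_intros cont\<pi>) auto
      then have "closed ((\<lambda>x. \<pi> x + \<rho> (h x) *\<^sub>R n) -` P)"
        using closed by (simp add: continuous_closed_vimage continuous_on_eq_continuous_at)
      then show ?thesis unfolding K_eq by (simp add: vimage_def)
    qed
    moreover have "bounded ?K"
      unfolding bounded_iff
    proof (intro exI ballI)
      fix x assume "x \<in> ?K"
      then obtain y where y: "y \<in> P" "x = y + (r * \<alpha> y) *\<^sub>R n" by blast
      have "norm x \<le> norm y + norm ((r * \<alpha> y) *\<^sub>R n)" unfolding y(2) by (rule norm_triangle_ineq)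
      also have "norm ((r * \<alpha> y) *\<^sub>R n) = 1 / 2 * \<bar>\<alpha> y\<bar>" by (simp add: n abs_mult r)
      also have "norm y + 1 / 2 * \<bar>\<alpha> y\<bar> \<le> M + 1 / 2 * (M + C)"
        using M[OF y(1)] \<alpha>_bound[OF y(1)] by (intro add_mono mult_left_mono) auto
      finally show "norm x \<le> M + 1 / 2 * (M + C)" .
    qed
    moreover have "convex ?K"
      unfolding K_eq
    proof (rule convexI)
      fix p q and u v :: real
      assume p: "p \<in> {x. \<pi> x + \<rho> (h x) *\<^sub>R n \<in> P}" and q: "q \<in> {x. \<pi> x + \<rho> (h x) *\<^sub>R n \<in> P}"
        and uv: "0 \<le> u" "0 \<le> v" "u + v = 1"
      let ?z = "u *\<^sub>R p + v *\<^sub>R q" and ?R = "u * \<rho> (h p) + v * \<rho> (h q)"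
      have \<pi>z: "\<pi> ?z = u *\<^sub>R \<pi> p + v *\<^sub>R \<pi> q"
        by (simp add: \<pi>_def inner_add_left algebra_simps)
      have "u *\<^sub>R (\<pi> p + \<rho> (h p) *\<^sub>R n) + v *\<^sub>R (\<pi> q + \<rho> (h q) *\<^sub>R n) \<in> P"
        using p q uv by (intro convexD[OF I(3)]) auto
      also have "u *\<^sub>R (\<pi> p + \<rho> (h p) *\<^sub>R n) + v *\<^sub>R (\<pi> q + \<rho> (h q) *\<^sub>R n) = \<pi> ?z + ?R *\<^sub>R n"
        by (simp add: \<pi>z algebra_simps)
      finally have R: "\<pi> ?z + ?R *\<^sub>R n \<in> P" .
      have hz: "h ?z = u * h p + v * h q"
      proof -
        have v: "v = 1 - u" using uv(3) by simp
        show ?thesis unfolding v by (simp add: h_def inner_add_left inner_add_right algebra_simps)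
      qed
      have le: "h p \<le> (1 + r) * \<rho> (h p)" "- h p \<le> (1 - r) * \<rho> (h p)"
        "h q \<le> (1 + r) * \<rho> (h q)" "- h q \<le> (1 - r) * \<rho> (h q)"
        using \<rho>_le[of "h p" "\<rho> (h p)"] \<rho>_le[of "h q" "\<rho> (h q)"] by auto
      have "u * h p + v * h q \<le> u * ((1 + r) * \<rho> (h p)) + v * ((1 + r) * \<rho> (h q))"
        using le uv by (intro add_mono mult_left_mono) auto
      moreover have "u * (- h p) + v * (- h q) \<le> u * ((1 - r) * \<rho> (h p)) + v * ((1 - r) * \<rho> (h q))"
        using le uv by (intro add_mono mult_left_mono) auto
      \<comment> \<open>Convexity of the gauge \<open>\<rho>\<close>, combined with the affine
        \<open>h\<close>; since \<open>P\<close> contains the point at height \<open>?R\<close>, it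
        also contains the one at the smaller height \<open>\<rho> (h ?z)\<close>.\<close>
      ultimately have "\<rho> (h ?z) \<le> ?R" by (simp add: \<rho>_le hz algebra_simps)
      then have "\<pi> ?z + \<rho> (h ?z) *\<^sub>R n \<in> P" using shrink[OF R] \<rho>0[of "h ?z"] by simp
      then show "?z \<in> {x. \<pi> x + \<rho> (h x) *\<^sub>R n \<in> P}" by simp
    qed
    ultimately show ?thesis using compact_eq_bounded_closed by blast
  qed
  have AE: "AE x in lborel. x \<in> P \<longrightarrow> \<alpha> x = 0"
    by (rule shear_trivial[OF P n \<alpha>_meas \<alpha>_shift \<alpha>_bound mean uncorr, of "1/2"]) (use convex_image in auto)
  have clP: "closure (interior P) = P"
    using convex_closure_interior[OF I(3)] closed I(1) by (simp add: convex_body_def)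
  \<comment> \<open>One half of the identification of \<open>g\<close> with the affine function: a
    point of \<open>P\<close> above the graph would have \<open>g\<close> strictly larger than the
    affine value, and such points form an open set.\<close>
  have "{x \<in> interior P. m + k \<bullet> x < x \<bullet> n} = {}"
  proof (rule open_subset_empty_if_AE[OF _ AE])
    have "{x \<in> interior P. m + k \<bullet> x < x \<bullet> n} = interior P \<inter> {x. m + k \<bullet> x < x \<bullet> n}" by auto
    moreover have "open {x. m + k \<bullet> x < x \<bullet> n}" by (intro open_Collect_less continuous_intros)
    ultimately show "open {x \<in> interior P. m + k \<bullet> x < x \<bullet> n}" by (simp add: open_Int)
    show "{x \<in> interior P. m + k \<bullet> x < x \<bullet> n} \<subseteq> P" using interior_subset by auto
    fix x assume "x \<in> {x \<in> interior P. m + k \<bullet> x < x \<bullet> n}"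
    then have x: "x \<in> P" "m + k \<bullet> x < x \<bullet> n" using interior_subset by auto
    have "\<bar>x \<bullet> n\<bar> \<le> g x" using g_iff[OF \<pi>P[OF x(1)], of "x \<bullet> n"] x(1) by (simp add: decomp)
    then show "\<alpha> x \<noteq> 0" using x by (simp add: \<alpha>_def)
  qed
  then have "interior P \<subseteq> {x. x \<bullet> n \<le> m + k \<bullet> x}" by force
  then have "closure (interior P) \<subseteq> {x. x \<bullet> n \<le> m + k \<bullet> x}"
    by (intro closure_minimal closed_Collect_le continuous_intros)
  then have up: "x \<bullet> n \<le> m + k \<bullet> x" if "x \<in> P" for x using that clP by auto
  have abs: "\<bar>x \<bullet> n\<bar> \<le> m + k \<bullet> x" if x: "x \<in> P" for x
    using up[OF x] up[OF sym[OF x]] by (simp add: inner_diff_left inner_diff_right nn kn)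
  \<comment> \<open>The other half: where the point on the graph is outside \<open>P\<close>, the
    affine value exceeds \<open>g\<close>, again on an open subset of the interior.\<close>
  let ?G = "{x \<in> interior P. \<pi> x + (m + k \<bullet> x) *\<^sub>R n \<notin> P}"
  have cont: "continuous_on UNIV (\<lambda>x. \<pi> x + (m + k \<bullet> x) *\<^sub>R n)"
    by (intro continuous_intros cont\<pi>)
  have cl: "closed ((\<lambda>x. \<pi> x + (m + k \<bullet> x) *\<^sub>R n) -` P)"
    using cont closed by (simp add: continuous_closed_vimage continuous_on_eq_continuous_at)
  have "?G = {}"
  proof (rule open_subset_empty_if_AE[OF _ AE])
    have "?G = interior P \<inter> - ((\<lambda>x. \<pi> x + (m + k \<bullet> x) *\<^sub>R n) -` P)" by auto
    then show "open ?G" using cl by (simp add: open_Int open_Compl)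
    show "?G \<subseteq> P" using interior_subset by auto
    fix x assume "x \<in> ?G"
    then have x: "x \<in> P" "\<pi> x + (m + k \<bullet> x) *\<^sub>R n \<notin> P" using interior_subset by auto
    have "\<not> \<bar>m + k \<bullet> x\<bar> \<le> g x" using g_iff[OF \<pi>P[OF x(1)]] x(2) by blast
    then show "\<alpha> x \<noteq> 0" using abs[OF x(1)] by (simp add: \<alpha>_def)
  qed
  then have "interior P \<subseteq> (\<lambda>x. \<pi> x + (m + k \<bullet> x) *\<^sub>R n) -` P" by auto
  then have "closure (interior P) \<subseteq> (\<lambda>x. \<pi> x + (m + k \<bullet> x) *\<^sub>R n) -` P"
    using cl by (intro closure_minimal)
  then have "\<pi> x + (m + k \<bullet> x) *\<^sub>R n \<in> P" if "x \<in> P" for x using that clP by auto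
  then show ?thesis
    using that[OF kn abs] by (simp add: \<pi>_def)
qed

subsection \<open>Reflections across ridges\<close>

text \<open>An isometric linear involution is self-adjoint and its own inverse, so images are
  preimages and the normals are moved by the same map.\<close>

lemma simplicial_fan_involution:
  fixes \<sigma> :: "'a::euclidean_space \<Rightarrow> 'a"
  assumes fan: "simplicial_fan P \<V> a" and lin: "linear \<sigma>" and inv: "\<And>x. \<sigma> (\<sigma> x) = x"
    and iso: "\<And>x y. \<sigma> x \<bullet> \<sigma> y = x \<bullet> y"
  shows "simplicial_fan (\<sigma> ` P) ((`) \<sigma> ` \<V>) (\<lambda>W. \<sigma> (a (\<sigma> ` W)))"
proof -
  interpret simplicial_fan P \<V> a by fact
  have inj: "inj \<sigma>" using inv by (metis injI)
  have im2: "\<sigma> ` \<sigma> ` S = S" for S by (simp add: image_image inv)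
  have mem: "x \<in> \<sigma> ` S \<longleftrightarrow> \<sigma> x \<in> S" for x S using inv by (metis image_eqI imageE)
  have adj: "\<sigma> x \<bullet> y = x \<bullet> \<sigma> y" for x y using iso[of x "\<sigma> y"] inv by simp
  show ?thesis
  proof (rule simplicial_fan.intro)
    show "finite ((`) \<sigma> ` \<V>)" using finite_facets by simp
    show "\<sigma> ` P = {x. \<forall>V\<in>(`) \<sigma> ` \<V>. \<sigma> (a (\<sigma> ` V)) \<bullet> x \<le> 1}"
    proof (rule set_eqI)
      fix x
      have "x \<in> \<sigma> ` P \<longleftrightarrow> (\<forall>V\<in>\<V>. a V \<bullet> \<sigma> x \<le> 1)"
        unfolding mem by (subst P_eq) simp
      then show "x \<in> \<sigma> ` P \<longleftrightarrow> x \<in> {x. \<forall>V\<in>(`) \<sigma> ` \<V>. \<sigma> (a (\<sigma> ` V)) \<bullet> x \<le> 1}"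
        by (simp add: im2 adj)
    qed
    show "bounded (\<sigma> ` P)"
      using bounded lin by (intro bounded_linear_image) (simp_all add: linear_conv_bounded_linear)
    fix W assume "W \<in> (`) \<sigma> ` \<V>"
    then obtain V where V: "V \<in> \<V>" "W = \<sigma> ` V" by blast
    interpret V: vector_basis V by (rule basis) fact
    show "vector_basis W"
    proof
      show "independent W"
        unfolding V(2) by (rule linear_independent_injective_image[OF lin V.independent]) (rule inj_on_subset[OF inj subset_UNIV])
      show "card W = DIM('a)"
        unfolding V(2) using inj_on_subset[OF inj subset_UNIV, of V] by (simp add: card_image V.card)
    qed
    show "\<sigma> (a (\<sigma> ` W)) \<bullet> v = 1" if v: "v \<in> W" for v
      using that normal[OF V(1)] by (auto simp: V(2) im2 iso)
    have "\<sigma> ` P \<inter> {x. \<sigma> (a (\<sigma> ` W)) \<bullet> x = 1} = \<sigma> ` (P \<inter> {x. a V \<bullet> x = 1})"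
      by (rule set_eqI) (simp add: mem V(2) im2 adj)
    then show "\<sigma> ` P \<inter> {x. \<sigma> (a (\<sigma> ` W)) \<bullet> x = 1} = convex hull W"
      by (simp add: facet[OF V(1)] V(2) convex_hull_linear_image[OF lin])
  qed
qed

lemma extreme_point_not_between:
  fixes x y n :: "real^'n"
  assumes "x extreme_point_of S" "y + c *\<^sub>R n \<in> S" "y + (- c) *\<^sub>R n \<in> S" "x = y + z *\<^sub>R n"
    "\<bar>z\<bar> < c" "n \<noteq> 0"
  shows False
proof -
  define u where "u = (c + z) / (2 * c)"
  have u: "0 < u" "u < 1" "u * (2 * c) = c + z" using assms(5) by (auto simp: u_def field_simps)
  have "x = (1 - u) *\<^sub>R (y + (- c) *\<^sub>R n) + u *\<^sub>R (y + c *\<^sub>R n)"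
  proof -
    have "(1 - u) *\<^sub>R (y + (- c) *\<^sub>R n) + u *\<^sub>R (y + c *\<^sub>R n) = y + (u * c + u * c - c) *\<^sub>R n"
      by (simp add: vec_eq_iff algebra_simps)
    also have "u * c + u * c - c = u * (2 * c) - c" by simp
    also have "\<dots> = z" unfolding u(3) by simp
    finally show ?thesis using assms(4) by simp
  qed
  moreover have "y + (- c) *\<^sub>R n \<noteq> y + c *\<^sub>R n"
  proof
    assume "y + (- c) *\<^sub>R n = y + c *\<^sub>R n"
    then have "(- c) *\<^sub>R n = c *\<^sub>R n" by (simp only: add_left_cancel)
    then have "- c = c" using assms(6) scaleR_cancel_right by blast
    then show False using assms(5) by linarith
  qed
  ultimately have "x \<in> open_segment (y + (- c) *\<^sub>R n) (y + c *\<^sub>R n)"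
    using u unfolding in_segment by blast
  then show False using assms(1-3) by (auto simp: extreme_point_of_def)
qed

context isotropic_maximizer_fan
begin

lemma is_simplex: "int CARD('n) simplex P"
proof -
  note I = isotropic_D[OF isotropic]
  obtain V where V: "V \<in> \<V>" by (rule cone_cover)
  interpret V: vector_basis V by (rule basis) fact
  obtain v where v: "v \<in> V" using V.card by fastforce
  define R where "R = V - {v}"
  obtain w where W: "insert w R \<in> \<V>" and w: "representation V w v < 0"
    using neighbour[OF V v] unfolding R_def by metis
  have wR: "w \<notin> R" using w V.coord_basis[of w v] by (auto simp: R_def split: if_splits)
  have "w \<noteq> v" using w V.coord_basis[OF v, of v] by auto
  note bal = balanced_neighbour_eq[OF V.vector_basis_axioms v facets_balanced[OF V]
      facets_balanced[OF W, unfolded R_def] wR[unfolded R_def], folded R_def]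
  define e where "e = norm (v - w)"
  have e: "0 < e" using \<open>w \<noteq> v\<close> by (simp add: e_def)
  define n where "n = (1 / e) *\<^sub>R (v - w)"
  have n1: "norm n = 1" using e by (simp add: n_def e_def)
  then have nn: "n \<bullet> n = 1" by (simp add: norm_eq_1)
  have n0: "n \<noteq> 0" using n1 by (metis norm_zero zero_neq_one)
  have vw: "v - w = e *\<^sub>R n" using e by (simp add: n_def)
  have Rn: "r \<bullet> n = 0" if "r \<in> R" for r
    using bal(2)[OF that] by (simp add: n_def inner_diff_right)
  \<comment> \<open>Equal norms put the midpoint of \<open>v\<close> and \<open>w\<close> on the
    hyperplane orthogonal to \<open>n\<close>, which contains the ridge; thus the reflection
    exchanges \<open>v\<close> with \<open>w\<close> and fixes the ridge.\<close>
  have "e * (v \<bullet> n) = v \<bullet> v - v \<bullet> w" using e by (simp add: n_def inner_diff_right)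
  moreover have "e * e = v \<bullet> v - 2 * (v \<bullet> w) + w \<bullet> w"
    using power2_norm_eq_inner[of "v - w"]
    by (simp add: e_def power2_eq_square inner_diff_left inner_diff_right inner_commute)
  moreover have "v \<bullet> v = w \<bullet> w" using bal(1) by (simp add: norm_eq)
  ultimately have "e * (2 * (v \<bullet> n)) = e * e" by simp
  then have vn: "2 * (v \<bullet> n) = e" using e by simp
  define \<sigma> where "\<sigma> x = x - (2 * (x \<bullet> n)) *\<^sub>R n" for x
  have lin: "linear \<sigma>"
    by (intro linearI) (simp_all add: \<sigma>_def inner_add_left scaleR_add_left distrib_left scaleR_diff_right mult.left_commute)
  have \<sigma>n: "\<sigma> x \<bullet> n = - (x \<bullet> n)" for x by (simp add: \<sigma>_def inner_diff_left nn)
  have inv: "\<sigma> (\<sigma> x) = x" for x by (simp add: \<sigma>_def[of "\<sigma> x"] \<sigma>n) (simp add: \<sigma>_def)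
  have iso: "\<sigma> x \<bullet> \<sigma> y = x \<bullet> y" for x y
    by (simp add: \<sigma>_def inner_diff_left inner_diff_right nn inner_commute)
  have \<sigma>v: "\<sigma> v = w" unfolding \<sigma>_def vn vw[symmetric] by simp
  have \<sigma>w: "\<sigma> w = v" using inv[of v] \<sigma>v by simp
  have \<sigma>R: "\<sigma> ` R = R"
  proof -
    have "\<sigma> r = r" if "r \<in> R" for r using Rn[OF that] by (simp add: \<sigma>_def)
    then show ?thesis by force
  qed
  have V_eq: "V = insert v R" using v by (auto simp: R_def)
  have \<sigma>V: "\<sigma> ` V = insert w R" "\<sigma> ` insert w R = V"
    unfolding V_eq image_insert \<sigma>R \<sigma>v \<sigma>w by (rule refl)+
  have fan: "simplicial_fan P \<V> a" by (rule simplicial_fan_axioms)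
  note fan' = simplicial_fan_involution[OF fan lin inv iso]
  have bal': "balanced ((real CARD('n) + 1) * (real CARD('n) + 2)) U" if "U \<in> (`) \<sigma> ` \<V>" for U
  proof -
    obtain X where X: "X \<in> \<V>" "U = \<sigma> ` X" using \<open>U \<in> _\<close> by blast
    have inj: "inj_on \<sigma> X" using inv by (metis inj_onI)
    have "\<Sum>U = \<sigma> (\<Sum>X)"
      unfolding X(2) by (simp add: sum.reindex[OF inj] linear_sum[OF lin, of "\<lambda>x. x"])
    then show ?thesis
      using facets_balanced[OF X(1)] unfolding X(2) balanced_def
      by (auto simp: iso linear_add[OF lin, symmetric])
  qed
  \<comment> \<open>The mirror fan is balanced with the same constant and shares the facet
    \<open>V\<close>, as the image of the neighbour. One shared facet determines the whole
    fan.\<close>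
  have "\<V> \<subseteq> (`) \<sigma> ` \<V>"
  proof (rule balanced_fan_subset[OF fan fan' facets_balanced bal' V])
    show "V \<in> (`) \<sigma> ` \<V>" using W \<sigma>V(2) by (metis image_eqI)
  qed
  then have "P \<subseteq> \<sigma> ` P" by (rule simplicial_fan_facets_determine[OF fan fan'])
  then have sym: "\<sigma> x \<in> P" if "x \<in> P" for x using that inv by (metis imageE subsetD)
  obtain m k where kn: "k \<bullet> n = 0"
    and le: "\<And>x. x \<in> P \<Longrightarrow> \<bar>x \<bullet> n\<bar> \<le> m + k \<bullet> x"
    and top: "\<And>x. x \<in> P \<Longrightarrow> x - (x \<bullet> n) *\<^sub>R n + (m + k \<bullet> x) *\<^sub>R n \<in> P"
    using symmetric_maximizer_affine_height[OF maximizer n1 sym[unfolded \<sigma>_def]] by metis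
  define y where "y x = x - (x \<bullet> n) *\<^sub>R n" for x
  have bot: "y x + (- (m + k \<bullet> x)) *\<^sub>R n \<in> P" if "x \<in> P" for x
  proof -
    have "\<sigma> (y x + (m + k \<bullet> x) *\<^sub>R n) = y x + (- (m + k \<bullet> x)) *\<^sub>R n"
      by (simp add: \<sigma>_def y_def vec_eq_iff inner_add_left inner_diff_left nn algebra_simps)
    then show ?thesis using sym[OF top[OF that]] by (simp add: y_def)
  qed
  have tight: "\<bar>u \<bullet> n\<bar> = m + k \<bullet> u" if "u extreme_point_of P" "u \<in> P" for u
  proof (rule ccontr)
    assume "\<bar>u \<bullet> n\<bar> \<noteq> m + k \<bullet> u"
    then have "\<bar>u \<bullet> n\<bar> < m + k \<bullet> u" using le[OF that(2)] by simp
    then show False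
      using extreme_point_not_between[OF that(1), of "y u" "m + k \<bullet> u" n "u \<bullet> n"] top[OF that(2)] bot[OF that(2)] n0
      by (auto simp: y_def)
  qed
  \<comment> \<open>No vertex of \<open>V\<close> lies below the mirror: \<open>v\<close> is above
    it and the ridge is on it. Extreme points are at the end of their fibres, so all of
    \<open>V\<close> lies on the graph of the affine height.\<close>
  have V_tight: "(n - k) \<bullet> u = m" if u: "u \<in> V" for u
  proof -
    have "0 \<le> u \<bullet> n"
    proof (cases "u = v")
      case False
      then have "u \<in> R" using u by (simp add: R_def)
      then show ?thesis using Rn by simp
    qed (use vn e in simp)
    then show ?thesis
      using tight[OF extreme_point[OF V u] vertex_in[OF V u]]
      by (simp add: inner_diff_left inner_commute[of n u])
  qed
  have "0 \<in> P" using isotropic_zero_interior[OF isotropic] interior_subset by blast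
  then have m0: "0 \<le> m" using le[of 0] by simp
  \<comment> \<open>If \<open>m\<close> were 0, then \<open>n - k\<close> would vanish on a basis,
    although \<open>k\<close> is orthogonal to the unit vector \<open>n\<close>.\<close>
  have "m \<noteq> 0"
  proof
    assume "m = 0"
    then have "n - k = 0" using V_tight by (intro V.inner_eq_onI) simp
    then have "(n - k) \<bullet> n = 0" by simp
    then show False by (simp add: inner_diff_left nn kn)
  qed
  then have m: "0 < m" using m0 by simp
  \<comment> \<open>The upper graph spans the hyperplane of the facet \<open>V\<close>, so the upper
    end of every fibre lies in that facet and the lower end in its mirror image, the neighbouring
    facet.\<close>
  have "(1 / m) *\<^sub>R (n - k) = a V"
    by (rule V.inner_eq_onI) (use V_tight normal[OF V] m in simp)
  then have aV: "a V \<bullet> x = ((n - k) \<bullet> x) / m" for x by (metis inner_scaleR_left mult.commute times_divide_eq_right mult.right_neutral)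
  let ?C = "insert w V"
  have finC: "finite ?C" using V.finite by simp
  have P_hull: "P = convex hull ?C"
  proof (rule subset_antisym)
    have "?C \<subseteq> P" using vertex_in[OF V] vertex_in[OF W] by auto
    then show "convex hull ?C \<subseteq> P" by (rule hull_minimal) (rule convex_P)
    show "P \<subseteq> convex hull ?C"
    proof
      fix x assume x: "x \<in> P"
      let ?l = "m + k \<bullet> x"
      let ?q = "y x + ?l *\<^sub>R n"
      have "(n - k) \<bullet> ?q = m"
        by (simp add: y_def inner_diff_left inner_diff_right inner_add_right nn kn inner_commute[of n x])
      then have "?q \<in> P \<inter> {x. a V \<bullet> x = 1}"
        using top[OF x] m by (simp add: y_def aV)
      then have q: "?q \<in> convex hull V" using facet[OF V] by blast
      then have "\<sigma> ?q \<in> convex hull (insert w R)"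
        using convex_hull_linear_image[OF lin, of V] \<sigma>V(1) by (metis imageI)
      moreover have "convex hull V \<subseteq> convex hull ?C" "convex hull (insert w R) \<subseteq> convex hull ?C"
        by (auto intro!: hull_mono simp: R_def)
      ultimately have qC: "?q \<in> convex hull ?C" "\<sigma> ?q \<in> convex hull ?C" using q by auto
      have \<sigma>q: "\<sigma> ?q = y x + (- ?l) *\<^sub>R n"
        by (simp add: \<sigma>_def y_def vec_eq_iff inner_add_left inner_diff_left nn algebra_simps)
      have xl: "\<bar>x \<bullet> n\<bar> \<le> ?l" by (rule le[OF x])
      show "x \<in> convex hull ?C"
      proof (cases "?l = 0")
        case True
        then show ?thesis using xl qC(1) by (simp add: y_def)
      next
        case False
        then have l: "0 < ?l" using xl by linarith
        \<comment> \<open>The position of \<open>x\<close> on its fibre, between the lower end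
          \<open>\<sigma> ?q\<close> and the upper end \<open>?q\<close>.\<close>
        define t where "t = (?l + x \<bullet> n) / (2 * ?l)"
        have t: "0 \<le> t" "t \<le> 1" "t * (2 * ?l) = ?l + x \<bullet> n"
          using xl l by (auto simp: t_def divide_le_eq)
        have "(1 - t) *\<^sub>R \<sigma> ?q + t *\<^sub>R ?q = y x + (t * (2 * ?l) - ?l) *\<^sub>R n"
          unfolding \<sigma>q by (simp add: vec_eq_iff algebra_simps)
        also have "\<dots> = x" unfolding t(3) by (simp add: y_def)
        finally have "x = (1 - t) *\<^sub>R \<sigma> ?q + t *\<^sub>R ?q" by simp
        then show ?thesis
          using convexD[OF convex_convex_hull qC(2,1), of "1 - t" t] t by simp
      qed
    qed
  qed
  have "w \<notin> V" using wR \<open>w \<noteq> v\<close> by (simp add: V_eq)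
  then have cardC: "card ?C = CARD('n) + 1" using V.card V.finite by simp
  have "aff_dim P = CARD('n)"
    using aff_dim_nonempty_interior[of P] I(1) by (simp add: convex_body_def)
  then have "\<not> affine_dependent ?C"
    using P_hull finC cardC by (simp add: affine_independent_iff_card aff_dim_convex_hull)
  then show ?thesis
    unfolding simplex_def using P_hull cardC by (intro exI[of _ ?C]) simp
qed

end

subsection \<open>Reduction to isotropic position\<close>

lemma simplex_affine_image:
  fixes f :: "'a::euclidean_space \<Rightarrow> 'b::euclidean_space"
  assumes f: "linear f" "inj f" and S: "n simplex S"
  shows "n simplex ((\<lambda>x. c + f x) ` S)"
proof -
  obtain C where C: "\<not> affine_dependent C" "int (card C) = n + 1" "S = convex hull C"
    using S by (auto simp: simplex_def)
  let ?T = "\<lambda>x. c + f x"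
  have im: "?T ` X = (+) c ` (f ` X)" for X by (simp add: image_image)
  have "card (?T ` C) = card C" using f(2) by (intro card_image) (auto simp: inj_on_def inj_def)
  moreover have "aff_dim (?T ` C) = aff_dim C"
    unfolding im aff_dim_translation_eq by (rule aff_dim_injective_linear_image[OF f])
  ultimately have "\<not> affine_dependent (?T ` C)"
    using C(1) by (simp add: affine_independent_iff_card)
  moreover have "?T ` S = convex hull (?T ` C)"
    unfolding C(3) im convex_hull_translation convex_hull_linear_image[OF f(1)] ..
  ultimately show ?thesis
    unfolding simplex_def using C(2) \<open>card (?T ` C) = card C\<close> by (intro exI[of _ "?T ` C"]) simp
qed

lemma simplicial_polytope_affine_image:
  fixes f :: "real^'n \<Rightarrow> real^'n"
  assumes f: "linear f" "inj f" and P: "simplicial_polytope P"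
  shows "simplicial_polytope ((\<lambda>x. c + f x) ` P)"
  unfolding simplicial_polytope_def
proof (intro conjI allI impI)
  let ?T = "\<lambda>x. c + f x"
  have im: "?T ` X = (+) c ` (f ` X)" for X by (simp add: image_image)
  have "polytope P" using P by (simp add: simplicial_polytope_def)
  then obtain X where "finite X" "P = convex hull X" by (auto simp: polytope_def)
  then have "?T ` P = convex hull (?T ` X)"
    unfolding im by (simp only: convex_hull_translation convex_hull_linear_image[OF f(1)])
  then show "polytope (?T ` P)" using \<open>finite X\<close> by (metis finite_imageI polytope_convex_hull)
  fix F assume F: "F facet_of ?T ` P"
  then have "F \<subseteq> ?T ` P" by (rule facet_of_imp_subset)
  then obtain G where G: "F = ?T ` G" by (metis subset_imageE)
  have "G facet_of P"
    using F unfolding facet_of_def G im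
    by (simp add: face_of_translation_eq face_of_linear_image[OF f] aff_dim_translation_eq
        aff_dim_injective_linear_image[OF f])
  then obtain n where "n simplex G" using P by (auto simp: simplicial_polytope_def)
  then show "\<exists>n. n simplex F"
    unfolding G using simplex_affine_image[OF f] by blast
qed

theorem theorem2:
  fixes P :: "(real^'n) set"
  assumes "convex_body P"
    and "simplicial_polytope P"
    and "\<And>K :: (real^'n) set. convex_body K \<Longrightarrow> isotropic_constant K \<le> isotropic_constant P"
  shows "int CARD('n) simplex P"
proof -
  obtain f c where f: "linear f" "det (matrix f) \<noteq> 0" and iso: "isotropic ((\<lambda>x. c + f x) ` P)"
    using isotropic_position[OF assms(1)] .
  let ?P = "(\<lambda>x. c + f x) ` P"
  have inj: "inj f" using f det_nz_iff_inj by blast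
  \<comment> \<open>Only the maximizer is moved; its invariant stays the same, so it still dominates
    that of every convex body.\<close>
  have max: "isotropic_maximizer ?P"
    unfolding isotropic_maximizer_def affine_invariant_affine_image[OF f assms(1)]
    using iso assms(3) isotropic_constant_le_iff by blast
  obtain \<V> a where fan: "simplicial_fan ?P \<V> a"
    using simplicial_fan_exists[OF simplicial_polytope_affine_image[OF f(1) inj assms(2)] isotropic_zero_interior[OF iso]] .
  have "isotropic_maximizer_fan ?P \<V> a"
    by (intro isotropic_maximizer_fan.intro isotropic_maximizer_fan_axioms.intro fan max)
  then have simplex: "int CARD('n) simplex ?P"
    by (rule isotropic_maximizer_fan.is_simplex)
  obtain g where g: "linear g" "\<And>x. g (f x) = x"
    using linear_injective_left_inverse[OF f(1) inj] by (auto simp: o_def fun_eq_iff)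
  have "surj f" using linear_injective_imp_surjective[OF f(1) inj] by simp
  then have "inj g" using g(2) by (metis injI surjD)
  have "(\<lambda>x. - g c + g x) ` ?P = P"
    by (simp add: image_image linear_add[OF g(1)] g(2))
  then show ?thesis
    using simplex_affine_image[OF g(1) \<open>inj g\<close> simplex, of "- g c"] by simp
qed

end
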